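(* Let $t\geq 2$, let $A$ be a set of $n$ points in the plane, and let $B$ be a family of $m$ pseudo-discs in the plane. Let $G_{A,B}$ be the bipartite incidence graph with parts $A$ and $B$ in which $a\in A$ and $b\in B$ are adjacent if and only if $a\in b$. If $G_{A,B}$ is $K_{t,t}$-free, then $|E(G_{A,B})|= O(t^4n+tm)$, where the implied constant is absolute.
   Context: A family of pseudo-discs is a family of simple closed Jordan regions in the plane such that the boundaries of any two members intersect in at most two points. A bipartite graph is $K_{t,t}$-free if it contains no complete bipartite subgraph with $t$ vertices on each side. *)

theory Defs
  imports "HOL-Analysis.Analysis"
begin

text \<open>The plane is \<open>complex\<close>, the type for which the library states the Jordan curve theorem.\<close>

definition jordan_region :: "complex set \<Rightarrow> bool" where
  "jordan_region b \<longleftrightarrow>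
     (\<exists>c. simple_path c \<and> pathfinish c = pathstart c \<and> b = path_image c \<union> inside (path_image c))"

text \<open>A member listed twice would share infinitely many boundary points with its copy, so a
  family of pseudo-discs is a set of regions. Finiteness of the intersection must be stated,
  since \<open>card\<close> of an infinite set is \<open>0\<close>.\<close>

definition pseudo_discs :: "complex set set \<Rightarrow> bool" where
  "pseudo_discs B \<longleftrightarrow>
     (\<forall>b\<in>B. jordan_region b) \<and>
     (\<forall>b\<in>B. \<forall>b'\<in>B. b \<noteq> b' \<longrightarrow>
        finite (frontier b \<inter> frontier b') \<and> card (frontier b \<inter> frontier b') \<le> 2)"

text \<open>A bipartite graph with parts \<open>A\<close> and \<open>B\<close> is given by its edge set \<open>E \<subseteq> A \<times> B\<close>; the
  ordered pair \<open>(a, b)\<close> stands for the edge joining \<open>a \<in> A\<close> and \<open>b \<in> B\<close>.\<close>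

definition incidence_edges :: "'a set \<Rightarrow> 'a set set \<Rightarrow> ('a \<times> 'a set) set" where
  "incidence_edges A B = {(a, b). a \<in> A \<and> b \<in> B \<and> a \<in> b}"

definition K_free :: "nat \<Rightarrow> 'a set \<Rightarrow> 'b set \<Rightarrow> ('a \<times> 'b) set \<Rightarrow> bool" where
  "K_free t A B E \<longleftrightarrow>
     \<not> (\<exists>S T. S \<subseteq> A \<and> T \<subseteq> B \<and> finite S \<and> finite T \<and> card S = t \<and> card T = t \<and> S \<times> T \<subseteq> E)"

end

theory Submission imports Defs begin

text \<open>
  A set system is said to have linear Delaunay graphs if, for every subset \<open>X\<close> of the ground set,
  only \<open>O(|X|)\<close> pairs occur as the trace of a member on \<open>X\<close>. For points and pseudo-discs this holds
  for the discs, for their complements and for the dual system, as each of these Delaunay graphs has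
  no large complete minor. Indeed, \<open>b - b'\<close> is connected unless one disc contains the other, so a
  curve in \<open>b\<close> and a curve in \<open>b'\<close> with endpoints outside the other disc cross an even number of
  times. The crossing number is expressed by comparing two logarithms of the cross ratio of the
  four endpoints, and a parity count excludes \<open>K\<^sub>5\<close>.

  The rest is combinatorial. Sampling shows that the pairs lying in a common set of size at most
  \<open>k\<close> form a graph of degeneracy \<open>O(k)\<close>. Hence, if \<open>m\<close> sets have size about \<open>k\<close>, then \<open>m k / (2 n)\<close>
  of them are dense on a common set of \<open>O(k)\<close> points. The linear Delaunay property bounds the VC
  dimension, so a constant fraction of these sets nearly contain a fixed large set \<open>S\<close>, and the
  degeneracy argument for the complements confines what many of them miss of \<open>S\<close> to half of \<open>S\<close>,
  which yields \<open>K\<^sub>t\<^sub>,\<^sub>t\<close>. So without \<open>K\<^sub>t\<^sub>,\<^sub>t\<close> sets of size at least a multiple of \<open>t\<close> are few compared to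
  the points, and dually points of degree at least a multiple of \<open>t\<^sup>2\<close> are few compared to the sets;
  both cannot hold if all degrees are large, so successive deletion of a set or point of small
  degree exhausts the system.
\<close>

section \<open>Jordan regions\<close>

text \<open>No graph is ever drawn: the boundaries are arbitrary Jordan curves, which may touch
  without crossing, so crossings cannot simply be counted. Their parity is replaced by an identity
  between logarithm changes that mentions only endpoints. The identity is additive under
  concatenation, so an edge of a minor may be a walk through several regions. The complementary
  system is controlled only for points against discs. Both halves of the final count therefore feed
  the same biclique lemma, which wants a multiple of \<open>t\<close> points and a multiple of
  \<open>t ^ 2\<close> discs. This is the source of the asymmetric degree thresholds. The edge bound
  that results has the form \<open>D * t ^ 2 * n + C * t * m\<close>, which lies below the claimed
  one.\<close>

lemma jordan_curve_parts:
  fixes c :: "real \<Rightarrow> complex"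
  assumes "simple_path c" "pathfinish c = pathstart c"
  shows "open (inside (path_image c))" "connected (inside (path_image c))"
    "open (outside (path_image c))" "connected (outside (path_image c))"
    "bounded (inside (path_image c))" "\<not> bounded (outside (path_image c))"
    "inside (path_image c) \<inter> outside (path_image c) = {}"
    "inside (path_image c) \<inter> path_image c = {}"
    "outside (path_image c) \<inter> path_image c = {}"
    "- (path_image c \<union> inside (path_image c)) = outside (path_image c)"
    "closure (inside (path_image c)) = path_image c \<union> inside (path_image c)"
    "frontier (path_image c \<union> inside (path_image c)) = path_image c"
proof -
  note J = Jordan_inside_outside [OF assms]
  show 10: "- (path_image c \<union> inside (path_image c)) = outside (path_image c)"
    by (simp add: union_with_inside)
  show "closure (inside (path_image c)) = path_image c \<union> inside (path_image c)"
    using J by (simp add: closure_Un_frontier Un_commute)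
  show "frontier (path_image c \<union> inside (path_image c)) = path_image c"
    using J 10 by (metis frontier_complement)
qed (use Jordan_inside_outside [OF assms] in \<open>auto simp: inside_no_overlap outside_no_overlap\<close>)

lemma jordan_regionE:
  assumes "jordan_region b"
  obtains c where "simple_path c" "pathfinish c = pathstart c"
    "frontier b = path_image c" "b = path_image c \<union> inside (path_image c)"
    "- b = outside (path_image c)" "closure (inside (path_image c)) = b"
proof -
  obtain c where c: "simple_path c" "pathfinish c = pathstart c"
    and b: "b = path_image c \<union> inside (path_image c)"
    using assms unfolding jordan_region_def by blast
  show thesis
    using that [OF c] jordan_curve_parts(10-12) [OF c] b by simp
qed

lemma jordan_region_compact:
  assumes "jordan_region b" shows "compact b"
proof -
  obtain c where c: "simple_path c" "pathfinish c = pathstart c" "closure (inside (path_image c)) = b"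
    using jordan_regionE [OF assms] by metis
  have "compact (closure (inside (path_image c)))"
    using Jordan_inside_outside [OF c(1,2)] by (simp add: compact_closure)
  then show ?thesis by (simp only: c(3))
qed

lemma jordan_region_connected:
  assumes "jordan_region b" shows "connected b"
proof -
  obtain c where c: "simple_path c" "pathfinish c = pathstart c" "closure (inside (path_image c)) = b"
    using jordan_regionE [OF assms] by metis
  have "connected (closure (inside (path_image c)))"
    using Jordan_inside_outside [OF c(1,2)] by (simp add: connected_imp_connected_closure)
  then show ?thesis by (simp only: c(3))
qed

lemma jordan_region_connected_complement:
  assumes "jordan_region b" shows "connected (- b)"
proof -
  obtain c where c: "simple_path c" "pathfinish c = pathstart c" "- b = outside (path_image c)"
    using jordan_regionE [OF assms] by metis
  show ?thesis
    using Jordan_inside_outside [OF c(1,2)] by (simp add: c(3))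
qed

lemma connected_subset_inside_or_outside:
  fixes S :: "complex set" and c :: "real \<Rightarrow> complex"
  assumes c: "simple_path c" "pathfinish c = pathstart c"
    and S: "connected S" "S \<inter> path_image c = {}"
  shows "S \<subseteq> inside (path_image c) \<or> S \<subseteq> outside (path_image c)"
proof -
  note J = jordan_curve_parts [OF c]
  have "S \<subseteq> inside (path_image c) \<union> outside (path_image c)"
    using J(10) S(2) by blast
  then show ?thesis
    using connectedD [OF S(1) J(1,3)] J(7) by blast
qed

text \<open>If \<open>c\<close> misses the inside of \<open>d\<close>, this connected inside lies on
  one side of \<open>c\<close>, and lying inside would give containment of the closures. If
  \<open>d\<close> missed the outside of \<open>c\<close>, this connected unbounded set would lie
  outside \<open>d\<close>, and complements would give containment.\<close>

lemma jordan_curve_one_sided: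
  fixes c d :: "real \<Rightarrow> complex"
  assumes c: "simple_path c" "pathfinish c = pathstart c"
    and d: "simple_path d" "pathfinish d = pathstart d"
    and nsub: "\<not> path_image d \<union> inside (path_image d) \<subseteq> path_image c \<union> inside (path_image c)"
  shows "path_image c \<inter> inside (path_image d) = {} \<Longrightarrow>
           inside (path_image d) \<inter> (path_image c \<union> inside (path_image c)) = {}"
    and "path_image d \<inter> outside (path_image c) \<noteq> {}"
proof -
  note C = jordan_curve_parts [OF c] and D = jordan_curve_parts [OF d]
  show "inside (path_image d) \<inter> (path_image c \<union> inside (path_image c)) = {}"
    if "path_image c \<inter> inside (path_image d) = {}"
  proof -
    have "inside (path_image d) \<subseteq> inside (path_image c) \<or> inside (path_image d) \<subseteq> outside (path_image c)"
      using connected_subset_inside_or_outside [OF c D(2)] that by blast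
    moreover have "\<not> inside (path_image d) \<subseteq> inside (path_image c)"
      using closure_mono C(11) D(11) nsub by metis
    ultimately show ?thesis
      using C(10) by blast
  qed
  show "path_image d \<inter> outside (path_image c) \<noteq> {}"
  proof
    assume e: "path_image d \<inter> outside (path_image c) = {}"
    have "outside (path_image c) \<subseteq> inside (path_image d) \<or> outside (path_image c) \<subseteq> outside (path_image d)"
      using connected_subset_inside_or_outside [OF d C(4)] e by blast
    moreover have "\<not> outside (path_image c) \<subseteq> inside (path_image d)"
      using bounded_subset C(6) D(5) by metis
    ultimately have "outside (path_image c) \<subseteq> outside (path_image d)" by blast
    then show False
      using C(10) D(10) nsub by blast
  qed
qed

text \<open>A point of \<open>c\<close> inside \<open>d\<close> and one outside \<open>d\<close> cut
  \<open>c\<close> into two arcs. Each arc meets \<open>d\<close>, and the two hits differ because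
  the arcs share only points off \<open>d\<close>.\<close>

lemma jordan_curve_crossing_arcs:
  fixes c d :: "real \<Rightarrow> complex"
  assumes c: "simple_path c" "pathfinish c = pathstart c"
    and d: "simple_path d" "pathfinish d = pathstart d"
    and fin: "finite (path_image c \<inter> path_image d)" "card (path_image c \<inter> path_image d) \<le> 2"
    and I: "path_image c \<inter> inside (path_image d) \<noteq> {}"
    and O: "path_image c \<inter> outside (path_image d) \<noteq> {}"
  obtains p q where "p \<noteq> q" "path_image c \<inter> path_image d = {p, q}"
proof -
  note D = jordan_curve_parts [OF d]
  obtain u v where u: "u \<in> path_image c" "u \<in> inside (path_image d)"
    and v: "v \<in> path_image c" "v \<in> outside (path_image d)"
    using I O by blast
  then have "u \<noteq> v" using D(7) by blast
  obtain g h where gh: "arc g" "arc h" "pathstart g = u" "pathfinish g = v"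
      "pathstart h = v" "pathfinish h = u"
      "path_image g \<inter> path_image h = {u, v}" "path_image g \<union> path_image h = path_image c"
    using exists_double_arc [OF c u(1) v(1) \<open>u \<noteq> v\<close>] by metis
  have hit: "path_image k \<inter> path_image d \<noteq> {}"
    if "arc k" "u \<in> path_image k" "v \<in> path_image k" for k
    using connected_subset_inside_or_outside [OF d, of "path_image k"] connected_arc_image [OF that(1)]
      that u v D(7) by blast
  obtain p where p: "p \<in> path_image g" "p \<in> path_image d"
    using hit [OF gh(1)] gh pathstart_in_path_image pathfinish_in_path_image by blast
  obtain q where q: "q \<in> path_image h" "q \<in> path_image d"
    using hit [OF gh(2)] gh pathstart_in_path_image pathfinish_in_path_image by blast
  have "u \<notin> path_image d" "v \<notin> path_image d"
    using u v D(8,9) by blast+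
  then have "p \<noteq> q"
    using p q gh(7) by (metis IntI insertE singletonD)
  moreover have "{p, q} \<subseteq> path_image c \<inter> path_image d"
    using p q gh(8) by auto
  ultimately have "path_image c \<inter> path_image d = {p, q}"
    using fin by (metis card_2_iff card_seteq)
  then show thesis using that \<open>p \<noteq> q\<close> by blast
qed

text \<open>Without its endpoints each arc of \<open>c\<close> is connected and avoids
  \<open>d\<close>, hence stays on one side. Both sides occur, so each belongs to one arc.\<close>

lemma jordan_curve_sided_arcs:
  fixes c d :: "real \<Rightarrow> complex"
  assumes c: "simple_path c" "pathfinish c = pathstart c"
    and d: "simple_path d" "pathfinish d = pathstart d"
    and pq: "p \<noteq> q" "path_image c \<inter> path_image d = {p, q}"
    and I: "path_image c \<inter> inside (path_image d) \<noteq> {}"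
    and O: "path_image c \<inter> outside (path_image d) \<noteq> {}"
  obtains g h where "arc g" "arc h" "pathstart g = p" "pathfinish g = q"
    "pathstart h = p" "pathfinish h = q"
    "path_image g \<inter> path_image h = {p, q}" "path_image g \<union> path_image h = path_image c"
    "path_image g - {p, q} \<subseteq> inside (path_image d)"
    "path_image h - {p, q} \<subseteq> outside (path_image d)"
proof -
  note D = jordan_curve_parts [OF d]
  have "p \<in> path_image c" "q \<in> path_image c" using pq by blast+
  then obtain g h where gh: "arc g" "arc h" "pathstart g = p" "pathfinish g = q"
      "pathstart h = q" "pathfinish h = p"
      "path_image g \<inter> path_image h = {p, q}" "path_image g \<union> path_image h = path_image c"
    using exists_double_arc [OF c] pq(1) by metis
  define h' where "h' = reversepath h"
  have h': "arc h'" "pathstart h' = p" "pathfinish h' = q" "path_image h' = path_image h"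
    using gh by (auto simp: h'_def arc_reversepath)
  have side: "path_image k - {p, q} \<subseteq> inside (path_image d) \<or> path_image k - {p, q} \<subseteq> outside (path_image d)"
    if "arc k" "pathstart k = p" "pathfinish k = q" "path_image k \<subseteq> path_image c" for k
  proof (rule connected_subset_inside_or_outside [OF d])
    show "connected (path_image k - {p, q})"
      using connected_simple_path_endless [of k] arc_imp_simple_path that by force
    show "(path_image k - {p, q}) \<inter> path_image d = {}"
      using that(4) pq(2) by blast
  qed
  have sg: "path_image g - {p, q} \<subseteq> inside (path_image d) \<or> path_image g - {p, q} \<subseteq> outside (path_image d)"
    using side [of g] gh by blast
  have sh: "path_image h' - {p, q} \<subseteq> inside (path_image d) \<or> path_image h' - {p, q} \<subseteq> outside (path_image d)"
    using side [of h'] gh h' by blast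
  have pqd: "p \<in> path_image d" "q \<in> path_image d" using pq by blast+
  show thesis
  proof (cases "path_image g - {p, q} \<subseteq> inside (path_image d)")
    case True
    then have "\<not> path_image h' - {p, q} \<subseteq> inside (path_image d)"
      using O D(7,9) pqd True unfolding gh(8) [symmetric] h'(4) by blast
    then show thesis
      using that [of g h'] True sh gh h' by auto
  next
    case False
    then have g_out: "path_image g - {p, q} \<subseteq> outside (path_image d)"
      using sg by blast
    then have "\<not> path_image h' - {p, q} \<subseteq> outside (path_image d)"
      using I D(7,8) pqd g_out unfolding gh(8) [symmetric] h'(4) by blast
    then show thesis
      using that [of h' g] g_out sh gh h' by auto
  qed
qed

text \<open>The difference is squeezed between a connected open set and its closure. If
  \<open>c\<close> does not enter the inside of \<open>d\<close>, this set is the inside of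
  \<open>c\<close>. Otherwise the boundaries cross at exactly two points, an arc of \<open>d\<close>
  cuts the inside of \<open>c\<close> into two pieces, and the set is the piece outside
  \<open>d\<close>.\<close>

lemma jordan_region_diff_connected:
  assumes b: "jordan_region b" "jordan_region b'"
    and fin: "finite (frontier b \<inter> frontier b')" "card (frontier b \<inter> frontier b') \<le> 2"
    and nsub: "\<not> b \<subseteq> b'" "\<not> b' \<subseteq> b"
  shows "connected (b - b')"
proof -
  obtain c where c: "simple_path c" "pathfinish c = pathstart c" and bc:
    "frontier b = path_image c" "b = path_image c \<union> inside (path_image c)"
    "- b = outside (path_image c)" "closure (inside (path_image c)) = b"
    using jordan_regionE [OF b(1)] by metis
  obtain d where d: "simple_path d" "pathfinish d = pathstart d" and bd:
    "frontier b' = path_image d" "b' = path_image d \<union> inside (path_image d)"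
    "- b' = outside (path_image d)" "closure (inside (path_image d)) = b'"
    using jordan_regionE [OF b(2)] by metis
  note C = jordan_curve_parts [OF c] and D = jordan_curve_parts [OF d]
  note one_cd = jordan_curve_one_sided [OF c d nsub(2) [unfolded bc(2) bd(2)], folded bc(2) bd(2)]
  note one_dc = jordan_curve_one_sided [OF d c nsub(1) [unfolded bc(2) bd(2)], folded bc(2) bd(2)]
  show ?thesis
  proof (cases "path_image c \<inter> inside (path_image d) = {}")
    case True
    then have "inside (path_image d) \<inter> b = {}"
      using one_cd(1) by blast
    then have "inside (path_image c) \<inter> closure (inside (path_image d)) = {}"
      using C(1) bc(2) open_Int_closure_eq_empty by blast
    then have "inside (path_image c) \<subseteq> b - b'"
      using bc(2) bd(4) by blast
    moreover have "b - b' \<subseteq> closure (inside (path_image c))"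
      using bc(4) by blast
    ultimately show ?thesis
      using C(2) connected_intermediate_closure by blast
  next
    case cI: False
    have cO: "path_image c \<inter> outside (path_image d) \<noteq> {}"
      using one_dc(2) .
    have dO: "path_image d \<inter> outside (path_image c) \<noteq> {}"
      using one_cd(2) .
    have dI: "path_image d \<inter> inside (path_image c) \<noteq> {}"
    proof
      assume "path_image d \<inter> inside (path_image c) = {}"
      then have "inside (path_image c) \<inter> b' = {}"
        using one_dc(1) by blast
      then have "inside (path_image d) \<inter> closure (inside (path_image c)) = {}"
        using D(1) bd(2) open_Int_closure_eq_empty by blast
      then show False using cI bc(2,4) by blast
    qed
    obtain p q where pq: "p \<noteq> q" "path_image c \<inter> path_image d = {p, q}"
      using jordan_curve_crossing_arcs [OF c d _ _ cI cO] fin bc(1) bd(1) by metis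
    obtain g h where gh: "arc g" "arc h" "pathstart g = p" "pathfinish g = q"
        "pathstart h = p" "pathfinish h = q"
        "path_image g \<inter> path_image h = {p, q}" "path_image g \<union> path_image h = path_image c"
        "path_image g - {p, q} \<subseteq> inside (path_image d)"
        "path_image h - {p, q} \<subseteq> outside (path_image d)"
      using jordan_curve_sided_arcs [OF c d pq cI cO] .
    have pq': "path_image d \<inter> path_image c = {p, q}" using pq by blast
    obtain k l where kl: "arc k" "arc l" "pathstart k = p" "pathfinish k = q"
        "pathstart l = p" "pathfinish l = q"
        "path_image k \<inter> path_image l = {p, q}" "path_image k \<union> path_image l = path_image d"
        "path_image k - {p, q} \<subseteq> inside (path_image c)"
        "path_image l - {p, q} \<subseteq> outside (path_image c)"
      using jordan_curve_sided_arcs [OF d c pq(1) pq' dI dO] .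
    have ends: "{p, q} \<subseteq> path_image g" "{p, q} \<subseteq> path_image h" "{p, q} \<subseteq> path_image k"
      using gh kl pathstart_in_path_image pathfinish_in_path_image by (metis empty_subsetI insert_subset)+
    have sub: "path_image g \<subseteq> path_image c" "path_image h \<subseteq> path_image c"
        "path_image k \<subseteq> path_image d" "path_image l \<subseteq> path_image d"
      using gh(8) kl(8) by auto
    have gk: "path_image g \<inter> path_image k = {p, q}"
      using Int_mono [OF sub(1,3)] ends pq(2) by auto
    have hk: "path_image h \<inter> path_image k = {p, q}"
      using Int_mono [OF sub(2,3)] ends pq(2) by auto
    have kne: "path_image k - {p, q} \<noteq> {}"
      using nonempty_simple_path_endless [of k] kl arc_imp_simple_path by metis
    \<comment> \<open>\<open>k\<close> is a crosscut of the inside of \<open>c\<close>, so the theta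
      curve formed by \<open>g\<close>, \<open>h\<close> and \<open>k\<close> bounds two pieces,
      \<open>P\<close> and \<open>Q\<close>.\<close>
    have "path_image k \<inter> inside (path_image g \<union> path_image h) \<noteq> {}"
      using kne kl(9) gh(8) by auto
    then have split: "inside (path_image g \<union> path_image k) \<union> inside (path_image h \<union> path_image k) \<union>
           (path_image k - {p, q}) = inside (path_image c)"
      using split_inside_simple_closed_curve [of g p q h k] gh kl pq(1) gk hk arc_imp_simple_path
      by metis
    have loop: "simple_path (m +++ reversepath k)" "pathfinish (m +++ reversepath k) = pathstart (m +++ reversepath k)"
        "path_image (m +++ reversepath k) = path_image m \<union> path_image k"
      if "arc m" "pathstart m = p" "pathfinish m = q" "path_image m \<inter> path_image k = {p, q}" for m
      using that kl by (auto simp: simple_path_join_loop_eq arc_reversepath path_image_join)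
    define P where "P = inside (path_image g \<union> path_image k)"
    define Q where "Q = inside (path_image h \<union> path_image k)"
    have P: "connected P" "frontier P = path_image g \<union> path_image k"
      using Jordan_inside_outside [OF loop(1,2) [of g]] loop(3) [of g] gh gk unfolding P_def by auto
    have Q: "connected Q" "frontier Q = path_image h \<union> path_image k"
      using Jordan_inside_outside [OF loop(1,2) [of h]] loop(3) [of h] gh hk unfolding Q_def by auto
    have "P \<inter> (path_image g \<union> path_image k) = {}" "Q \<inter> (path_image h \<union> path_image k) = {}"
      unfolding P_def Q_def by (simp_all add: inside_no_overlap)
    moreover have "P \<subseteq> inside (path_image c)" "Q \<subseteq> inside (path_image c)"
      using split unfolding P_def Q_def by blast+
    \<comment> \<open>\<open>l\<close> runs outside \<open>c\<close>, so \<open>P\<close> and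
      \<open>Q\<close>, which avoid \<open>k\<close>, avoid all of \<open>d\<close>.\<close>
    moreover have "path_image l \<inter> inside (path_image c) = {}"
    proof -
      have "p \<in> path_image c" "q \<in> path_image c" using pq(2) by blast+
      then show ?thesis using kl(10) C(7,8) by blast
    qed
    ultimately have disj: "P \<inter> path_image d = {}" "Q \<inter> path_image d = {}"
      unfolding kl(8) [symmetric] by blast+
    have gne: "path_image g - {p, q} \<noteq> {}" and hne: "path_image h - {p, q} \<noteq> {}"
      using nonempty_simple_path_endless gh arc_imp_simple_path by metis+
    \<comment> \<open>\<open>g\<close> lies on the frontier of \<open>P\<close> and runs inside
      \<open>d\<close>, so the open inside of \<open>d\<close> meets \<open>P\<close>. In the same
      way \<open>h\<close> places \<open>Q\<close> outside \<open>d\<close>.\<close>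
    have "P \<inter> inside (path_image d) \<noteq> {}"
    proof -
      have "closure P \<inter> inside (path_image d) \<noteq> {}"
        using gne gh(9) P(2) by (auto simp: closure_Un_frontier)
      then show ?thesis using D(1,3) open_Int_closure_eq_empty by (metis Int_commute)
    qed
    then have P_in: "P \<subseteq> inside (path_image d)"
      using connected_subset_inside_or_outside [OF d P(1) disj(1)] D(7) by blast
    have "Q \<inter> outside (path_image d) \<noteq> {}"
    proof -
      have "closure Q \<inter> outside (path_image d) \<noteq> {}"
        using hne gh(10) Q(2) by (auto simp: closure_Un_frontier)
      then show ?thesis using D(1,3) open_Int_closure_eq_empty by (metis Int_commute)
    qed
    then have Q_out: "Q \<subseteq> outside (path_image d)"
      using connected_subset_inside_or_outside [OF d Q(1) disj(2)] D(7) by blast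
    have b_eq: "b = path_image g \<union> path_image h \<union> P \<union> Q \<union> path_image k"
      using split bc(2) gh(8) ends unfolding P_def Q_def by auto
    have "Q \<subseteq> b - b'"
      using Q_out b_eq bd(3) by blast
    moreover have "b - b' \<subseteq> path_image h \<union> Q"
    proof -
      have "path_image g \<subseteq> b'"
        using gh(9) bd(2) pq' by blast
      moreover have "P \<subseteq> b'" "path_image k \<subseteq> b'"
        using P_in bd(2) kl(8) by blast+
      ultimately show ?thesis using b_eq by blast
    qed
    moreover have "path_image h \<union> Q \<subseteq> closure Q"
      using Q(2) by (auto simp: closure_Un_frontier)
    ultimately show ?thesis
      using connected_intermediate_closure [OF Q(1)] by blast
  qed
qed

section \<open>Change of the logarithm inside a Jordan region\<close>

text \<open>The values are logarithms of 1, hence multiples of 2 \<pi> \<i>, and a continuous map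
  from a connected set to a discrete one is constant.\<close>

lemma continuous_log_of_one_constant:
  fixes f :: "'a::topological_space \<Rightarrow> complex"
  assumes S: "connected S" and f: "continuous_on S f" and 1: "\<And>x. x \<in> S \<Longrightarrow> exp (f x) = 1"
    and xy: "x \<in> S" "y \<in> S"
  shows "f x = f y"
proof -
  have "f constant_on S"
  proof (rule continuous_discrete_range_constant [OF S f])
    fix x assume x: "x \<in> S"
    have "2 * pi \<le> norm (f y - f x)" if y: "y \<in> S" "f y \<noteq> f x" for y
    proof -
      obtain m n :: int where mn: "f x = of_int (2 * m) * pi * \<i>" "f y = of_int (2 * n) * pi * \<i>"
        using 1 [OF x] 1 [OF y(1)] exp_eq [of _ 0] by auto
      then have "f y - f x = of_int (n - m) * (2 * of_real pi * \<i>)"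
        by (simp add: algebra_simps)
      then have d: "norm (f y - f x) = \<bar>of_int (n - m)\<bar> * (2 * pi)"
        by (simp only: norm_mult norm_of_int) simp
      have "n \<noteq> m" using mn y(2) by auto
      then have "(1::real) \<le> \<bar>of_int (n - m)\<bar>" by linarith
      then have "2 * pi * 1 \<le> 2 * pi * \<bar>real_of_int (n - m)\<bar>"
        by (intro mult_left_mono) auto
      then show ?thesis unfolding d by (simp add: mult.commute)
    qed
    then show "\<exists>e>0. \<forall>y. y \<in> S \<and> f y \<noteq> f x \<longrightarrow> e \<le> norm (f y - f x)"
      using pi_gt_zero by (intro exI [of _ "2 * pi"]) auto
  qed
  then show ?thesis using xy unfolding constant_on_def by auto
qed

text \<open>The choice is harmless for \<open>x\<close>, \<open>y\<close> in a Jordan region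
  \<open>b\<close>: two branches differ by a constant there, so any branch computes the value. For
  \<open>c\<close> in \<open>b\<close> no branch exists and the value is arbitrary.\<close>

definition log_change :: "complex set \<Rightarrow> complex \<Rightarrow> complex \<Rightarrow> complex \<Rightarrow> complex" where
  "log_change b x y c =
     (SOME d. \<exists>L. continuous_on b L \<and> (\<forall>z\<in>b. exp (L z) = z - c) \<and> d = L y - L x)"

lemma log_change_eq:
  assumes b: "jordan_region b" and L: "continuous_on b L" "\<And>z. z \<in> b \<Longrightarrow> exp (L z) = z - c"
    and xy: "x \<in> b" "y \<in> b"
  shows "log_change b x y c = L y - L x"
proof -
  have "\<exists>d L. continuous_on b L \<and> (\<forall>z\<in>b. exp (L z) = z - c) \<and> d = L y - L x"
    using L by blast
  then have "\<exists>L'. continuous_on b L' \<and> (\<forall>z\<in>b. exp (L' z) = z - c) \<and> log_change b x y c = L' y - L' x"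
    unfolding log_change_def by (rule someI_ex)
  then obtain L' where L': "continuous_on b L'" "\<And>z. z \<in> b \<Longrightarrow> exp (L' z) = z - c"
    "log_change b x y c = L' y - L' x" by blast
  have "L' x - L x = L' y - L y"
  proof (rule continuous_log_of_one_constant [where f = "\<lambda>z. L' z - L z", OF jordan_region_connected [OF b] _ _ xy])
    show "continuous_on b (\<lambda>z. L' z - L z)"
      using L L' by (intro continuous_intros) auto
    show "exp (L' z - L z) = 1" if "z \<in> b" for z
      by (metis L(2) L'(2) that exp_diff divide_self exp_not_eq_zero)
  qed
  then show ?thesis using L'(3) by (metis diff_diff_eq2 diff_add_eq add_diff_cancel_left' add.commute)
qed

text \<open>A compact set that does not separate the plane is Borsukian: continuous functions
  without zeros have logarithms on it.\<close>

lemma jordan_region_log: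
  assumes b: "jordan_region b" and c: "c \<notin> b"
  obtains L where "continuous_on b L" "\<And>z. z \<in> b \<Longrightarrow> exp (L z) = z - c"
proof -
  have "Borsukian b"
    using Borsukian_separation_compact [OF jordan_region_compact [OF b]]
      jordan_region_connected_complement [OF b] by blast
  moreover have "continuous_on b (\<lambda>z. z - c)" "(\<lambda>z. z - c) \<in> b \<rightarrow> - {0}"
    using c by (auto intro!: continuous_intros)
  ultimately obtain L where "continuous_on b L" "\<forall>z\<in>b. z - c = exp (L z)"
    unfolding Borsukian_continuous_logarithm by blast
  then show thesis using that by metis
qed

lemma exp_log_change:
  assumes b: "jordan_region b" and c: "c \<notin> b" and xy: "x \<in> b" "y \<in> b"
  shows "exp (log_change b x y c) = (y - c) / (x - c)"
proof -
  obtain L where L: "continuous_on b L" "\<And>z. z \<in> b \<Longrightarrow> exp (L z) = z - c"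
    using jordan_region_log [OF b c] by blast
  show ?thesis
    using log_change_eq [OF b L xy] L(2) xy by (simp add: exp_diff)
qed

lemma log_change_refl: "jordan_region b \<Longrightarrow> c \<notin> b \<Longrightarrow> x \<in> b \<Longrightarrow> log_change b x x c = 0"
  using jordan_region_log log_change_eq by (metis diff_self)

lemma log_change_continuous_left:
  assumes b: "jordan_region b" and c: "c \<notin> b" and x: "x \<in> b"
  shows "continuous_on b (\<lambda>y. log_change b x y c)"
proof -
  obtain L where L: "continuous_on b L" "\<And>z. z \<in> b \<Longrightarrow> exp (L z) = z - c"
    using jordan_region_log [OF b c] by blast
  have "continuous_on b (\<lambda>y. L y - L x)"
    using L(1) by (intro continuous_intros)
  then show ?thesis
    using log_change_eq [OF b L x] by (subst continuous_on_cong [OF refl]) auto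
qed

text \<open>Near \<open>c0\<close> a logarithm of \<open>z - c\<close> on \<open>b\<close> is obtained from one of \<open>z - c0\<close> by adding
  \<open>Ln (1 - (c - c0) / (z - c0))\<close>.\<close>

lemma log_change_continuous_right:
  assumes b: "jordan_region b" and xy: "x \<in> b" "y \<in> b"
  shows "continuous_on (- b) (log_change b x y)"
proof -
  have "isCont (log_change b x y) c0" if c0: "c0 \<in> - b" for c0
  proof -
    have "open (- b)"
      using jordan_region_compact [OF b] by (simp add: compact_imp_closed open_Compl)
    then obtain r where r: "r > 0" "ball c0 r \<subseteq> - b"
      using c0 open_contains_ball by blast
    have far: "r \<le> norm (z - c0)" if "z \<in> b" for z
      using r(2) that by (force simp: dist_norm norm_minus_commute subset_iff)
    have "c0 \<notin> b" using c0 by simp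
    then obtain L where L: "continuous_on b L" "\<And>z. z \<in> b \<Longrightarrow> exp (L z) = z - c0"
      using jordan_region_log [OF b] by blast
    \<comment> \<open>The quotient has modulus below 1 on \<open>b\<close>, which keeps the argument
      of \<open>Ln\<close> in the right half-plane, away from the cut.\<close>
    have Re1: "Re (1 - (c - c0) / (z - c0)) > 0" if "z \<in> b" "c \<in> ball c0 r" for z c
    proof -
      have "norm ((c - c0) / (z - c0)) < 1"
        using that far [OF that(1)] r(1)
        by (auto simp: norm_divide dist_norm norm_minus_commute divide_less_eq)
      then show ?thesis using complex_Re_le_cmod [of "(c - c0) / (z - c0)"] by simp
    qed
    then have nonneg: "1 - (c - c0) / (z - c0) \<notin> \<real>\<^sub>\<le>\<^sub>0" if "z \<in> b" "c \<in> ball c0 r" for z c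
      using that by (auto simp: complex_nonpos_Reals_iff not_le)
    have loc: "log_change b x y c = L y + Ln (1 - (c - c0) / (y - c0)) - (L x + Ln (1 - (c - c0) / (x - c0)))"
      if c: "c \<in> ball c0 r" for c
    proof (rule log_change_eq [OF b _ _ xy])
      show "continuous_on b (\<lambda>z. L z + Ln (1 - (c - c0) / (z - c0)))"
        using nonneg [OF _ c] far r(1) L(1) by (intro continuous_intros) force+
      show "exp (L z + Ln (1 - (c - c0) / (z - c0))) = z - c" if z: "z \<in> b" for z
      proof -
        have "z - c0 \<noteq> 0" using far [OF z] r(1) by auto
        then have "(z - c0) * (1 - (c - c0) / (z - c0)) = z - c" by (simp add: field_simps)
        moreover have "1 - (c - c0) / (z - c0) \<noteq> 0" using Re1 [OF z c] by force
        ultimately show ?thesis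
          unfolding exp_add L(2) [OF z] by simp
      qed
    qed
    have "isCont (\<lambda>c. L y + Ln (1 - (c - c0) / (y - c0)) - (L x + Ln (1 - (c - c0) / (x - c0)))) c0"
      using far xy r(1) by (intro continuous_intros) force+
    moreover have "\<forall>\<^sub>F c in nhds c0. log_change b x y c =
        L y + Ln (1 - (c - c0) / (y - c0)) - (L x + Ln (1 - (c - c0) / (x - c0)))"
      using loc r(1) by (intro eventually_nhds_in_open [THEN eventually_mono, of "ball c0 r"]) auto
    ultimately show ?thesis
      by (simp add: isCont_cong)
  qed
  then show ?thesis
    by (simp add: continuous_at_imp_continuous_on)
qed

text \<open>For fixed \<open>z, w\<close> both sides are logarithms of the same cross ratio, so they differ by a
  constant as \<open>y\<close> runs through the connected set \<open>b - b'\<close>; the constant vanishes at \<open>y = x\<close>.\<close>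

lemma log_change_symmetric:
  assumes b: "jordan_region b" "jordan_region b'"
    and fin: "finite (frontier b \<inter> frontier b')" "card (frontier b \<inter> frontier b') \<le> 2"
    and xy: "x \<in> b - b'" "y \<in> b - b'" and zw: "z \<in> b' - b" "w \<in> b' - b"
  shows "log_change b x y w - log_change b x y z = log_change b' z w y - log_change b' z w x"
proof -
  define f where "f y = log_change b x y w - log_change b x y z - (log_change b' z w y - log_change b' z w x)" for y
  have "f x = f y"
  proof (rule continuous_log_of_one_constant [of "b - b'" f])
    show "connected (b - b')"
      using jordan_region_diff_connected [OF b fin] xy zw by blast
    have "continuous_on (b - b') (log_change b' z w)"
      using log_change_continuous_right [OF b(2)] zw by (rule_tac continuous_on_subset) auto
    moreover have "continuous_on (b - b') (\<lambda>y. log_change b x y u)" if "u \<in> b' - b" for u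
      using log_change_continuous_left [OF b(1), of u x] xy that by (rule_tac continuous_on_subset) auto
    ultimately show "continuous_on (b - b') f"
      unfolding f_def using zw by (intro continuous_intros) auto
    \<comment> \<open>The two cross ratios agree because exchanging the pairs changes the sign of
      all four factors.\<close>
    show "exp (f u) = 1" if "u \<in> b - b'" for u
    proof -
      have "u \<noteq> z" "u \<noteq> w" "x \<noteq> z" "x \<noteq> w" using that xy zw by auto
      then show ?thesis
        unfolding f_def using that xy zw by (simp add: exp_diff exp_log_change [OF b(1)] exp_log_change [OF b(2)] divide_simps)
          (simp add: algebra_simps)
    qed
  qed (use xy in auto)
  moreover have "f x = 0"
    unfolding f_def using log_change_refl b xy zw by simp
  ultimately show ?thesis unfolding f_def by simp
qed

section \<open>Even drawings of the complete graph on five vertices\<close>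

text \<open>Writing \<open>T i j k\<close> as a difference of fixed logarithms plus \<open>2 \<pi> \<i> N i j k\<close>, the symmetry
  becomes a parity statement about the integers \<open>N i j k\<close>: its two sides differ by an odd number
  exactly if \<open>{i, j}\<close> and \<open>{k, l}\<close> interleave. Among the 15 pairs of disjoint edges of \<open>K\<^sub>5\<close> five
  interleave, while every \<open>N i j k\<close> occurs in exactly two of the equations.\<close>

lemma even_drawing_K5_impossible:
  fixes v :: "nat \<Rightarrow> complex" and T :: "nat \<Rightarrow> nat \<Rightarrow> nat \<Rightarrow> complex"
  assumes inj: "inj_on v {..<5}"
    and T: "\<And>i j k. i < j \<Longrightarrow> j < 5 \<Longrightarrow> k < 5 \<Longrightarrow> k \<noteq> i \<Longrightarrow> k \<noteq> j \<Longrightarrow>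
              exp (T i j k) = (v j - v k) / (v i - v k)"
    and sym: "\<And>i j k l. i < j \<Longrightarrow> j < 5 \<Longrightarrow> k < l \<Longrightarrow> l < 5 \<Longrightarrow> {i, j} \<inter> {k, l} = {} \<Longrightarrow>
              T i j l - T i j k = T k l j - T k l i"
  shows False
proof -
  \<comment> \<open>Each unordered pair gets one logarithm, that of the difference with the larger
    index first. Reversing the difference costs a half turn, which \<open>\<sigma>\<close>
    records.\<close>
  define \<mu> where "\<mu> u w = Ln (v (max u w) - v (min u w))" for u w
  define \<sigma> :: "nat \<Rightarrow> nat \<Rightarrow> int" where "\<sigma> u w = (if u < w then 0 else 1)" for u w
  have ne: "v u \<noteq> v w" if "u < 5" "w < 5" "u \<noteq> w" for u w
    using inj that by (auto simp: inj_on_def)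
  have exp_\<mu>: "exp (\<mu> u w + of_int (\<sigma> u w) * (pi * \<i>)) = v w - v u" if "u < 5" "w < 5" "u \<noteq> w" for u w
    using ne [OF that] that by (auto simp: \<mu>_def \<sigma>_def exp_add max_def min_def)
  have "\<exists>n. T i j k = \<mu> k j + of_int (\<sigma> k j) * (pi * \<i>) - (\<mu> k i + of_int (\<sigma> k i) * (pi * \<i>)) + of_int (2 * n) * (pi * \<i>)"
    if "i < j" "j < 5" "k < 5" "k \<noteq> i" "k \<noteq> j" for i j k
  proof -
    have "exp (T i j k) = exp (\<mu> k j + of_int (\<sigma> k j) * (pi * \<i>) - (\<mu> k i + of_int (\<sigma> k i) * (pi * \<i>)))"
      unfolding exp_diff using exp_\<mu> [of k j] exp_\<mu> [of k i] T [OF that] that by simp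
    then show ?thesis
      unfolding exp_eq by (simp add: mult.assoc)
  qed
  then obtain N where N: "\<And>i j k. i < j \<Longrightarrow> j < 5 \<Longrightarrow> k < 5 \<Longrightarrow> k \<noteq> i \<Longrightarrow> k \<noteq> j \<Longrightarrow>
      T i j k = \<mu> k j + of_int (\<sigma> k j) * (pi * \<i>) - (\<mu> k i + of_int (\<sigma> k i) * (pi * \<i>)) + of_int (2 * N i j k) * (pi * \<i>)"
    by metis
  define E where "E i j k l = N i j l - N i j k - N k l j + N k l i" for i j k l
  have E: "2 * E i j k l = \<sigma> j l - \<sigma> j k - \<sigma> i l + \<sigma> i k - (\<sigma> l j - \<sigma> l i - \<sigma> k j + \<sigma> k i)"
    if "i < j" "j < 5" "k < l" "l < 5" "{i, j} \<inter> {k, l} = {}" for i j k l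
  proof -
    have \<mu>: "\<mu> l j = \<mu> j l" "\<mu> l i = \<mu> i l" "\<mu> k j = \<mu> j k" "\<mu> k i = \<mu> i k"
      unfolding \<mu>_def by (simp_all add: max.commute min.commute)
    have "of_int (2 * E i j k l - (\<sigma> j l - \<sigma> j k - \<sigma> i l + \<sigma> i k - (\<sigma> l j - \<sigma> l i - \<sigma> k j + \<sigma> k i))) * (complex_of_real pi * \<i>) =
        (T i j l - T i j k) - (T k l j - T k l i)"
      using that \<mu> by (simp add: N E_def algebra_simps)
    also have "\<dots> = 0"
      using sym [OF that] by simp
    finally have "of_int (2 * E i j k l - (\<sigma> j l - \<sigma> j k - \<sigma> i l + \<sigma> i k - (\<sigma> l j - \<sigma> l i - \<sigma> k j + \<sigma> k i))) = (0::complex)"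
      by simp
    then show ?thesis
      by (metis of_int_eq_0_iff eq_iff_diff_eq_0)
  qed
  have vals: "E 0 1 2 3 = 0" "E 0 1 2 4 = 0" "E 0 1 3 4 = 0" "E 0 2 3 4 = 0" "E 1 2 3 4 = 0"
    "E 0 3 1 2 = 0" "E 0 4 1 2 = 0" "E 0 4 1 3 = 0" "E 0 4 2 3 = 0" "E 1 4 2 3 = 0"
    "odd (E 0 2 1 3)" "odd (E 0 2 1 4)" "odd (E 0 3 1 4)" "odd (E 0 3 2 4)" "odd (E 1 3 2 4)"
    using E [of 0 1 2 3] E [of 0 1 2 4] E [of 0 1 3 4] E [of 0 2 3 4] E [of 1 2 3 4]
      E [of 0 3 1 2] E [of 0 4 1 2] E [of 0 4 1 3] E [of 0 4 2 3] E [of 1 4 2 3]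
      E [of 0 2 1 3] E [of 0 2 1 4] E [of 0 3 1 4] E [of 0 3 2 4] E [of 1 3 2 4]
    by (auto simp: \<sigma>_def)
  define D where "D = E 0 1 2 3 + E 0 1 2 4 + E 0 1 3 4 + E 0 2 3 4 + E 1 2 3 4
    + E 0 3 1 2 + E 0 4 1 2 + E 0 4 1 3 + E 0 4 2 3 + E 1 4 2 3
    + E 0 2 1 3 + E 0 2 1 4 + E 0 3 1 4 + E 0 3 2 4 + E 1 3 2 4"
  have "odd D"
    unfolding D_def using vals by simp
  \<comment> \<open>Ten of the thirty integers \<open>N i j k\<close> occur with opposite signs and
    cancel; the other twenty occur twice with the same sign.\<close>
  moreover have "D = 2 * (- N 0 1 2 + N 0 1 4 - N 0 2 1 + N 0 2 4 - N 0 3 1 + N 0 3 4 - N 0 4 1 + N 0 4 3 + N 1 2 0 - N 1 2 3 + N 1 3 0 - N 1 3 2 + N 1 4 0 - N 1 4 2 + N 2 3 0 - N 2 3 4 + N 2 4 0 - N 2 4 3 + N 3 4 0 - N 3 4 2)"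
    unfolding D_def E_def by simp
  then have "even D" by simp
  ultimately show False by blast
qed

text \<open>A step \<open>(x, u, \<tau>)\<close> stands for a curve from \<open>x\<close> to \<open>u\<close>, where \<open>\<tau> c\<close> is the change along the
  curve of a logarithm of \<open>z - c\<close>.\<close>

type_synonym step = "complex \<times> complex \<times> (complex \<Rightarrow> complex)"

fun step_walk :: "step set \<Rightarrow> complex \<Rightarrow> (complex \<times> (complex \<Rightarrow> complex)) list \<Rightarrow> complex \<Rightarrow> bool" where
  "step_walk S x [] y \<longleftrightarrow> x = y"
| "step_walk S x ((u, \<tau>) # ps) y \<longleftrightarrow> (x, u, \<tau>) \<in> S \<and> step_walk S u ps y"

fun walk_change :: "(complex \<times> (complex \<Rightarrow> complex)) list \<Rightarrow> complex \<Rightarrow> complex" where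
  "walk_change [] c = 0"
| "walk_change ((u, \<tau>) # ps) c = \<tau> c + walk_change ps c"

lemma exp_walk_change:
  assumes "step_walk S x ps y" "x \<noteq> c"
    and S: "\<And>x u \<tau>. (x, u, \<tau>) \<in> S \<Longrightarrow> u \<noteq> c \<and> exp (\<tau> c) = (u - c) / (x - c)"
  shows "exp (walk_change ps c) = (y - c) / (x - c)"
  using assms(1,2)
proof (induction ps arbitrary: x)
  case (Cons p ps)
  obtain u \<tau> where p: "p = (u, \<tau>)" by force
  then have u: "(x, u, \<tau>) \<in> S" "step_walk S u ps y" using Cons.prems(1) by auto
  have "exp (walk_change (p # ps) c) = (u - c) / (x - c) * ((y - c) / (u - c))"
    using Cons.IH [OF u(2)] S [OF u(1)] by (simp add: p exp_add)
  then show ?case using S [OF u(1)] by simp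
qed auto

text \<open>The identity for single steps telescopes twice: over the second walk for a fixed first
  step, then over the first walk.\<close>

lemma walk_change_symmetric:
  assumes walk: "step_walk S x ps y" and walk': "step_walk S' z qs w"
    and sym: "\<And>x u \<tau> z w \<tau>'. (x, u, \<tau>) \<in> S \<Longrightarrow> (z, w, \<tau>') \<in> S' \<Longrightarrow> \<tau> w - \<tau> z = \<tau>' u - \<tau>' x"
  shows "walk_change ps w - walk_change ps z = walk_change qs y - walk_change qs x"
  using walk
proof (induction ps arbitrary: x)
  case (Cons p ps)
  obtain u \<tau> where p: "p = (u, \<tau>)" by force
  then have u: "(x, u, \<tau>) \<in> S" "step_walk S u ps y" using Cons.prems by auto
  have "\<tau> w - \<tau> z = walk_change qs u - walk_change qs x"
    using walk'
  proof (induction qs arbitrary: z)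
    case (Cons q qs)
    obtain z' \<tau>' where q: "q = (z', \<tau>')" by force
    then have z': "(z, z', \<tau>') \<in> S'" "step_walk S' z' qs w" using Cons.prems by auto
    show ?case
      using Cons.IH [OF z'(2)] sym [OF u(1) z'(1)] unfolding q walk_change.simps by algebra
  qed auto
  then show ?case
    using Cons.IH [OF u(2)] unfolding p walk_change.simps by algebra
qed auto

definition step_rel :: "step set \<Rightarrow> (complex \<times> complex) set" where
  "step_rel S = {(x, y). \<exists>\<tau>. (x, y, \<tau>) \<in> S}"

lemma step_rel_rtrancl_walk: "(x, y) \<in> (step_rel S)\<^sup>* \<Longrightarrow> \<exists>ps. step_walk S x ps y"
proof (induction rule: converse_rtrancl_induct)
  case base
  show ?case by (metis step_walk.simps(1))
next
  case (step x u)
  then obtain ps \<tau> where "step_walk S u ps y" "(x, u, \<tau>) \<in> S"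
    unfolding step_rel_def by auto
  then have "step_walk S x ((u, \<tau>) # ps) y" by simp
  then show ?case by blast
qed

text \<open>Changes summed along walks take the place of \<open>T\<close> in the parity argument, so
  its hypotheses only have to be checked for single steps.\<close>

lemma even_walks_K5_impossible:
  fixes v :: "nat \<Rightarrow> complex"
  assumes inj: "inj_on v {..<5}"
    and reach: "\<And>i j. i < j \<Longrightarrow> j < 5 \<Longrightarrow> (v i, v j) \<in> (step_rel (S i j))\<^sup>*"
    and lift: "\<And>i j k x u \<tau>. i < j \<Longrightarrow> j < 5 \<Longrightarrow> k < 5 \<Longrightarrow> k \<notin> {i, j} \<Longrightarrow> (x, u, \<tau>) \<in> S i j \<Longrightarrow>
                u \<noteq> v k \<and> exp (\<tau> (v k)) = (u - v k) / (x - v k)"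
    and sym: "\<And>i j k l x u \<tau> z w \<tau>'. i < j \<Longrightarrow> j < 5 \<Longrightarrow> k < l \<Longrightarrow> l < 5 \<Longrightarrow> {i, j} \<inter> {k, l} = {} \<Longrightarrow>
                (x, u, \<tau>) \<in> S i j \<Longrightarrow> (z, w, \<tau>') \<in> S k l \<Longrightarrow> \<tau> w - \<tau> z = \<tau>' u - \<tau>' x"
  shows False
proof -
  have "\<exists>ps. i < j \<longrightarrow> j < 5 \<longrightarrow> step_walk (S i j) (v i) ps (v j)" for i j
    using step_rel_rtrancl_walk [OF reach] by blast
  then obtain ps where ps: "\<And>i j. i < j \<Longrightarrow> j < 5 \<Longrightarrow> step_walk (S i j) (v i) (ps i j) (v j)"
    by metis
  show False
  proof (rule even_drawing_K5_impossible [OF inj, of "\<lambda>i j k. walk_change (ps i j) (v k)"])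
    fix i j k :: nat
    assume ij: "i < j" "j < 5" and k: "k < 5" "k \<noteq> i" "k \<noteq> j"
    have "v i \<noteq> v k"
      using inj ij k by (auto simp: inj_on_def)
    then show "exp (walk_change (ps i j) (v k)) = (v j - v k) / (v i - v k)"
      by (rule exp_walk_change [OF ps [OF ij]]) (use lift [OF ij k(1)] k in auto)
  next
    fix i j k l :: nat
    assume ij: "i < j" "j < 5" and kl: "k < l" "l < 5" and d: "{i, j} \<inter> {k, l} = {}"
    show "walk_change (ps i j) (v l) - walk_change (ps i j) (v k) =
          walk_change (ps k l) (v j) - walk_change (ps k l) (v i)"
      by (rule walk_change_symmetric [OF ps [OF ij] ps [OF kl]]) (rule sym [OF ij kl d])
  qed
qed

section \<open>Walks through pseudo-discs and their complements\<close>

lemma pseudo_discsD: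
  assumes "pseudo_discs B" "b \<in> B" "b' \<in> B" "b \<noteq> b'"
  shows "jordan_region b" "jordan_region b'"
    "finite (frontier b \<inter> frontier b')" "card (frontier b \<inter> frontier b') \<le> 2"
  using assms by (simp_all add: pseudo_discs_def)

text \<open>A fact about a single index \<open>k\<close> off \<open>{i, j}\<close> is to be read off
  from the separation of disjoint index pairs; this provides the partner of
  \<open>k\<close>.\<close>

lemma ex_index_avoiding_three:
  assumes "i < 5" "j < 5" "k < (5::nat)"
  obtains l where "l < 5" "l \<notin> {i, j, k}"
proof -
  have "card {i, j, k} \<le> 3"
    by (simp add: card_insert_if)
  moreover have "card ({..<5} - {i, j, k}) \<ge> card {..<5::nat} - card {i, j, k}"
    by (rule diff_card_le_card_Diff) auto
  ultimately have "{..<5} - {i, j, k} \<noteq> {}" by force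
  then show thesis using that by blast
qed

definition disc_step :: "complex set set \<Rightarrow> complex set \<Rightarrow> (complex \<times> complex) set" where
  "disc_step W Z = {(x, y). x \<in> Z \<and> y \<in> Z \<and> (\<exists>b\<in>W. x \<in> b \<and> y \<in> b)}"

text \<open>\<open>W i j\<close> and \<open>Z i j\<close> are the discs and points that the edge
  from \<open>i\<close> to \<open>j\<close> may use. Separation holds for disjoint edges in both
  orders, so steps in \<open>b\<close> and \<open>b'\<close> have their ends in
  \<open>b - b'\<close> and \<open>b' - b\<close>, the position required by
  \<open>log_change_symmetric\<close>. Both points and discs can serve as vertices of the
  minor.\<close>

lemma pseudo_disc_walks_K5_impossible:
  assumes B: "pseudo_discs B" and inj: "inj_on v {..<5::nat}"
    and W: "\<And>i j. i < j \<Longrightarrow> j < 5 \<Longrightarrow> W i j \<subseteq> B"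
    and Z: "\<And>i j. i < j \<Longrightarrow> j < 5 \<Longrightarrow> v i \<in> Z i j \<and> v j \<in> Z i j"
    and reach: "\<And>i j. i < j \<Longrightarrow> j < 5 \<Longrightarrow> (v i, v j) \<in> (disc_step (W i j) (Z i j))\<^sup>*"
    and sep: "\<And>i j k l b x. i < j \<Longrightarrow> j < 5 \<Longrightarrow> k < l \<Longrightarrow> l < 5 \<Longrightarrow> {i, j} \<inter> {k, l} = {} \<Longrightarrow>
                b \<in> W k l \<Longrightarrow> x \<in> Z i j \<Longrightarrow> x \<notin> b"
  shows False
proof -
  define S where "S i j = {(x, u, log_change b x u) | x u b. x \<in> Z i j \<and> u \<in> Z i j \<and> b \<in> W i j \<and> x \<in> b \<and> u \<in> b}" for i j
  have rel: "step_rel (S i j) = disc_step (W i j) (Z i j)" for i j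
    unfolding step_rel_def S_def disc_step_def by auto
  show False
  proof (rule even_walks_K5_impossible [OF inj, of S])
    show "(v i, v j) \<in> (step_rel (S i j))\<^sup>*" if "i < j" "j < 5" for i j
      using reach [OF that] rel by simp
  next
    fix i j k x u \<tau>
    assume ij: "i < j" "j < (5::nat)" and k: "k < 5" "k \<notin> {i, j}" and S: "(x, u, \<tau>) \<in> S i j"
    obtain b where b: "b \<in> W i j" "x \<in> b" "u \<in> b" "\<tau> = log_change b x u"
      using S unfolding S_def by auto
    obtain l where l: "l < 5" "l \<notin> {i, j, k}"
      using ex_index_avoiding_three [of i j k] ij k by auto
    have "v k \<notin> b"
    proof (cases "k < l")
      case True
      then show ?thesis
        using sep [of k l i j b "v k"] Z [of k l] ij l k b by auto
    next
      case False
      then have "l < k" using l by auto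
      then show ?thesis
        using sep [of l k i j b "v k"] Z [of l k] ij l k b by auto
    qed
    moreover have "jordan_region b"
      using B W [OF ij] b(1) unfolding pseudo_discs_def by blast
    ultimately show "u \<noteq> v k \<and> exp (\<tau> (v k)) = (u - v k) / (x - v k)"
      using exp_log_change b by auto
  next
    fix i j k l x u \<tau> z w \<tau>'
    assume ij: "i < j" "j < (5::nat)" and kl: "k < l" "l < (5::nat)" and d: "{i, j} \<inter> {k, l} = {}"
      and S: "(x, u, \<tau>) \<in> S i j" and S': "(z, w, \<tau>') \<in> S k l"
    have d': "{k, l} \<inter> {i, j} = {}" using d by blast
    obtain b where b: "b \<in> W i j" "x \<in> b" "u \<in> b" "x \<in> Z i j" "u \<in> Z i j" "\<tau> = log_change b x u"
      using S unfolding S_def by auto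
    obtain b' where b': "b' \<in> W k l" "z \<in> b'" "w \<in> b'" "z \<in> Z k l" "w \<in> Z k l" "\<tau>' = log_change b' z w"
      using S' unfolding S_def by auto
    have mem: "x \<in> b - b'" "u \<in> b - b'" "z \<in> b' - b" "w \<in> b' - b"
      using sep [OF ij kl d b'(1)] sep [OF kl ij d' b(1)] b b' by auto
    then have "b \<noteq> b'" by blast
    moreover have "b \<in> B" "b' \<in> B" using W [OF ij] W [OF kl] b(1) b'(1) by blast+
    ultimately show "\<tau> w - \<tau> z = \<tau>' u - \<tau>' x"
      unfolding b(6) b'(6) using log_change_symmetric [OF pseudo_discsD [OF B]] mem by blast
  qed
qed

text \<open>For a curve in the complement of \<open>b\<close> the logarithm of \<open>z - c\<close> is traded for one of
  \<open>(c - u) / (c - x)\<close> on \<open>b\<close>, as a function of \<open>c\<close>.\<close>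

lemma complement_step:
  assumes b: "jordan_region b" and xu: "x \<notin> b" "u \<notin> b"
  obtains \<tau> where "\<And>c. c \<in> b \<Longrightarrow> exp (\<tau> c) = (u - c) / (x - c)"
    "\<And>z w. z \<in> b \<Longrightarrow> w \<in> b \<Longrightarrow> \<tau> w - \<tau> z = log_change b z w u - log_change b z w x"
proof -
  obtain L where L: "continuous_on b L" "\<And>z. z \<in> b \<Longrightarrow> exp (L z) = z - u"
    using jordan_region_log [OF b xu(2)] by blast
  obtain M where M: "continuous_on b M" "\<And>z. z \<in> b \<Longrightarrow> exp (M z) = z - x"
    using jordan_region_log [OF b xu(1)] by blast
  show thesis
  proof (rule that [of "\<lambda>c. L c - M c"])
    show "exp (L c - M c) = (u - c) / (x - c)" if "c \<in> b" for c
      using L(2) [OF that] M(2) [OF that] by (metis exp_diff minus_diff_eq minus_divide_divide)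
    show "L w - M w - (L z - M z) = log_change b z w u - log_change b z w x"
      if "z \<in> b" "w \<in> b" for z w
      using log_change_eq [OF b L that] log_change_eq [OF b M that] by simp
  qed
qed

section \<open>Complete minors of dense graphs\<close>

definition graph_connected :: "('a \<times> 'a) set \<Rightarrow> 'a set \<Rightarrow> bool" where
  "graph_connected E U \<longleftrightarrow> (\<forall>x\<in>U. \<forall>y\<in>U. (x, y) \<in> (E \<inter> U \<times> U)\<^sup>*)"

definition complete_minor :: "nat \<Rightarrow> 'a set \<Rightarrow> ('a \<times> 'a) set \<Rightarrow> (nat \<Rightarrow> 'a set) \<Rightarrow> bool" where
  "complete_minor r V E X \<longleftrightarrow>
     (\<forall>i<r. X i \<subseteq> V \<and> X i \<noteq> {} \<and> graph_connected E (X i)) \<and>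
     (\<forall>i<r. \<forall>j<r. i \<noteq> j \<longrightarrow> X i \<inter> X j = {} \<and> (\<exists>x\<in>X i. \<exists>y\<in>X j. (x, y) \<in> E))"

lemma graph_connected_mono: "graph_connected E U \<Longrightarrow> E \<subseteq> E' \<Longrightarrow> graph_connected E' U"
  unfolding graph_connected_def by (meson Int_mono rtrancl_mono subset_iff order_refl)

lemma complete_minor_mono:
  "complete_minor r V E X \<Longrightarrow> V \<subseteq> V' \<Longrightarrow> E \<subseteq> E' \<Longrightarrow> complete_minor r V' E' X"
  unfolding complete_minor_def using graph_connected_mono by (meson subset_iff order_trans)

lemma graph_connected_Un:
  assumes E: "sym E" and U: "graph_connected E U" "graph_connected E U'"
    and xy: "x \<in> U" "y \<in> U'" "(x, y) \<in> E"
  shows "graph_connected E (U \<union> U')"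
proof -
  define R where "R = (E \<inter> (U \<union> U') \<times> (U \<union> U'))\<^sup>*"
  have R1: "(u, w) \<in> R" if "u \<in> U" "w \<in> U" for u w
    using U(1) that rtrancl_mono [of "E \<inter> U \<times> U" "E \<inter> (U \<union> U') \<times> (U \<union> U')"]
    unfolding graph_connected_def R_def by blast
  have R2: "(u, w) \<in> R" if "u \<in> U'" "w \<in> U'" for u w
    using U(2) that rtrancl_mono [of "E \<inter> U' \<times> U'" "E \<inter> (U \<union> U') \<times> (U \<union> U')"]
    unfolding graph_connected_def R_def by blast
  have R3: "(x, y) \<in> R" "(y, x) \<in> R"
    using xy E unfolding R_def sym_def by auto
  have tr: "(u, w) \<in> R \<Longrightarrow> (w, z) \<in> R \<Longrightarrow> (u, z) \<in> R" for u w z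
    unfolding R_def by (rule rtrancl_trans)
  have "(u, w) \<in> R" if "u \<in> U \<union> U'" "w \<in> U \<union> U'" for u w
    using that R1 R2 R3 tr xy by (metis Un_iff)
  then show ?thesis
    unfolding graph_connected_def R_def by blast
qed

lemma graph_connected_singleton: "graph_connected E {x}"
  unfolding graph_connected_def by simp

text \<open>Edges are counted as ordered pairs, here and in all later bounds, so a vertex accounts
  for twice its degree.\<close>

lemma card_edges_remove_vertex:
  assumes "finite W" "sym E" "irrefl E" "v \<in> W"
  shows "card (E \<inter> W \<times> W) = card (E \<inter> (W - {v}) \<times> (W - {v})) + 2 * card {w \<in> W. (v, w) \<in> E}"
proof -
  define D where "D = {w \<in> W. (v, w) \<in> E}"
  have D: "finite D" "v \<notin> D"
    using assms unfolding D_def irrefl_def by auto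
  have "E \<inter> W \<times> W = E \<inter> (W - {v}) \<times> (W - {v}) \<union> ({v} \<times> D \<union> D \<times> {v})"
    using assms unfolding D_def sym_def irrefl_def by auto
  moreover have "card (\<dots>) = card (E \<inter> (W - {v}) \<times> (W - {v})) + card ({v} \<times> D \<union> D \<times> {v})"
    using assms D by (intro card_Un_disjoint) auto
  moreover have "card ({v} \<times> D \<union> D \<times> {v}) = card ({v} \<times> D) + card (D \<times> {v})"
    using D by (intro card_Un_disjoint) auto
  ultimately show ?thesis
    unfolding D_def [symmetric] by (simp add: card_cartesian_product)
qed

text \<open>Mader's argument: contract a connected set \<open>U\<close> that is maximal subject to the contracted
  graph still being dense. Contracting one more neighbour of \<open>U\<close> loses many edges, so the
  neighbours of \<open>U\<close> span a graph of large minimum degree.\<close>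

lemma complete_minor_if_dense:
  fixes V :: "'a set"
  assumes "finite V" "V \<noteq> {}" "E \<subseteq> V \<times> V" "sym E" "irrefl E"
    and "(2 ^ (r + 1) - 2) * card V \<le> card E"
  shows "\<exists>X. complete_minor r V E X"
  using assms
proof (induction r arbitrary: V E)
  case 0
  show ?case by (simp add: complete_minor_def)
next
  case (Suc r)
  note IHr = Suc.IH
  \<comment> \<open>\<open>2 ^ (r + 1) - 2\<close> solves the recursion from \<open>c\<close> to
    \<open>2 * c + 2\<close> with value 0 at \<open>r = 0\<close>.\<close>
  define c :: nat where "c = 2 ^ (r + 1) - 2"
  have c2: "2 ^ (Suc r + 1) - 2 = 2 * c + 2"
  proof -
    have "(2::nat) \<le> 2 ^ (r + 1)" "(2::nat) ^ (Suc r + 1) = 2 * 2 ^ (r + 1)" by simp_all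
    then show ?thesis unfolding c_def by linarith
  qed
  show ?case
    using Suc.prems
  proof (induction "card V" arbitrary: V E rule: less_induct)
    case less
    note V = less.prems(1-5)
    have dense: "(2 * c + 2) * card V \<le> card E"
      using less.prems(6) c2 by simp
    define N where "N U = {w \<in> V - U. \<exists>u\<in>U. (u, w) \<in> E}" for U
    \<comment> \<open>The count refers to the graph with \<open>U\<close> contracted to one vertex
      of degree \<open>card (N U)\<close>.\<close>
    define good where "good U \<longleftrightarrow> U \<subseteq> V \<and> U \<noteq> {} \<and> graph_connected E U \<and>
      (2 * c + 2) * (card (V - U) + 1) \<le> card (E \<inter> (V - U) \<times> (V - U)) + 2 * card (N U)" for U
    obtain v where v: "v \<in> V" using V by blast
    have "good {v}"
    proof -
      have "N {v} = {w \<in> V. (v, w) \<in> E}"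
        using V(5) unfolding N_def irrefl_def by auto
      moreover have "E \<inter> V \<times> V = E" using V(3) by blast
      moreover have "card (V - {v}) + 1 = card V"
        using V(1) v by (metis Suc_eq_plus1 card_Suc_Diff1)
      ultimately have "(2 * c + 2) * (card (V - {v}) + 1) \<le> card (E \<inter> (V - {v}) \<times> (V - {v})) + 2 * card (N {v})"
        using card_edges_remove_vertex [OF V(1,4,5) v] dense by simp
      then show ?thesis
        unfolding good_def using v graph_connected_singleton [of E v] by blast
    qed
    moreover have "finite {U. good U}"
      using V(1) by (rule_tac finite_subset [of _ "Pow V"]) (auto simp: good_def)
    ultimately obtain U where U: "good U" and maxU: "\<And>U'. good U' \<Longrightarrow> U \<subseteq> U' \<Longrightarrow> U = U'"
      using finite_has_maximal [of "{U. good U}"] by blast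
    define W where "W = V - U"
    have W: "finite W" and UV: "U \<subseteq> V" "U \<noteq> {}" "graph_connected E U"
      using V U unfolding W_def good_def by auto
    have bound: "(2 * c + 2) * (card W + 1) \<le> card (E \<inter> W \<times> W) + 2 * card (N U)"
      using U unfolding good_def W_def by blast
    have NW: "N U \<subseteq> W" unfolding N_def W_def by blast
    then have finN: "finite (N U)" using W finite_subset by blast
    show ?case
    proof (cases "N U = {}")
      case True
      \<comment> \<open>No edge leaves \<open>U\<close>, so the density sits entirely in the smaller
        graph on \<open>W\<close>.\<close>
      have big: "(2 * c + 2) * (card W + 1) \<le> card (E \<inter> W \<times> W)"
        using bound True by simp
      then have "W \<noteq> {}" by auto
      moreover have "card W < card V"
        unfolding W_def using V UV by (intro psubset_card_mono) auto
      moreover have "sym (E \<inter> W \<times> W)" "irrefl (E \<inter> W \<times> W)"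
        using V(4,5) unfolding sym_def irrefl_def by auto
      moreover have "(2 ^ (Suc r + 1) - 2) * card W \<le> card (E \<inter> W \<times> W)"
        using big unfolding c2 by simp
      ultimately obtain X where "complete_minor (Suc r) W (E \<inter> W \<times> W) X"
        using less.hyps [of W "E \<inter> W \<times> W"] W by blast
      then have "complete_minor (Suc r) V E X"
        by (rule complete_minor_mono) (auto simp: W_def)
      then show ?thesis by blast
    next
      case False
      \<comment> \<open>By maximality, contracting \<open>x\<close> into \<open>U\<close> loses more
        than \<open>2 * c + 2\<close> ordered pairs. Two of them belong to the contracted edge, and
        two to each common neighbour of \<open>x\<close> and \<open>U\<close>.\<close>
      have deg: "c \<le> card {w \<in> N U. (x, w) \<in> E}" if x: "x \<in> N U" for x
      proof -
        have xW: "x \<in> W" "x \<in> V" "x \<notin> U" using x NW unfolding W_def by auto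
        obtain u where u: "u \<in> U" "(u, x) \<in> E" using x unfolding N_def by blast
        have "graph_connected E (insert x U)"
          using graph_connected_Un [OF V(4) UV(3) graph_connected_singleton u(1) _ u(2)] by simp
        moreover have "\<not> good (insert x U)" using maxU [of "insert x U"] xW by blast
        moreover have W': "V - insert x U = W - {x}" unfolding W_def by blast
        ultimately have fail: "\<not> (2 * c + 2) * (card (W - {x}) + 1) \<le>
            card (E \<inter> (W - {x}) \<times> (W - {x})) + 2 * card (N (insert x U))"
          using UV xW unfolding good_def W' by blast
        have "card (W - {x}) + 1 = card W"
          using W xW by (metis Suc_eq_plus1 card_Suc_Diff1)
        then have fail': "(2 * c + 2) * card W >
            card (E \<inter> (W - {x}) \<times> (W - {x})) + 2 * card (N (insert x U))"
          using fail by simp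
        have "N (insert x U) = (N U - {x}) \<union> {w \<in> W - N U. (x, w) \<in> E}"
          using V(5) xW unfolding N_def W_def irrefl_def by auto
        then have "card (N (insert x U)) = card (N U - {x}) + card {w \<in> W - N U. (x, w) \<in> E}"
          using finN W by (simp only:) (intro card_Un_disjoint, auto)
        moreover have "card (N U) = card (N U - {x}) + 1"
          using finN x by (metis Suc_eq_plus1 card_Suc_Diff1)
        moreover have "card {w \<in> W. (x, w) \<in> E} = card {w \<in> N U. (x, w) \<in> E} + card {w \<in> W - N U. (x, w) \<in> E}"
        proof -
          have "{w \<in> W. (x, w) \<in> E} = {w \<in> N U. (x, w) \<in> E} \<union> {w \<in> W - N U. (x, w) \<in> E}"
            using NW by blast
          moreover have "card \<dots> = card {w \<in> N U. (x, w) \<in> E} + card {w \<in> W - N U. (x, w) \<in> E}"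
            using finN W by (intro card_Un_disjoint) auto
          ultimately show ?thesis by simp
        qed
        moreover define M where "M = (2 * c + 2) * card W"
        have "M + (2 * c + 2) \<le> card (E \<inter> W \<times> W) + 2 * card (N U)"
          using bound unfolding M_def by simp
        ultimately show ?thesis
          using fail' card_edges_remove_vertex [OF W V(4,5) xW(1)]
          unfolding M_def [symmetric] by linarith
      qed
      have "c * card (N U) \<le> card (E \<inter> N U \<times> N U)"
      proof -
        have "E \<inter> N U \<times> N U = (SIGMA x:N U. {w \<in> N U. (x, w) \<in> E})" by auto
        then have "card (E \<inter> N U \<times> N U) = (\<Sum>x\<in>N U. card {w \<in> N U. (x, w) \<in> E})"
          using finN by simp
        also have "\<dots> \<ge> (\<Sum>x\<in>N U. c)"
          using deg by (rule sum_mono)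
        finally show ?thesis by (simp add: mult.commute)
      qed
      moreover have "sym (E \<inter> N U \<times> N U)" "irrefl (E \<inter> N U \<times> N U)"
        using V(4,5) unfolding sym_def irrefl_def by auto
      ultimately obtain X where "complete_minor r (N U) (E \<inter> N U \<times> N U) X"
        using IHr [of "N U" "E \<inter> N U \<times> N U"] finN False unfolding c_def by blast
      then have X0: "complete_minor r (N U) E X"
        by (rule complete_minor_mono) auto
      then have X: "\<And>i. i < r \<Longrightarrow> X i \<subseteq> N U \<and> X i \<noteq> {} \<and> graph_connected E (X i)"
        and X': "\<And>i j. i < r \<Longrightarrow> j < r \<Longrightarrow> i \<noteq> j \<Longrightarrow> X i \<inter> X j = {} \<and> (\<exists>x\<in>X i. \<exists>y\<in>X j. (x, y) \<in> E)"
        unfolding complete_minor_def by blast+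
      have NU: "N U \<inter> U = {}" "N U \<subseteq> V" unfolding N_def by auto
      have adj: "\<exists>u\<in>U. \<exists>x\<in>X i. (u, x) \<in> E \<and> (x, u) \<in> E" if i: "i < r" for i
      proof -
        obtain x where x: "x \<in> X i" "x \<in> N U" using X [OF i] by blast
        then obtain u where "u \<in> U" "(u, x) \<in> E" unfolding N_def by blast
        then show ?thesis using x V(4) unfolding sym_def by blast
      qed
      \<comment> \<open>\<open>U\<close> becomes the last bag. The other bags consist of neighbours
        of \<open>U\<close>, so it is adjacent to all of them.\<close>
      define Y where "Y i = (if i < r then X i else U)" for i
      have "complete_minor (Suc r) V E Y"
        unfolding complete_minor_def
      proof (intro conjI allI impI)
        fix i assume "i < Suc r"
        then show "Y i \<subseteq> V" "Y i \<noteq> {}" "graph_connected E (Y i)"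
          using X [of i] NU UV unfolding Y_def by auto
      next
        fix i j assume ij: "i < Suc r" "j < Suc r" "i \<noteq> j"
        consider "i < r" "j < r" | "i < r" "j = r" | "i = r" "j < r"
          using ij by linarith
        then have "Y i \<inter> Y j = {} \<and> (\<exists>x\<in>Y i. \<exists>y\<in>Y j. (x, y) \<in> E)"
        proof cases
          case 1
          then show ?thesis using X' ij unfolding Y_def by auto
        next
          case 2
          then show ?thesis using X [of i] adj [of i] NU unfolding Y_def by auto
        next
          case 3
          then show ?thesis using X [of j] adj [of j] NU unfolding Y_def by auto
        qed
        then show "Y i \<inter> Y j = {}" "\<exists>x\<in>Y i. \<exists>y\<in>Y j. (x, y) \<in> E" by blast+
      qed
      then show ?thesis by blast
    qed
  qed
qed

section \<open>Delaunay graphs of pseudo-discs\<close>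

text \<open>The relation is a parameter because membership, its negation and its converse are all
  needed.\<close>

definition delaunay :: "'a set \<Rightarrow> 'b set \<Rightarrow> ('a \<Rightarrow> 'b \<Rightarrow> bool) \<Rightarrow> ('a \<times> 'a) set" where
  "delaunay X Y R = {(x, x'). x \<in> X \<and> x' \<in> X \<and> x \<noteq> x' \<and> (\<exists>y\<in>Y. {z \<in> X. R z y} = {x, x'})}"

text \<open>All subsets of the ground set are included since sampling and degeneracy both pass to
  subsets. Shrinking \<open>Y\<close> only removes pairs.\<close>

definition linear_delaunay :: "nat \<Rightarrow> 'a set \<Rightarrow> 'b set \<Rightarrow> ('a \<Rightarrow> 'b \<Rightarrow> bool) \<Rightarrow> bool" where
  "linear_delaunay K X Y R \<longleftrightarrow> (\<forall>X'\<subseteq>X. card (delaunay X' Y R) \<le> K * card X')"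

lemma linear_delaunay_if_no_minor:
  assumes X: "finite X"
    and no: "\<And>X' M. X' \<subseteq> X \<Longrightarrow> complete_minor r X' (delaunay X' Y R) M \<Longrightarrow> False"
  shows "linear_delaunay (2 ^ (r + 1) - 2) X Y R"
  unfolding linear_delaunay_def
proof (intro allI impI)
  fix X' assume X': "X' \<subseteq> X"
  show "card (delaunay X' Y R) \<le> (2 ^ (r + 1) - 2) * card X'"
  proof (rule ccontr)
    assume *: "\<not> card (delaunay X' Y R) \<le> (2 ^ (r + 1) - 2) * card X'"
    have "delaunay X' Y R \<subseteq> X' \<times> X'" "sym (delaunay X' Y R)" "irrefl (delaunay X' Y R)"
      unfolding delaunay_def sym_def irrefl_def by (auto simp: insert_commute)
    moreover from this * have "X' \<noteq> {}" by auto
    ultimately obtain M where "complete_minor r X' (delaunay X' Y R) M"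
      using complete_minor_if_dense [of X' "delaunay X' Y R" r] * X' finite_subset [OF X' X]
      by (meson nle_le)
    then show False using no X' by blast
  qed
qed

text \<open>The edge from \<open>i\<close> to \<open>j\<close> is realised inside
  \<open>M i \<union> M j\<close>, so edges without a common end use disjoint vertex sets.\<close>

lemma complete_minorD:
  assumes "complete_minor r V E M" "sym E"
  shows "\<And>i. i < r \<Longrightarrow> M i \<subseteq> V \<and> M i \<noteq> {}"
    and "\<And>i j. i < r \<Longrightarrow> j < r \<Longrightarrow> i \<noteq> j \<Longrightarrow> M i \<inter> M j = {}"
    and "\<And>i j. i < r \<Longrightarrow> j < r \<Longrightarrow> i \<noteq> j \<Longrightarrow> graph_connected E (M i \<union> M j)"
proof -
  show "\<And>i. i < r \<Longrightarrow> M i \<subseteq> V \<and> M i \<noteq> {}"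
    and "\<And>i j. i < r \<Longrightarrow> j < r \<Longrightarrow> i \<noteq> j \<Longrightarrow> M i \<inter> M j = {}"
    using assms(1) unfolding complete_minor_def by blast+
  show "graph_connected E (M i \<union> M j)" if ij: "i < r" "j < r" "i \<noteq> j" for i j
  proof -
    obtain x y where "x \<in> M i" "y \<in> M j" "(x, y) \<in> E"
      using assms(1) ij unfolding complete_minor_def by blast
    then show ?thesis
      using graph_connected_Un [OF assms(2)] assms(1) ij unfolding complete_minor_def by blast
  qed
qed

lemma sym_delaunay: "sym (delaunay X Y R)"
  unfolding delaunay_def sym_def by (auto simp: insert_commute)

lemma complete_minor_representatives:
  assumes "complete_minor r V E M" "sym E"
  obtains v where "\<And>i. i < r \<Longrightarrow> v i \<in> M i" "inj_on v {..<r}"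
proof -
  have "\<exists>x. i < r \<longrightarrow> x \<in> M i" for i
    using complete_minorD(1) [OF assms, of i] by blast
  then obtain v where v: "\<And>i. i < r \<Longrightarrow> v i \<in> M i" by metis
  have "inj_on v {..<r}"
    unfolding inj_on_def using complete_minorD(2) [OF assms] v by (metis disjoint_iff lessThan_iff)
  then show thesis using that v by blast
qed

lemma rtrancl_steps:
  assumes "graph_connected E U" "x \<in> U" "y \<in> U"
    and "\<And>x y. (x, y) \<in> E \<Longrightarrow> x \<in> U \<Longrightarrow> y \<in> U \<Longrightarrow> (x, y) \<in> T"
  shows "(x, y) \<in> T\<^sup>*"
proof -
  have "(x, y) \<in> (E \<inter> U \<times> U)\<^sup>*"
    using assms(1-3) unfolding graph_connected_def by blast
  moreover have "E \<inter> U \<times> U \<subseteq> T" using assms(4) by blast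
  ultimately show ?thesis using rtrancl_mono by blast
qed

text \<open>The edge from \<open>i\<close> to \<open>j\<close> uses only discs whose trace on
  \<open>X\<close> stays in \<open>M i \<union> M j\<close>. Every Delaunay pair of this union comes
  from such a disc, and no such disc contains a point from the bags of a disjoint edge.\<close>

lemma pseudo_discs_linear_delaunay:
  assumes A: "finite A" and B: "pseudo_discs B"
  shows "linear_delaunay 62 A B (\<in>)"
proof -
  have "linear_delaunay (2 ^ (5 + 1) - 2) A B (\<in>)"
  proof (rule linear_delaunay_if_no_minor [OF A])
    fix X M assume X: "X \<subseteq> A" and M: "complete_minor 5 X (delaunay X B (\<in>)) M"
    note M' = complete_minorD [OF M sym_delaunay]
    obtain v where v: "\<And>i. i < 5 \<Longrightarrow> v i \<in> M i" "inj_on v {..<5}"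
      using complete_minor_representatives [OF M sym_delaunay] by blast
    define W where "W i j = {b \<in> B. {z \<in> X. z \<in> b} \<subseteq> M i \<union> M j}" for i j
    show False
    proof (rule pseudo_disc_walks_K5_impossible [OF B v(2), of W "\<lambda>i j. M i \<union> M j"])
      fix i j :: nat assume ij: "i < j" "j < 5"
      show "W i j \<subseteq> B" unfolding W_def by blast
      show "v i \<in> M i \<union> M j \<and> v j \<in> M i \<union> M j" using v(1) ij by auto
      show "(v i, v j) \<in> (disc_step (W i j) (M i \<union> M j))\<^sup>*"
      proof (rule rtrancl_steps)
        show "graph_connected (delaunay X B (\<in>)) (M i \<union> M j)"
          using M'(3) ij by simp
        show "(x, y) \<in> disc_step (W i j) (M i \<union> M j)"
          if xy: "(x, y) \<in> delaunay X B (\<in>)" "x \<in> M i \<union> M j" "y \<in> M i \<union> M j" for x y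
        proof -
          obtain b where b: "b \<in> B" "{z \<in> X. z \<in> b} = {x, y}"
            using xy(1) unfolding delaunay_def by blast
          then have "x \<in> b" "y \<in> b" by blast+
          moreover have "b \<in> W i j" using b xy unfolding W_def by simp
          ultimately show ?thesis using xy unfolding disc_step_def by blast
        qed
      qed (use v(1) ij in auto)
    next
      fix i j k l b x
      assume ij: "i < j" "j < (5::nat)" and kl: "k < l" "l < (5::nat)" and d: "{i, j} \<inter> {k, l} = {}"
        and b: "b \<in> W k l" and x: "x \<in> M i \<union> M j"
      have "(M i \<union> M j) \<inter> (M k \<union> M l) = {}"
        using M'(2) [of i k] M'(2) [of i l] M'(2) [of j k] M'(2) [of j l] ij kl d by auto
      moreover have "x \<in> X" using M'(1) [of i] M'(1) [of j] ij x by auto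
      ultimately show "x \<notin> b" using b x unfolding W_def by blast
    qed
  qed
  then show ?thesis by simp
qed

text \<open>The curves now run through complements. A disc \<open>b\<close> that omits only
  \<open>x\<close> and \<open>u\<close> from \<open>X\<close> contains all points used by a disjoint
  edge, so \<open>x\<close>, \<open>u\<close> lie in \<open>b' - b\<close> and \<open>z\<close>,
  \<open>w\<close> in \<open>b - b'\<close>; the symmetry inside the discs carries over.\<close>

lemma pseudo_discs_linear_delaunay_complement:
  assumes A: "finite A" and B: "pseudo_discs B"
  shows "linear_delaunay 62 A B (\<notin>)"
proof -
  have "linear_delaunay (2 ^ (5 + 1) - 2) A B (\<notin>)"
  proof (rule linear_delaunay_if_no_minor [OF A])
    fix X M assume X: "X \<subseteq> A" and M: "complete_minor 5 X (delaunay X B (\<notin>)) M"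
    note M' = complete_minorD [OF M sym_delaunay]
    obtain v where v: "\<And>i. i < 5 \<Longrightarrow> v i \<in> M i" "inj_on v {..<5}"
      using complete_minor_representatives [OF M sym_delaunay] by blast
    define S where "S i j = {(x, u, \<tau>). x \<in> M i \<union> M j \<and> u \<in> M i \<union> M j \<and>
        (\<exists>b\<in>B. {z \<in> X. z \<notin> b} = {x, u} \<and> (\<forall>c\<in>b. exp (\<tau> c) = (u - c) / (x - c)) \<and>
           (\<forall>z\<in>b. \<forall>w\<in>b. \<tau> w - \<tau> z = log_change b z w u - log_change b z w x))}" for i j
    have MX: "M i \<subseteq> X" if "i < 5" for i using M'(1) that by blast
    show False
    proof (rule even_walks_K5_impossible [OF v(2), of S])
      fix i j :: nat assume ij: "i < j" "j < 5"
      show "(v i, v j) \<in> (step_rel (S i j))\<^sup>*"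
      proof (rule rtrancl_steps)
        show "graph_connected (delaunay X B (\<notin>)) (M i \<union> M j)"
          using M'(3) ij by simp
        show "(x, y) \<in> step_rel (S i j)"
          if xy: "(x, y) \<in> delaunay X B (\<notin>)" "x \<in> M i \<union> M j" "y \<in> M i \<union> M j" for x y
        proof -
          obtain b where b: "b \<in> B" "{z \<in> X. z \<notin> b} = {x, y}"
            using xy(1) unfolding delaunay_def by blast
          then have "x \<notin> b" "y \<notin> b" by blast+
          moreover have "jordan_region b" using B b(1) unfolding pseudo_discs_def by blast
          ultimately obtain \<tau> where "\<And>c. c \<in> b \<Longrightarrow> exp (\<tau> c) = (y - c) / (x - c)"
            "\<And>z w. z \<in> b \<Longrightarrow> w \<in> b \<Longrightarrow> \<tau> w - \<tau> z = log_change b z w y - log_change b z w x"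
            using complement_step by metis
          then have "(x, y, \<tau>) \<in> S i j" unfolding S_def using b xy(2,3) by blast
          then show ?thesis unfolding step_rel_def by blast
        qed
      qed (use v(1) ij in auto)
    next
      fix i j k x u \<tau>
      assume ij: "i < j" "j < (5::nat)" and k: "k < 5" "k \<notin> {i, j}" and S: "(x, u, \<tau>) \<in> S i j"
      obtain b where b: "{z \<in> X. z \<notin> b} = {x, u}" "\<forall>c\<in>b. exp (\<tau> c) = (u - c) / (x - c)"
        and xu: "x \<in> M i \<union> M j" "u \<in> M i \<union> M j"
        using S unfolding S_def by blast
      have "v k \<in> X" using v(1) [OF k(1)] MX [OF k(1)] by blast
      moreover have "v k \<notin> M i \<union> M j"
        using M'(2) [of k i] M'(2) [of k j] v(1) [OF k(1)] ij k by auto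
      moreover from this xu have vk: "v k \<notin> {x, u}" by blast
      ultimately have "v k \<in> b" "v k \<noteq> u" using vk [folded b(1)] by auto
      then show "u \<noteq> v k \<and> exp (\<tau> (v k)) = (u - v k) / (x - v k)"
        using b(2) by auto
    next
      fix i j k l x u \<tau> z w \<tau>'
      assume ij: "i < j" "j < (5::nat)" and kl: "k < l" "l < (5::nat)" and d: "{i, j} \<inter> {k, l} = {}"
        and S: "(x, u, \<tau>) \<in> S i j" and S': "(z, w, \<tau>') \<in> S k l"
      have disj: "(M i \<union> M j) \<inter> (M k \<union> M l) = {}"
        using M'(2) [of i k] M'(2) [of i l] M'(2) [of j k] M'(2) [of j l] ij kl d by auto
      obtain b where b: "b \<in> B" "{z \<in> X. z \<notin> b} = {x, u}"
          "\<forall>z\<in>b. \<forall>w\<in>b. \<tau> w - \<tau> z = log_change b z w u - log_change b z w x"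
        and xu: "x \<in> M i \<union> M j" "u \<in> M i \<union> M j"
        using S unfolding S_def by blast
      obtain b' where b': "b' \<in> B" "{c \<in> X. c \<notin> b'} = {z, w}"
          "\<forall>x\<in>b'. \<forall>u\<in>b'. \<tau>' u - \<tau>' x = log_change b' x u w - log_change b' x u z"
        and zw: "z \<in> M k \<union> M l" "w \<in> M k \<union> M l"
        using S' unfolding S_def by blast
      have X: "x \<in> X" "u \<in> X" "z \<in> X" "w \<in> X"
        using xu zw MX [of i] MX [of j] MX [of k] MX [of l] ij kl by auto
      have ne: "x \<noteq> z" "x \<noteq> w" "u \<noteq> z" "u \<noteq> w"
        using disj xu zw by blast+
      have "x \<in> {z \<in> X. z \<notin> b}" "u \<in> {z \<in> X. z \<notin> b}" "z \<notin> {z \<in> X. z \<notin> b}" "w \<notin> {z \<in> X. z \<notin> b}"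
        unfolding b(2) using ne by auto
      moreover have "z \<in> {c \<in> X. c \<notin> b'}" "w \<in> {c \<in> X. c \<notin> b'}"
          "x \<notin> {c \<in> X. c \<notin> b'}" "u \<notin> {c \<in> X. c \<notin> b'}"
        unfolding b'(2) using ne by auto
      ultimately have mem: "x \<in> b' - b" "u \<in> b' - b" "z \<in> b - b'" "w \<in> b - b'"
        using X by auto
      then have "b \<noteq> b'" by blast
      note pd = pseudo_discsD [OF B b(1) b'(1) this]
      have "\<tau> w - \<tau> z = log_change b z w u - log_change b z w x"
        using b(3) mem by blast
      also have "\<dots> = log_change b' x u w - log_change b' x u z"
        using log_change_symmetric [OF pd mem(3,4,1,2)] .
      also have "\<dots> = \<tau>' u - \<tau>' x"
        using b'(3) mem by auto
      finally show "\<tau> w - \<tau> z = \<tau>' u - \<tau>' x" .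
    qed
  qed
  then show ?thesis by simp
qed

text \<open>Merging the bags of a \<open>K\<^sub>1\<^sub>0\<close> minor in pairs makes every bag contain an edge, hence a point
  of \<open>A\<close> that lies in no disc of another bag; such a point serves as the centre of the bag.\<close>

lemma pseudo_discs_linear_delaunay_dual:
  assumes fB: "finite B" and B: "pseudo_discs B"
  shows "linear_delaunay 2046 B A (\<lambda>b a. a \<in> b)"
proof -
  have "linear_delaunay (2 ^ (10 + 1) - 2) B A (\<lambda>b a. a \<in> b)"
  proof (rule linear_delaunay_if_no_minor [OF fB])
    fix X M assume X: "X \<subseteq> B" and M: "complete_minor 10 X (delaunay X A (\<lambda>b a. a \<in> b)) M"
    define E where "E = delaunay X A (\<lambda>b a. a \<in> b)"
    note M' = complete_minorD [OF M sym_delaunay, folded E_def]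
    define U where "U i = M (2 * i) \<union> M (2 * i + 1)" for i
    have U1: "U i \<subseteq> X" if "i < 5" for i
      using M'(1) [of "2 * i"] M'(1) [of "2 * i + 1"] that unfolding U_def by auto
    have U2: "U i \<inter> U j = {}" if "i < 5" "j < 5" "i \<noteq> j" for i j
    proof -
      have "2 * i \<noteq> 2 * j + 1" "2 * i + 1 \<noteq> 2 * j" by presburger+
      then show ?thesis
        unfolding U_def Int_Un_distrib Int_Un_distrib2
        using M'(2) [of "2 * i" "2 * j"] M'(2) [of "2 * i" "2 * j + 1"]
          M'(2) [of "2 * i + 1" "2 * j"] M'(2) [of "2 * i + 1" "2 * j + 1"] that by simp
    qed
    have U3: "graph_connected E (U i)" if "i < 5" for i
      using M'(3) [of "2 * i" "2 * i + 1"] that unfolding U_def by simp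
    have adj: "\<exists>x\<in>M i. \<exists>y\<in>M j. (x, y) \<in> E" if "i < 10" "j < 10" "i \<noteq> j" for i j
      using M that unfolding complete_minor_def E_def by blast
    have U4: "graph_connected E (U i \<union> U j)" if ij: "i < 5" "j < 5" "i \<noteq> j" for i j
    proof -
      have "\<exists>x\<in>M (2 * i). \<exists>y\<in>M (2 * j). (x, y) \<in> E"
        using adj [of "2 * i" "2 * j"] ij by simp
      then obtain x y where xy: "x \<in> U i" "y \<in> U j" "(x, y) \<in> E"
        unfolding U_def by blast
      have "sym E" unfolding E_def by (rule sym_delaunay)
      then show ?thesis
        by (rule graph_connected_Un [OF _ U3 [OF ij(1)] U3 [OF ij(2)] xy])
    qed
    \<comment> \<open>These points witness the Delaunay pairs inside \<open>C\<close>: all discs of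
      \<open>X\<close> through such a point belong to \<open>C\<close>.\<close>
    define pts where "pts C = {a \<in> A. \<exists>b b'. b \<in> C \<and> b' \<in> C \<and> {c \<in> X. a \<in> c} = {b, b'}}" for C
    have "\<exists>a. i < 5 \<longrightarrow> a \<in> pts (U i)" for i
    proof (cases "i < 5")
      case True
      then have "\<exists>x\<in>M (2 * i). \<exists>y\<in>M (2 * i + 1). (x, y) \<in> E"
        using adj [of "2 * i" "2 * i + 1"] by simp
      then obtain b b' where bb': "b \<in> U i" "b' \<in> U i" "(b, b') \<in> E"
        unfolding U_def by blast
      then obtain a where "a \<in> A" "{c \<in> X. a \<in> c} = {b, b'}"
        unfolding E_def delaunay_def by blast
      then show ?thesis using bb' unfolding pts_def by blast
    qed auto
    then have "\<forall>i. \<exists>a. i < 5 \<longrightarrow> a \<in> pts (U i)" by blast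
    then obtain v where v: "\<And>i. i < 5 \<Longrightarrow> v i \<in> pts (U i)"
      using choice [of "\<lambda>i a. i < 5 \<longrightarrow> a \<in> pts (U i)"] by blast
    have ptsD: "{c \<in> X. a \<in> c} \<subseteq> C" "{c \<in> X. a \<in> c} \<noteq> {}" if a: "a \<in> pts C" for a C
    proof -
      obtain b b' where bb': "b \<in> C" "b' \<in> C" "{c \<in> X. a \<in> c} = {b, b'}"
        using a unfolding pts_def by blast
      show "{c \<in> X. a \<in> c} \<subseteq> C" "{c \<in> X. a \<in> c} \<noteq> {}"
        unfolding bb'(3) using bb'(1,2) by simp_all
    qed
    have sep: "a \<notin> b" if "a \<in> pts C" "b \<in> X" "b \<notin> C" for a b C
      using ptsD(1) [OF that(1)] that(2,3) by blast
    have hit: "\<exists>b\<in>C. b \<in> X \<and> a \<in> b" if "a \<in> pts C" for a C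
      using ptsD [OF that] by blast
    have mono: "pts C \<subseteq> pts C'" if "C \<subseteq> C'" for C C'
      using that unfolding pts_def by blast
    have "inj_on v {..<5}"
    proof (rule inj_onI, rule ccontr)
      fix i j assume ij: "i \<in> {..<5}" "j \<in> {..<5}" "v i = v j" "i \<noteq> j"
      then obtain b where b: "b \<in> U i" "b \<in> X" "v i \<in> b"
        using hit [OF v] by blast
      have "b \<notin> U j" using U2 [of i j] ij b by auto
      then show False using sep [OF v, of j b] ij b by auto
    qed
    moreover have "(p, q) \<in> (disc_step C (pts C))\<^sup>*"
      if C: "graph_connected E C" and p: "p \<in> pts C" and q: "q \<in> pts C" for C p q
    proof -
      obtain b where b: "b \<in> C" "p \<in> b" using hit [OF p] by blast
      obtain b' where b': "b' \<in> C" "q \<in> b'" using hit [OF q] by blast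
      have "(b, b') \<in> (E \<inter> C \<times> C)\<^sup>*"
        using C b b' unfolding graph_connected_def by blast
      \<comment> \<open>Consecutive discs share a witness in \<open>pts C\<close>, so a path of
        discs becomes a walk of points. The claim covers every point of the current disc, so that
        the walk can leave through the next witness.\<close>
      then have "\<forall>q\<in>pts C. q \<in> b' \<longrightarrow> (p, q) \<in> (disc_step C (pts C))\<^sup>*"
      proof (induction rule: rtrancl_induct)
        case base
        show ?case
          using b p unfolding disc_step_def by blast
      next
        case (step b1 b2)
        then obtain a where a0: "a \<in> A" "{c \<in> X. a \<in> c} = {b1, b2}"
          unfolding E_def delaunay_def by blast
        have "b1 \<in> {c \<in> X. a \<in> c}" "b2 \<in> {c \<in> X. a \<in> c}"
          unfolding a0(2) by simp_all
        then have a: "a \<in> pts C" "a \<in> b1" "a \<in> b2"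
          using step(2) a0 unfolding pts_def by blast+
        have "(p, a) \<in> (disc_step C (pts C))\<^sup>*" using step(3) a by blast
        moreover have "(a, q) \<in> disc_step C (pts C)" if "q \<in> pts C" "q \<in> b2" for q
          using that a step(2) unfolding disc_step_def by blast
        ultimately show ?case by (meson rtrancl.rtrancl_into_rtrancl)
      qed
      then show ?thesis using q b' by blast
    qed
    moreover have "v i \<in> pts (U i \<union> U j)" "v j \<in> pts (U i \<union> U j)" if "i < 5" "j < 5" for i j
      using v that mono by blast+
    ultimately show False
    proof (intro pseudo_disc_walks_K5_impossible [OF B, of v "\<lambda>i j. U i \<union> U j" "\<lambda>i j. pts (U i \<union> U j)"])
      fix i j k l b x
      assume ij: "i < j" "j < (5::nat)" and kl: "k < l" "l < (5::nat)" and d: "{i, j} \<inter> {k, l} = {}"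
        and b: "b \<in> U k \<union> U l" and x: "x \<in> pts (U i \<union> U j)"
      have "(U i \<union> U j) \<inter> (U k \<union> U l) = {}"
        using U2 [of i k] U2 [of i l] U2 [of j k] U2 [of j l] ij kl d by auto
      moreover have "b \<in> X" using b U1 [of k] U1 [of l] kl by auto
      ultimately show "x \<notin> b" using sep [OF x] b by blast
    next
      show "U i \<union> U j \<subseteq> B" if "i < j" "j < 5" for i j
        using U1 [of i] U1 [of j] X that by auto
    qed (use U4 in auto)
  qed
  then show ?thesis by simp
qed

section \<open>Shallow pairs\<close>

lemma delaunay_subset: "delaunay X Y R \<subseteq> X \<times> X"
  unfolding delaunay_def by auto

lemma finite_delaunay: "finite X \<Longrightarrow> finite (delaunay X Y R)"
  by (rule finite_subset [OF delaunay_subset]) simp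

lemma linear_delaunay_mono:
  assumes "linear_delaunay K X Y R" "finite X" "X' \<subseteq> X" "Y' \<subseteq> Y" "K \<le> K'"
  shows "linear_delaunay K' X' Y' R"
  unfolding linear_delaunay_def
proof (intro allI impI)
  fix Z assume "Z \<subseteq> X'"
  then have Z: "Z \<subseteq> X" using assms(3) by blast
  have fZ: "finite Z" using Z assms(2) by (rule finite_subset)
  have "delaunay Z Y' R \<subseteq> delaunay Z Y R"
    using assms(4) unfolding delaunay_def by blast
  then have "card (delaunay Z Y' R) \<le> card (delaunay Z Y R)"
    using finite_delaunay [OF fZ] by (intro card_mono)
  also have "\<dots> \<le> K * card Z" using assms(1) Z unfolding linear_delaunay_def by blast
  also have "\<dots> \<le> K' * card Z" using assms(5) by simp
  finally show "card (delaunay Z Y' R) \<le> K' * card Z" .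
qed

definition shallow_pairs :: "'a set \<Rightarrow> 'b set \<Rightarrow> ('a \<Rightarrow> 'b \<Rightarrow> bool) \<Rightarrow> nat \<Rightarrow> ('a \<times> 'a) set" where
  "shallow_pairs X Y R k = {(x, x'). x \<in> X \<and> x' \<in> X \<and> x \<noteq> x' \<and>
     (\<exists>y\<in>Y. R x y \<and> R x' y \<and> card {z \<in> X. R z y} \<le> k)}"

text \<open>By Bernoulli, \<open>(1 - 1 / q) ^ m\<close> is at least \<open>1 - m / q\<close>, hence
  at least 1/2.\<close>

lemma bernoulli_half:
  assumes "2 * m \<le> q" "0 < q"
  shows "(q::nat) ^ m \<le> 2 * (q - 1) ^ m"
proof -
  have "1 - real m / real q \<ge> 1 / 2"
    using assms by (simp add: field_simps)
  also have "1 - real m / real q = 1 + real m * (- 1 / real q)" by simp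
  also have "\<dots> \<le> (1 + - 1 / real q) ^ m"
    using assms by (intro Bernoulli_inequality) (simp add: field_simps)
  also have "\<dots> = (real (q - 1) / real q) ^ m"
    using assms by (simp add: field_simps of_nat_diff)
  finally have "1 / 2 \<le> real (q - 1) ^ m / real q ^ m"
    by (simp add: power_divide)
  then have "real q ^ m \<le> 2 * real (q - 1) ^ m"
    using assms by (simp add: field_simps)
  then have "real (q ^ m) \<le> real (2 * (q - 1) ^ m)"
    by simp
  then show ?thesis
    unfolding of_nat_le_iff .
qed

text \<open>The Clarkson--Shor sampling argument: the fibre over \<open>0\<close> of a random map \<open>X \<rightarrow> {..<2 * k}\<close>
  is a random sample of \<open>X\<close>, in which a given shallow pair is a Delaunay pair with probability
  at least \<open>1 / (8 * k\<^sup>2)\<close>.\<close>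

lemma card_shallow_pairs_le:
  assumes X: "finite X" and lin: "linear_delaunay K X Y R" and k: "1 \<le> k"
  shows "card (shallow_pairs X Y R k) \<le> 4 * K * k * card X"
proof (cases "shallow_pairs X Y R k = {}")
  case False
  define n where "n = card X"
  \<comment> \<open>With sampling probability 1 / (2 k) the fewer than \<open>k\<close> other points
    of a shallow set are all avoided with probability at least 1/2.\<close>
  define q where "q = 2 * k"
  define \<Omega> where "\<Omega> = PiE X (\<lambda>_. {..<q})"
  define S where "S f = {x \<in> X. f x = (0::nat)}" for f
  define P where "P = shallow_pairs X Y R k"
  have q: "0 < q" using k unfolding q_def by simp
  have fin\<Omega>: "finite \<Omega>" unfolding \<Omega>_def using X by (intro finite_PiE) auto
  have PX: "P \<subseteq> X \<times> X" unfolding P_def shallow_pairs_def by auto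
  then have finP: "finite P" using X finite_subset by blast
  have n2: "2 \<le> n"
  proof -
    obtain x x' where "x \<in> X" "x' \<in> X" "x \<noteq> x'"
      using False unfolding shallow_pairs_def by auto
    then have "card {x, x'} = 2" "{x, x'} \<subseteq> X" by auto
    then show ?thesis unfolding n_def using card_mono [OF X] by metis
  qed
  have fibre: "card {f \<in> \<Omega>. f x = 0} = q ^ (n - 1)" if x: "x \<in> X" for x
  proof -
    have "{f \<in> \<Omega>. f x = 0} = PiE X (\<lambda>z. if z = x then {0} else {..<q})"
      using x q unfolding \<Omega>_def by (auto simp: PiE_iff extensional_def split: if_splits)
    also have "card \<dots> = (\<Prod>z\<in>X. if z = x then 1 else q)"
      using X by (simp add: card_PiE if_distrib cong: if_cong)
    also have "\<dots> = (\<Prod>z\<in>X - {x}. q)"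
      using X x by (subst prod.remove [of _ x]) auto
    also have "\<dots> = q ^ (n - 1)"
      using X x by (simp add: n_def)
    finally show ?thesis .
  qed
  have upper: "(\<Sum>f\<in>\<Omega>. card (delaunay (S f) Y R)) \<le> K * (n * q ^ (n - 1))"
  proof -
    have "(\<Sum>f\<in>\<Omega>. card (delaunay (S f) Y R)) \<le> (\<Sum>f\<in>\<Omega>. K * card (S f))"
      using lin unfolding linear_delaunay_def by (intro sum_mono) (auto simp: S_def)
    also have "\<dots> = K * (\<Sum>f\<in>\<Omega>. card (S f))" by (simp add: sum_distrib_left)
    also have "(\<Sum>f\<in>\<Omega>. card (S f)) = (\<Sum>x\<in>X. card {f \<in> \<Omega>. f x = 0})"
      unfolding S_def using sum_multicount_gen [OF fin\<Omega> X, of "\<lambda>f x. f x = 0" "\<lambda>x. card {f \<in> \<Omega>. f x = 0}"]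
      by simp
    also have "\<dots> = n * q ^ (n - 1)" using fibre by (simp add: n_def)
    finally show ?thesis .
  qed
  have lower: "q ^ (n - 2) \<le> 2 * card {f \<in> \<Omega>. e \<in> delaunay (S f) Y R}" if e: "e \<in> P" for e
  proof -
    obtain x x' y where xx: "e = (x, x')" "x \<in> X" "x' \<in> X" "x \<noteq> x'" "y \<in> Y" "R x y" "R x' y"
      "card {z \<in> X. R z y} \<le> k"
      using e unfolding P_def shallow_pairs_def by auto
    define D where "D = {z \<in> X. R z y}"
    \<comment> \<open>The value 0 is forced at \<open>x\<close> and \<open>x'\<close>, forbidden on
      the rest of \<open>D\<close> and free elsewhere.\<close>
    define F where "F z = (if z \<in> {x, x'} then {0} else if z \<in> D then {1..<q} else {..<q})" for z
    have D: "{x, x'} \<subseteq> D" "D \<subseteq> X" "finite D" using xx X unfolding D_def by auto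
    have "F z \<subseteq> {..<q}" for z
      using q unfolding F_def by auto
    then have F\<Omega>: "PiE X F \<subseteq> \<Omega>"
      unfolding \<Omega>_def by (intro PiE_mono)
    have "PiE X F \<subseteq> {f \<in> \<Omega>. e \<in> delaunay (S f) Y R}"
    proof
      fix f assume f: "f \<in> PiE X F"
      then have f\<Omega>: "f \<in> \<Omega>" using F\<Omega> by blast
      have f0: "f x = 0" "f x' = 0"
        using PiE_mem [OF f xx(2)] PiE_mem [OF f xx(3)] by (auto simp: F_def)
      have f1: "f z \<noteq> 0" if "z \<in> D" "z \<notin> {x, x'}" for z
      proof -
        have "f z \<in> F z" using PiE_mem [OF f] that D by blast
        then show ?thesis using that by (auto simp: F_def)
      qed
      have "{z \<in> S f. R z y} \<subseteq> {x, x'}"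
        using f1 unfolding S_def D_def by blast
      moreover have Sf: "x \<in> S f" "x' \<in> S f"
        using f0 xx unfolding S_def by simp_all
      ultimately have "{z \<in> S f. R z y} = {x, x'}"
        using xx(6,7) by blast
      then have "e \<in> delaunay (S f) Y R"
        unfolding delaunay_def xx(1) using xx(4,5) Sf by blast
      then show "f \<in> {f \<in> \<Omega>. e \<in> delaunay (S f) Y R}" using f\<Omega> by blast
    qed
    then have "card (PiE X F) \<le> card {f \<in> \<Omega>. e \<in> delaunay (S f) Y R}"
      using fin\<Omega> by (intro card_mono) auto
    moreover have "card (PiE X F) = q ^ (n - card D) * (q - 1) ^ (card D - 2)"
    proof -
      have "card (PiE X F) = (\<Prod>z\<in>X. card (F z))" using X by (rule card_PiE)
      also have "\<dots> = (\<Prod>z\<in>X - D. card (F z)) * (\<Prod>z\<in>D. card (F z))"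
        using D X by (intro prod.subset_diff) auto
      also have "(\<Prod>z\<in>D. card (F z)) = (\<Prod>z\<in>D - {x, x'}. card (F z)) * (\<Prod>z\<in>{x, x'}. card (F z))"
        using D by (intro prod.subset_diff) auto
      also have "(\<Prod>z\<in>{x, x'}. card (F z)) = 1" using xx(4) by (simp add: F_def)
      also have "(\<Prod>z\<in>D - {x, x'}. card (F z)) = (\<Prod>z\<in>D - {x, x'}. q - 1)"
        by (rule prod.cong) (auto simp: F_def)
      also have "\<dots> = (q - 1) ^ (card D - 2)"
        using D xx(4) by (simp add: card_Diff_subset numeral_2_eq_2)
      also have "(\<Prod>z\<in>X - D. card (F z)) = (\<Prod>z\<in>X - D. q)"
        using D by (intro prod.cong) (auto simp: F_def)
      also have "\<dots> = q ^ (n - card D)"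
        using D by (simp add: card_Diff_subset n_def)
      finally show ?thesis by simp
    qed
    moreover have "q ^ (n - 2) \<le> 2 * (q ^ (n - card D) * (q - 1) ^ (card D - 2))"
    proof -
      have cD: "2 \<le> card D" "card D \<le> n"
        using D xx(4) X card_mono [of D "{x, x'}"] card_mono [of X D] unfolding n_def by auto
      have "q ^ (n - 2) = q ^ (n - card D) * q ^ (card D - 2)"
        using cD by (simp flip: power_add)
      also have "\<dots> \<le> q ^ (n - card D) * (2 * (q - 1) ^ (card D - 2))"
        using bernoulli_half [of "card D - 2" q] xx(8) q unfolding D_def q_def
        by (intro mult_left_mono) auto
      finally show ?thesis by (simp add: mult_ac)
    qed
    ultimately show ?thesis by linarith
  qed
  \<comment> \<open>Samples in which a shallow pair is Delaunay are counted twice: at least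
    \<open>q ^ (n - 2) / 2\<close> for each pair, and at most \<open>K * n * q ^ (n - 1)\<close>
    incidences altogether.\<close>
  have "card P * q ^ (n - 2) = (\<Sum>e\<in>P. q ^ (n - 2))" by simp
  also have "\<dots> \<le> (\<Sum>e\<in>P. 2 * card {f \<in> \<Omega>. e \<in> delaunay (S f) Y R})"
    using lower by (intro sum_mono) auto
  also have "\<dots> = 2 * (\<Sum>e\<in>P. card {f \<in> \<Omega>. e \<in> delaunay (S f) Y R})"
    by (simp add: sum_distrib_left)
  also have "(\<Sum>e\<in>P. card {f \<in> \<Omega>. e \<in> delaunay (S f) Y R}) = (\<Sum>f\<in>\<Omega>. card {e \<in> P. e \<in> delaunay (S f) Y R})"
    using sum_multicount_gen [OF finP fin\<Omega>, of "\<lambda>e f. e \<in> delaunay (S f) Y R"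
        "\<lambda>f. card {e \<in> P. e \<in> delaunay (S f) Y R}"] by simp
  also have "\<dots> \<le> (\<Sum>f\<in>\<Omega>. card (delaunay (S f) Y R))"
  proof (intro sum_mono card_mono)
    show "finite (delaunay (S f) Y R)" for f
      using X by (intro finite_delaunay) (simp add: S_def)
  qed auto
  also have "\<dots> \<le> K * (n * q ^ (n - 1))" by (rule upper)
  also have "q ^ (n - 1) = q * q ^ (n - 2)"
    using n2 by (metis Suc_diff_le diff_Suc_Suc numeral_2_eq_2 power_Suc Suc_1)
  finally have "card P * q ^ (n - 2) \<le> (2 * K * n * q) * q ^ (n - 2)"
    by (simp add: mult_ac)
  then have "card P \<le> 2 * K * n * q" using q by simp
  then show ?thesis unfolding P_def q_def n_def by (simp add: mult_ac)
qed auto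

text \<open>A vertex of degree at most \<open>d\<close> is removed and ranked below all that remain,
  so its later neighbours are neighbours at the time of removal.\<close>

lemma degeneracy_ranking:
  assumes "finite X" "\<And>Z. Z \<subseteq> X \<Longrightarrow> card (E \<inter> Z \<times> Z) \<le> d * card Z"
  shows "\<exists>g::'a \<Rightarrow> nat. inj_on g X \<and> (\<forall>x\<in>X. card {z \<in> X. (x, z) \<in> E \<and> g x < g z} \<le> d)"
  using assms
proof (induction "card X" arbitrary: X)
  case 0
  then show ?case by auto
next
  case (Suc n)
  have "\<exists>x\<in>X. card {z \<in> X. (x, z) \<in> E} \<le> d"
  proof (rule ccontr)
    assume "\<not> ?thesis"
    then have big: "\<And>x. x \<in> X \<Longrightarrow> d + 1 \<le> card {z \<in> X. (x, z) \<in> E}" by force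
    have "(d + 1) * card X = (\<Sum>x\<in>X. d + 1)" by simp
    also have "\<dots> \<le> (\<Sum>x\<in>X. card {z \<in> X. (x, z) \<in> E})" using big by (rule sum_mono)
    also have "\<dots> = card (SIGMA x:X. {z \<in> X. (x, z) \<in> E})" using Suc.prems(1) by simp
    also have "(SIGMA x:X. {z \<in> X. (x, z) \<in> E}) = E \<inter> X \<times> X" by auto
    also have "card (E \<inter> X \<times> X) \<le> d * card X" using Suc.prems(2) by blast
    finally show False using Suc.hyps(2) by simp
  qed
  then obtain x where x: "x \<in> X" "card {z \<in> X. (x, z) \<in> E} \<le> d" by blast
  have "n = card (X - {x})" using Suc.hyps(2) x(1) Suc.prems(1) by simp
  moreover have "card (E \<inter> Z \<times> Z) \<le> d * card Z" if "Z \<subseteq> X - {x}" for Z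
    using Suc.prems(2) that by blast
  ultimately obtain g :: "'a \<Rightarrow> nat" where g: "inj_on g (X - {x})"
    "\<And>y. y \<in> X - {x} \<Longrightarrow> card {z \<in> X - {x}. (y, z) \<in> E \<and> g y < g z} \<le> d"
    using Suc.hyps(1) [of "X - {x}"] Suc.prems(1) by blast
  define g' where "g' z = (if z = x then 0 else Suc (g z))" for z
  have "inj_on g' X"
    using g(1) unfolding inj_on_def g'_def by auto
  moreover have "card {z \<in> X. (y, z) \<in> E \<and> g' y < g' z} \<le> d" if y: "y \<in> X" for y
  proof (cases "y = x")
    case True
    have "card {z \<in> X. (y, z) \<in> E \<and> g' y < g' z} \<le> card {z \<in> X. (x, z) \<in> E}"
      using Suc.prems(1) True by (intro card_mono) auto
    then show ?thesis using x(2) by simp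
  next
    case False
    have "{z \<in> X. (y, z) \<in> E \<and> g' y < g' z} = {z \<in> X - {x}. (y, z) \<in> E \<and> g y < g z}"
      using False unfolding g'_def by auto
    then show ?thesis using g(2) [of y] y False by simp
  qed
  ultimately show ?case by (intro exI [of _ g']) simp
qed

text \<open>Passing to \<open>Z\<close> only shrinks the sets, so shallow pairs within
  \<open>Z\<close> stay shallow. The pair bound is thus hereditary, as degeneracy requires.\<close>

lemma shallow_ranking:
  assumes X: "finite X" and lin: "linear_delaunay K X Y R" and k: "1 \<le> k"
  obtains g :: "'a \<Rightarrow> nat" where "inj_on g X"
    "\<And>x. x \<in> X \<Longrightarrow> card {z \<in> X. (x, z) \<in> shallow_pairs X Y R k \<and> g x < g z} \<le> 4 * K * k"
proof -
  have "card (shallow_pairs X Y R k \<inter> Z \<times> Z) \<le> 4 * K * k * card Z" if Z: "Z \<subseteq> X" for Z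
  proof -
    have fZ: "finite Z" using X Z finite_subset by blast
    have "card {z \<in> Z. R z y} \<le> card {z \<in> X. R z y}" for y
      using X Z by (intro card_mono) auto
    then have "shallow_pairs X Y R k \<inter> Z \<times> Z \<subseteq> shallow_pairs Z Y R k"
      unfolding shallow_pairs_def by (auto intro: order_trans)
    moreover have "finite (shallow_pairs Z Y R k)"
      using fZ by (rule_tac finite_subset [of _ "Z \<times> Z"]) (auto simp: shallow_pairs_def)
    ultimately have "card (shallow_pairs X Y R k \<inter> Z \<times> Z) \<le> card (shallow_pairs Z Y R k)"
      by (rule_tac card_mono)
    also have "\<dots> \<le> 4 * K * k * card Z"
      by (rule card_shallow_pairs_le [OF fZ linear_delaunay_mono [OF lin X Z] k]) auto
    finally show ?thesis .
  qed
  from degeneracy_ranking [OF X this] show thesis using that by blast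
qed

lemma exists_ge_average:
  fixes f :: "'a \<Rightarrow> nat"
  assumes "finite X" "c \<le> (\<Sum>x\<in>X. f x)" "0 < c"
  obtains x where "x \<in> X" "c \<le> card X * f x"
proof -
  have "\<exists>x\<in>X. c \<le> card X * f x"
  proof (rule ccontr)
    assume "\<not> ?thesis"
    then have lt: "\<And>x. x \<in> X \<Longrightarrow> card X * f x < c" by force
    have "X \<noteq> {}" using assms by auto
    have "card X * c \<le> (\<Sum>x\<in>X. card X * f x)"
      using assms(2) by (simp add: sum_distrib_left [symmetric])
    also have "\<dots> < (\<Sum>x\<in>X. c)"
      using lt assms(1) \<open>X \<noteq> {}\<close> by (intro sum_strict_mono) auto
    finally show False by simp
  qed
  then show thesis using that by blast
qed

lemma sum_card_swap:
  assumes "finite X" "finite Y"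
  shows "(\<Sum>x\<in>X. card {y \<in> Y. R x y}) = (\<Sum>y\<in>Y. card {x \<in> X. R x y})"
  using sum_multicount_gen [OF assms, of R "\<lambda>y. card {x \<in> X. R x y}"] by simp

text \<open>The number of later elements is injective on \<open>S\<close>, so at most
  \<open>k div 2\<close> elements have fewer than \<open>k div 2\<close> successors. The
  \<open>+ 1\<close> absorbs odd \<open>k\<close>.\<close>

lemma card_first_half:
  fixes g :: "'a \<Rightarrow> nat"
  assumes S: "finite S" "k \<le> card S" and g: "inj_on g S"
  shows "k \<le> 2 * card {x \<in> S. k \<le> 2 * card {z \<in> S. g x < g z} + 1}"
proof -
  define h where "h x = card {z \<in> S. g x < g z}" for x
  have less: "h y < h x" if "x \<in> S" "y \<in> S" "g x < g y" for x y
    unfolding h_def using that S(1) by (intro psubset_card_mono) auto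
  have inj: "inj_on h S"
  proof (rule inj_onI, rule ccontr)
    fix x y assume xy: "x \<in> S" "y \<in> S" "h x = h y" "x \<noteq> y"
    then have "g x \<noteq> g y" using g by (auto simp: inj_on_def)
    then show False using less [of x y] less [of y x] xy by linarith
  qed
  define G where "G = {x \<in> S. k \<le> 2 * h x + 1}"
  have "h ` (S - G) \<subseteq> {..<k div 2}"
    unfolding G_def by auto
  then have "card (h ` (S - G)) \<le> k div 2"
    using card_mono [of "{..<k div 2}"] by simp
  moreover have "card (h ` (S - G)) = card (S - G)"
    using inj by (intro card_image) (auto simp: inj_on_def)
  moreover have "card S = card G + card (S - G)"
    using S(1) card_Diff_subset [of G S] card_mono [of S G] by (simp add: G_def)
  ultimately have "k \<le> 2 * card G" using S(2) by linarith
  then show ?thesis unfolding G_def h_def .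
qed

text \<open>If \<open>x\<close> is ranked in the first half of the set of \<open>y\<close>, then the second half of this set
  consists of later shallow neighbours of \<open>x\<close>, of which there are only \<open>O(k)\<close>.\<close>

lemma dense_neighbourhood:
  assumes X: "finite X" and Y: "finite Y" and lin: "linear_delaunay K X Y R" and k: "1 \<le> k"
    and sz: "\<And>y. y \<in> Y \<Longrightarrow> k \<le> card {x \<in> X. R x y} \<and> card {x \<in> X. R x y} \<le> 2 * k"
  obtains P Q where "P \<subseteq> X" "Q \<subseteq> Y" "card P \<le> 8 * K * k"
    "\<And>y. y \<in> Q \<Longrightarrow> k \<le> 2 * card {x \<in> P. R x y} + 1"
    "k * card Y \<le> 2 * (card X * card Q)"
proof (cases "Y = {}")
  case True
  show thesis by (rule that [of "{}" "{}"]) (auto simp: True)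
next
  case False
  \<comment> \<open>The sets have up to \<open>2 * k\<close> elements, so pairs are taken shallow at
    level \<open>2 * k\<close>; this produces \<open>8 * K * k\<close>.\<close>
  obtain g :: "'a \<Rightarrow> nat" where g: "inj_on g X"
    "\<And>x. x \<in> X \<Longrightarrow> card {z \<in> X. (x, z) \<in> shallow_pairs X Y R (2 * k) \<and> g x < g z} \<le> 4 * K * (2 * k)"
    using shallow_ranking [OF X lin, of "2 * k"] k by auto
  define P where "P x = {z \<in> X. (x, z) \<in> shallow_pairs X Y R (2 * k) \<and> g x < g z}" for x
  define S where "S y = {x \<in> X. R x y}" for y
  have P: "{z \<in> S y. g x < g z} \<subseteq> {z \<in> P x. R z y}" if "y \<in> Y" "x \<in> S y" for x y
    using that sz [OF that(1)] unfolding P_def S_def shallow_pairs_def by auto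
  define T where "T x y \<longleftrightarrow> R x y \<and> k \<le> 2 * card {z \<in> P x. R z y} + 1" for x y
  have finP: "finite (P x)" for x unfolding P_def using X by simp
  have half: "k \<le> 2 * card {x \<in> X. T x y}" if y: "y \<in> Y" for y
  proof -
    have S: "finite (S y)" "k \<le> card (S y)" "inj_on g (S y)"
      using X sz [OF y] g(1) unfolding S_def by (auto simp: inj_on_def)
    have "k \<le> 2 * card {x \<in> S y. k \<le> 2 * card {z \<in> S y. g x < g z} + 1}"
      by (rule card_first_half [OF S])
    also have "card {x \<in> S y. k \<le> 2 * card {z \<in> S y. g x < g z} + 1} \<le> card {x \<in> X. T x y}"
    proof (rule card_mono)
      show "{x \<in> S y. k \<le> 2 * card {z \<in> S y. g x < g z} + 1} \<subseteq> {x \<in> X. T x y}"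
      proof clarify
        fix x assume x: "x \<in> S y" "k \<le> 2 * card {z \<in> S y. g x < g z} + 1"
        have "card {z \<in> S y. g x < g z} \<le> card {z \<in> P x. R z y}"
          using P [OF y x(1)] finP by (intro card_mono) auto
        then show "x \<in> X \<and> T x y"
          using x unfolding T_def S_def by auto
      qed
    qed (use X in simp)
    finally show ?thesis by simp
  qed
  have "k * card Y = (\<Sum>y\<in>Y. k)" by simp
  also have "\<dots> \<le> (\<Sum>y\<in>Y. 2 * card {x \<in> X. T x y})" using half by (rule sum_mono)
  also have "\<dots> = (\<Sum>x\<in>X. 2 * card {y \<in> Y. T x y})"
    unfolding sum_distrib_left [symmetric] using sum_card_swap [OF X Y, of T] by simp
  finally have "k * card Y \<le> (\<Sum>x\<in>X. 2 * card {y \<in> Y. T x y})" .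
  moreover have "0 < k * card Y" using k False Y by (simp add: card_gt_0_iff)
  \<comment> \<open>This \<open>x\<close> is in the first half of at least the average number of
    sets. Its later shallow neighbours and these sets form the dense pair.\<close>
  ultimately obtain x where x: "x \<in> X" "k * card Y \<le> card X * (2 * card {y \<in> Y. T x y})"
    using exists_ge_average [OF X] by blast
  show thesis
  proof (rule that [of "P x" "{y \<in> Y. T x y}"])
    show "card (P x) \<le> 8 * K * k" using g(2) [OF x(1)] unfolding P_def by simp
    show "k * card Y \<le> 2 * (card X * card {y \<in> Y. T x y})" using x(2) by (simp add: mult_ac)
  qed (auto simp: P_def T_def)
qed

section \<open>Traces and packing\<close>

definition shatters :: "'a set set \<Rightarrow> 'a set \<Rightarrow> bool" where
  "shatters F S \<longleftrightarrow> (\<forall>T\<subseteq>S. \<exists>A\<in>F. A \<inter> S = T)"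

text \<open>Pajor's form of the Sauer-Shelah lemma: \<open>F\<close> is split into the members
  without \<open>a\<close> and those with \<open>a\<close>, the latter with \<open>a\<close>
  removed, and induction applies to both families.\<close>

lemma card_le_card_shattered:
  assumes "finite X" "F \<subseteq> Pow X"
  shows "card F \<le> card {S. S \<subseteq> X \<and> shatters F S}"
  using assms
proof (induction X arbitrary: F rule: finite_induct)
  case empty
  then have "F = {} \<or> F = {{}}" by auto
  then show ?case
  proof
    assume F: "F = {{}}"
    then have "{S. S \<subseteq> {} \<and> shatters F S} = {{}}" by (auto simp: shatters_def)
    then show ?thesis using F by simp
  qed auto
next
  case (insert a X)
  define F0 where "F0 = {A \<in> F. a \<notin> A}"
  define F1 where "F1 = (\<lambda>A. A - {a}) ` {A \<in> F. a \<in> A}"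
  have finF: "finite F" using insert.prems insert.hyps(1) by (meson finite.insertI finite_Pow_iff finite_subset)
  have sub: "F0 \<subseteq> Pow X" "F1 \<subseteq> Pow X"
    using insert.prems unfolding F0_def F1_def by auto
  have "card F1 = card {A \<in> F. a \<in> A}"
    unfolding F1_def by (rule card_image) (auto simp: inj_on_def)
  moreover have "card F = card F0 + card {A \<in> F. a \<in> A}"
  proof -
    have "F = F0 \<union> {A \<in> F. a \<in> A}" unfolding F0_def by blast
    moreover have "card (F0 \<union> {A \<in> F. a \<in> A}) = card F0 + card {A \<in> F. a \<in> A}"
      using finF by (intro card_Un_disjoint) (auto simp: F0_def)
    ultimately show ?thesis by simp
  qed
  ultimately have cF: "card F = card F0 + card F1" by simp
  define H where "H G = {S. S \<subseteq> X \<and> shatters G S}" for G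
  define H' where "H' = {S. S \<subseteq> insert a X \<and> shatters F S}"
  have fin: "finite (H G)" for G unfolding H_def using insert.hyps(1) by simp
  have finH': "finite H'" unfolding H'_def using insert.hyps(1) by simp
  have sh0: "shatters F S" if "S \<in> H F0" for S
    using that unfolding H_def shatters_def F0_def by blast
  have a_notin: "a \<notin> S" if "S \<subseteq> X" for S using that insert.hyps(2) by blast
  have sh1: "shatters F S" if S: "S \<in> H F1" for S
    unfolding shatters_def
  proof (intro allI impI)
    fix T assume "T \<subseteq> S"
    then obtain A where A: "A \<in> F" "(A - {a}) \<inter> S = T"
      using S unfolding H_def shatters_def F1_def by blast
    have "a \<notin> S" using S a_notin unfolding H_def by blast
    then have "A \<inter> S = T" using A(2) by blast
    then show "\<exists>A\<in>F. A \<inter> S = T" using A(1) by blast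
  qed
  have sh01: "shatters F (insert a S)" if S: "S \<in> H F0 \<inter> H F1" for S
    unfolding shatters_def
  proof (intro allI impI)
    fix T assume T: "T \<subseteq> insert a S"
    have aS: "a \<notin> S" using S a_notin unfolding H_def by blast
    have T': "T - {a} \<subseteq> S" using T by blast
    show "\<exists>A\<in>F. A \<inter> insert a S = T"
    proof (cases "a \<in> T")
      case True
      have "shatters F1 S" using S unfolding H_def by blast
      then obtain A1 where A1: "A1 \<in> F1" "A1 \<inter> S = T - {a}"
        using T' unfolding shatters_def by blast
      then obtain A where A: "A \<in> F" "a \<in> A" "A1 = A - {a}"
        unfolding F1_def by blast
      have "A \<inter> S = T - {a}" using A1(2) aS unfolding A(3) by blast
      then have "A \<inter> insert a S = T" using A(2) True by (simp add: insert_absorb)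
      then show ?thesis using A(1) by blast
    next
      case False
      have "shatters F0 S" using S unfolding H_def by blast
      then obtain A where A: "A \<in> F0" "A \<inter> S = T - {a}"
        using T' unfolding shatters_def by blast
      then have A': "A \<in> F" "a \<notin> A" unfolding F0_def by blast+
      then have "A \<inter> insert a S = T" using A(2) False by simp
      then show ?thesis using A'(1) by blast
    qed
  qed
  \<comment> \<open>A set shattered by both families is counted twice; its second copy is replaced
    by the set with \<open>a\<close> inserted, which \<open>F\<close> also shatters.\<close>
  have "card (H F0) + card (H F1) = card (H F0 \<union> H F1) + card (H F0 \<inter> H F1)"
    by (rule card_Un_Int [OF fin fin])
  also have "card (H F0 \<inter> H F1) = card (insert a ` (H F0 \<inter> H F1))"
  proof (rule card_image [symmetric])
    show "inj_on (insert a) (H F0 \<inter> H F1)"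
      unfolding inj_on_def H_def using a_notin by (metis (no_types, lifting) Int_iff insert_ident mem_Collect_eq)
  qed
  also have "card (H F0 \<union> H F1) + \<dots> = card (H F0 \<union> H F1 \<union> insert a ` (H F0 \<inter> H F1))"
    using fin a_notin by (intro card_Un_disjoint [symmetric]) (auto simp: H_def)
  also have "\<dots> \<le> card H'"
    using finH' sh0 sh1 sh01 by (intro card_mono) (auto simp: H_def H'_def)
  finally have "card (H F0) + card (H F1) \<le> card H'" .
  moreover have "card F0 \<le> card (H F0)" "card F1 \<le> card (H F1)"
    unfolding H_def using insert.IH sub by blast+
  ultimately show ?case using cF unfolding H'_def by linarith
qed

section \<open>The number of traces on a finite set\<close>

lemma card_small_subsets_le:
  assumes "finite X"
  shows "finite {S. S \<subseteq> X \<and> card S \<le> v} \<and> card {S. S \<subseteq> X \<and> card S \<le> v} \<le> (card X + 1) ^ v"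
proof (induction v)
  case 0
  have "{S. S \<subseteq> X \<and> card S \<le> 0} = {{}}"
    using assms by (auto simp: finite_subset)
  then show ?case by simp
next
  case (Suc v)
  define N where "N v = {S. S \<subseteq> X \<and> card S \<le> v}" for v
  have "N (Suc v) \<subseteq> N v \<union> (\<lambda>(a, S). insert a S) ` (X \<times> N v)"
  proof
    fix S assume S: "S \<in> N (Suc v)"
    then have fS: "finite S" using assms finite_subset unfolding N_def by blast
    show "S \<in> N v \<union> (\<lambda>(a, S). insert a S) ` (X \<times> N v)"
    proof (cases "S = {}")
      case True
      then show ?thesis unfolding N_def by simp
    next
      case False
      then obtain a where a: "a \<in> S" by blast
      have "card (S - {a}) \<le> v" using S a fS unfolding N_def by (simp add: le_diff_conv)
      then have "(a, S - {a}) \<in> X \<times> N v" using S a unfolding N_def by auto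
      moreover have "S = (\<lambda>(a, S). insert a S) (a, S - {a})" using a by auto
      ultimately show ?thesis by blast
    qed
  qed
  moreover have fN: "finite (N v)" using assms unfolding N_def by simp
  ultimately have "card (N (Suc v)) \<le> card (N v \<union> (\<lambda>(a, S). insert a S) ` (X \<times> N v))"
    using assms by (intro card_mono) auto
  also have "\<dots> \<le> card (N v) + card ((\<lambda>(a, S). insert a S) ` (X \<times> N v))" by (rule card_Un_le)
  also have "card ((\<lambda>(a, S). insert a S) ` (X \<times> N v)) \<le> card (X \<times> N v)"
    using assms fN by (intro card_image_le) auto
  finally have "card (N (Suc v)) \<le> (card X + 1) * card (N v)"
    by (simp add: card_cartesian_product)
  also have "\<dots> \<le> (card X + 1) * (card X + 1) ^ v"
    using Suc.IH unfolding N_def by (intro mult_left_mono) auto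
  finally show ?case using assms unfolding N_def by simp
qed

text \<open>Every pair in a shattered set is a trace, so its Delaunay graph is complete, with
  \<open>card S * (card S - 1)\<close> ordered pairs.\<close>

lemma card_shattered_le:
  assumes lin: "linear_delaunay K X Y R" and S: "S \<subseteq> Z" "Z \<subseteq> X" "finite X"
    and sh: "shatters ((\<lambda>y. {x \<in> Z. R x y}) ` Y) S"
  shows "card S \<le> K + 1"
proof (rule ccontr)
  assume big: "\<not> card S \<le> K + 1"
  have SX: "S \<subseteq> X" using S(1,2) by (rule order_trans)
  have fS: "finite S" using SX S(3) by (rule finite_subset)
  have "(SIGMA x:S. S - {x}) \<subseteq> delaunay S Y R"
  proof (rule subrelI)
    fix x x' assume "(x, x') \<in> (SIGMA x:S. S - {x})"
    then have xx: "x \<in> S" "x' \<in> S" "x' \<noteq> x" by auto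
    then have "{x, x'} \<subseteq> S" by blast
    then obtain y where y: "y \<in> Y" "{x \<in> Z. R x y} \<inter> S = {x, x'}"
      using sh unfolding shatters_def by blast
    moreover have "{x \<in> Z. R x y} \<inter> S = {x \<in> S. R x y}" using S(1) by blast
    ultimately show "(x, x') \<in> delaunay S Y R"
      unfolding delaunay_def using xx by auto
  qed
  then have "card (SIGMA x:S. S - {x}) \<le> card (delaunay S Y R)"
    using finite_delaunay [OF fS] by (rule_tac card_mono)
  also have "\<dots> \<le> K * card S" using lin SX unfolding linear_delaunay_def by blast
  finally have "card S * (card S - 1) \<le> K * card S" using fS by simp
  then have "card S - 1 \<le> K" using big by (simp add: mult.commute)
  then show False using big by simp
qed

lemma card_traces_le:
  assumes lin: "linear_delaunay K X Y R" and Z: "Z \<subseteq> X" "finite X"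
  shows "card ((\<lambda>y. {x \<in> Z. R x y}) ` Y) \<le> (card Z + 1) ^ (K + 1)"
proof -
  have fZ: "finite Z" using Z finite_subset by blast
  define F where "F = (\<lambda>y. {x \<in> Z. R x y}) ` Y"
  have "card F \<le> card {S. S \<subseteq> Z \<and> shatters F S}"
    using fZ by (intro card_le_card_shattered) (auto simp: F_def)
  also have "\<dots> \<le> card {S. S \<subseteq> Z \<and> card S \<le> K + 1}"
    using card_shattered_le [OF lin _ Z(1,2)] card_small_subsets_le [OF fZ]
    unfolding F_def by (intro card_mono) blast+
  also have "\<dots> \<le> (card Z + 1) ^ (K + 1)"
    using card_small_subsets_le [OF fZ] by blast
  finally show ?thesis unfolding F_def .
qed

text \<open>A greedy choice replaces a random sample: by averaging, some point of \<open>P\<close>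
  separates at least the fraction \<delta> of the pairs not yet separated.\<close>

lemma exists_distinguishing_set:
  fixes \<delta> :: real
  assumes P: "finite P" "P \<noteq> {}" and Q: "finite Q" and \<delta>: "\<delta> \<le> 1"
    and sep: "\<And>y y'. y \<in> Q \<Longrightarrow> y' \<in> Q \<Longrightarrow> y \<noteq> y' \<Longrightarrow> \<delta> * card P \<le> card {x \<in> P. R x y \<noteq> R x y'}"
  shows "\<exists>Z\<subseteq>P. card Z \<le> r \<and>
    real (card {p \<in> Q \<times> Q. fst p \<noteq> snd p \<and> (\<forall>x\<in>Z. R x (fst p) = R x (snd p))}) \<le> (1 - \<delta>) ^ r * (real (card Q))\<^sup>2"
proof (induction r)
  case 0
  have "card {p \<in> Q \<times> Q. fst p \<noteq> snd p} \<le> card (Q \<times> Q)" using Q by (intro card_mono) auto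
  also have "\<dots> = card Q * card Q" by (simp add: card_cartesian_product)
  finally have "real (card {p \<in> Q \<times> Q. fst p \<noteq> snd p}) \<le> (real (card Q))\<^sup>2"
    by (metis of_nat_le_iff of_nat_mult power2_eq_square)
  then show ?case by (intro exI [of _ "{}"]) simp
next
  case (Suc r)
  define D where "D Z = {p \<in> Q \<times> Q. fst p \<noteq> snd p \<and> (\<forall>x\<in>Z. R x (fst p) = R x (snd p))}" for Z
  obtain Z where Z: "Z \<subseteq> P" "card Z \<le> r" "real (card (D Z)) \<le> (1 - \<delta>) ^ r * (real (card Q))\<^sup>2"
    using Suc.IH unfolding D_def by blast
  define N where "N x = {p \<in> D Z. R x (fst p) \<noteq> R x (snd p)}" for x
  have fD: "finite (D Z)" unfolding D_def using Q by simp
  have "\<exists>x\<in>P. \<delta> * card (D Z) \<le> card (N x)"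
  proof (rule ccontr)
    assume "\<not> ?thesis"
    then have lt: "\<And>x. x \<in> P \<Longrightarrow> real (card (N x)) < \<delta> * card (D Z)" by force
    have "card P * (\<delta> * card (D Z)) = (\<Sum>p\<in>D Z. \<delta> * card P)" by simp
    also have "\<dots> \<le> (\<Sum>p\<in>D Z. real (card {x \<in> P. R x (fst p) \<noteq> R x (snd p)}))"
      using sep by (intro sum_mono) (auto simp: D_def)
    also have "\<dots> = real (\<Sum>p\<in>D Z. card {x \<in> P. R x (fst p) \<noteq> R x (snd p)})" by simp
    also have "(\<Sum>p\<in>D Z. card {x \<in> P. R x (fst p) \<noteq> R x (snd p)}) = (\<Sum>x\<in>P. card (N x))"
      unfolding N_def using sum_card_swap [OF fD P(1), of "\<lambda>p x. R x (fst p) \<noteq> R x (snd p)"] .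
    also have "real (\<Sum>x\<in>P. card (N x)) = (\<Sum>x\<in>P. real (card (N x)))" by simp
    also have "\<dots> < (\<Sum>x\<in>P. \<delta> * card (D Z))"
      using lt P by (intro sum_strict_mono) auto
    finally show False by simp
  qed
  then obtain x where x: "x \<in> P" "\<delta> * card (D Z) \<le> card (N x)" by blast
  have "D (insert x Z) = D Z - N x" unfolding D_def N_def by auto
  then have "card (D (insert x Z)) = card (D Z) - card (N x)"
    using fD by (simp add: card_Diff_subset N_def)
  moreover have "card (N x) \<le> card (D Z)" using fD by (intro card_mono) (auto simp: N_def)
  ultimately have "real (card (D (insert x Z))) \<le> (1 - \<delta>) * card (D Z)"
    using x(2) by (simp add: of_nat_diff algebra_simps)
  also have "\<dots> \<le> (1 - \<delta>) * ((1 - \<delta>) ^ r * (real (card Q))\<^sup>2)"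
    using Z(3) \<delta> by (intro mult_left_mono) auto
  finally have "real (card (D (insert x Z))) \<le> (1 - \<delta>) ^ Suc r * (real (card Q))\<^sup>2" by simp
  moreover have "card (insert x Z) \<le> Suc r"
    using Z(2) card_insert_le_m1 [of "Suc r" Z x] by simp
  ultimately show ?case
    using Z(1) x(1) unfolding D_def by (intro exI [of _ "insert x Z"]) auto
qed

text \<open>Taking a root of order \<open>2 * (K + 1)\<close> reduces the claim to the limit 0 of
  \<open>(r + 1) * s ^ r\<close> for \<open>s < 1\<close>. The choice of \<open>r\<close> depends on
  \<delta> and \<open>K\<close> alone, which keeps the later constants absolute.\<close>

lemma exponential_beats_polynomial:
  fixes \<delta> :: real
  assumes "0 < \<delta>" "\<delta> \<le> 1"
  shows "\<exists>r. (1 - \<delta>) ^ r * (real ((r + 1) ^ (K + 1) + 1))\<^sup>2 < 1"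
proof -
  define w where "w = 2 * (K + 1)"
  define s where "s = root w (1 - \<delta>)"
  have w: "0 < w" unfolding w_def by simp
  have s: "0 \<le> s" "s < 1" "s ^ w = 1 - \<delta>"
    using assms w unfolding s_def by (simp_all add: real_root_pow_pos2)
  have "(\<lambda>n. real n * s ^ n) \<longlonglongrightarrow> 0" using s by (intro powser_times_n_limit_0) auto
  moreover have "(\<lambda>n. s ^ n) \<longlonglongrightarrow> 0" using s by (intro LIMSEQ_realpow_zero) auto
  ultimately have "(\<lambda>n. real n * s ^ n + s ^ n) \<longlonglongrightarrow> 0 + 0" by (rule tendsto_add)
  then have "(\<lambda>n. 4 * (real n * s ^ n + s ^ n) ^ w) \<longlonglongrightarrow> 4 * (0 + 0) ^ w"
    by (intro tendsto_mult tendsto_const tendsto_power)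
  moreover have "4 * (0 + 0) ^ w = (0::real)" using w by simp
  ultimately have "(\<lambda>n. 4 * (real n * s ^ n + s ^ n) ^ w) \<longlonglongrightarrow> 0" by (simp only:)
  then have "eventually (\<lambda>n. 4 * (real n * s ^ n + s ^ n) ^ w < 1) sequentially"
    by (rule order_tendstoD) simp
  then obtain r where r: "4 * (real r * s ^ r + s ^ r) ^ w < 1"
    by (meson eventually_sequentially le_refl)
  have "real ((r + 1) ^ (K + 1) + 1) \<le> 2 * (real r + 1) ^ (K + 1)"
  proof -
    have "(1::real) \<le> (real r + 1) ^ (K + 1)" by (rule one_le_power) simp
    moreover have "real ((r + 1) ^ (K + 1) + 1) = (real r + 1) ^ (K + 1) + 1"
      by (simp only: of_nat_add of_nat_power of_nat_1)
    ultimately show ?thesis by linarith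
  qed
  then have "(real ((r + 1) ^ (K + 1) + 1))\<^sup>2 \<le> (2 * (real r + 1) ^ (K + 1))\<^sup>2"
    by (intro power_mono) auto
  also have "\<dots> = 4 * (real r + 1) ^ ((K + 1) * 2)"
    unfolding power_mult_distrib power_mult by simp
  also have "(K + 1) * 2 = w" unfolding w_def by simp
  finally have "(1 - \<delta>) ^ r * (real ((r + 1) ^ (K + 1) + 1))\<^sup>2 \<le> (s ^ w) ^ r * (4 * (real r + 1) ^ w)"
    unfolding s(3) using assms(2) by (intro mult_left_mono) auto
  also have "\<dots> = 4 * (real r * s ^ r + s ^ r) ^ w"
  proof -
    have "real r * s ^ r + s ^ r = (real r + 1) * s ^ r" by (simp add: algebra_simps)
    then show ?thesis by (simp add: power_mult_distrib power_mult [symmetric] mult.commute)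
  qed
  finally show ?thesis using r by (intro exI [of _ r]) linarith
qed

text \<open>A packing bound in the style of Haussler. With one more set, \<open>r\<close> points
  would leave less than one pair undistinguished, hence none, and the sets would have more traces on
  these points than the trace bound permits.\<close>

lemma separated_card_le:
  fixes \<delta> :: real
  assumes P: "finite P" "P \<noteq> {}" and Q: "finite Q" and lin: "linear_delaunay K P Q R" and \<delta>: "\<delta> \<le> 1"
    and sep: "\<And>y y'. y \<in> Q \<Longrightarrow> y' \<in> Q \<Longrightarrow> y \<noteq> y' \<Longrightarrow> \<delta> * card P \<le> card {x \<in> P. R x y \<noteq> R x y'}"
    and r: "(1 - \<delta>) ^ r * (real ((r + 1) ^ (K + 1) + 1))\<^sup>2 < 1"
  shows "card Q \<le> (r + 1) ^ (K + 1)"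
proof (rule ccontr)
  assume "\<not> ?thesis"
  then obtain Q' where Q': "Q' \<subseteq> Q" "card Q' = (r + 1) ^ (K + 1) + 1" "finite Q'"
    by (metis Suc_eq_plus1 Suc_leI not_le obtain_subset_with_card_n)
  define D where "D Z = {p \<in> Q' \<times> Q'. fst p \<noteq> snd p \<and> (\<forall>x\<in>Z. R x (fst p) = R x (snd p))}" for Z
  have "\<exists>Z\<subseteq>P. card Z \<le> r \<and> real (card (D Z)) \<le> (1 - \<delta>) ^ r * (real (card Q'))\<^sup>2"
    unfolding D_def using Q'(1) sep by (intro exists_distinguishing_set [OF P Q'(3) \<delta>]) blast
  then obtain Z where Z: "Z \<subseteq> P" "card Z \<le> r" "real (card (D Z)) \<le> (1 - \<delta>) ^ r * (real (card Q'))\<^sup>2"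
    by blast
  have "real (card (D Z)) < 1" using Z(3) r unfolding Q'(2) by linarith
  moreover have "finite (D Z)" unfolding D_def using Q'(3) by simp
  ultimately have D0: "D Z = {}" by simp
  have "inj_on (\<lambda>y. {x \<in> Z. R x y}) Q'"
  proof (rule inj_onI, rule ccontr)
    fix y y' assume y: "y \<in> Q'" "y' \<in> Q'" "{x \<in> Z. R x y} = {x \<in> Z. R x y'}" "y \<noteq> y'"
    then have "(y, y') \<in> D Z" unfolding D_def by auto
    then show False using D0 by blast
  qed
  then have "card Q' = card ((\<lambda>y. {x \<in> Z. R x y}) ` Q')" by (simp add: card_image)
  also have "\<dots> \<le> (card Z + 1) ^ (K + 1)"
    by (rule card_traces_le [OF linear_delaunay_mono [OF lin P(1) order_refl Q'(1) order_refl] Z(1) P(1)])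
  also have "\<dots> \<le> (r + 1) ^ (K + 1)" using Z(2) by (intro power_mono) auto
  finally show False using Q'(2) by simp
qed

section \<open>Bicliques in dense systems\<close>

lemma fibre_pigeonhole:
  assumes "finite X" "finite Y" "f ` X \<subseteq> Y" "card Y * m < card X"
  obtains y where "m < card {x \<in> X. f x = y}"
proof -
  have "\<exists>y. m < card {x \<in> X. f x = y}"
  proof (rule ccontr)
    assume "\<not> ?thesis"
    then have le: "\<And>y. card {x \<in> X. f x = y} \<le> m" by (meson not_le)
    have "card X = (\<Sum>y\<in>Y. card {x \<in> X. f x = y})"
      using sum.group [OF assms(1,2,3), of "\<lambda>_. 1::nat"] by simp
    also have "\<dots> \<le> card Y * m" using sum_bounded_above [of Y _ m] le by simp
    finally show False using assms(4) by simp
  qed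
  then show thesis using that by blast
qed

definition biclique :: "nat \<Rightarrow> 'a set \<Rightarrow> 'b set \<Rightarrow> ('a \<Rightarrow> 'b \<Rightarrow> bool) \<Rightarrow> bool" where
  "biclique t P Q R \<longleftrightarrow> (\<exists>S T. S \<subseteq> P \<and> T \<subseteq> Q \<and> card S = t \<and> card T = t \<and> (\<forall>x\<in>S. \<forall>y\<in>T. R x y))"

lemma biclique_mono:
  assumes "biclique t P Q R" "P \<subseteq> P'" "Q \<subseteq> Q'"
  shows "biclique t P' Q' R"
proof -
  obtain S T where "S \<subseteq> P" "T \<subseteq> Q" and ST: "card S = t" "card T = t" "\<forall>x\<in>S. \<forall>y\<in>T. R x y"
    using assms(1) unfolding biclique_def by blast
  then have "S \<subseteq> P'" "T \<subseteq> Q'" using assms(2,3) by blast+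
  then show ?thesis unfolding biclique_def using ST by blast
qed

text \<open>The sets \<open>{x \<in> S. \<not> R x y}\<close> are shallow; grouping them by their first element in the
  ranking of the complementary system confines every group to \<open>O(k)\<close> points of \<open>S\<close>.\<close>

lemma biclique_if_almost_complete:
  assumes S: "finite S" and Q: "finite Q" and lin: "linear_delaunay K S Q (\<lambda>x y. \<not> R x y)" and k: "1 \<le> k"
    and miss: "\<And>y. y \<in> Q \<Longrightarrow> card {x \<in> S. \<not> R x y} \<le> k"
    and t: "1 \<le> t" "t + 4 * K * k + 1 \<le> card S" "t * (card S + 1) \<le> card Q"
  shows "biclique t S Q R"
proof -
  obtain g :: "'a \<Rightarrow> nat" where g: "inj_on g S"
    "\<And>x. x \<in> S \<Longrightarrow> card {z \<in> S. (x, z) \<in> shallow_pairs S Q (\<lambda>x y. \<not> R x y) k \<and> g x < g z} \<le> 4 * K * k"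
    using shallow_ranking [OF S lin k] by blast
  define N where "N x = {z \<in> S. (x, z) \<in> shallow_pairs S Q (\<lambda>x y. \<not> R x y) k \<and> g x < g z}" for x
  define C where "C y = {x \<in> S. \<not> R x y}" for y
  \<comment> \<open>\<open>None\<close> labels the sets that miss nothing, so there are
    \<open>card S + 1\<close> groups.\<close>
  define f where "f y = (if C y = {} then None else Some (arg_min_on g (C y)))" for y
  have fC: "finite (C y)" for y unfolding C_def using S by simp
  have first: "arg_min_on g (C y) \<in> C y \<and> C y \<subseteq> insert (arg_min_on g (C y)) (N (arg_min_on g (C y)))"
    if y: "y \<in> Q" "C y \<noteq> {}" for y
  proof -
    define x where "x = arg_min_on g (C y)"
    have x: "x \<in> C y" unfolding x_def using fC y(2) by (rule arg_min_if_finite)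
    have "z \<in> N x" if z: "z \<in> C y" "z \<noteq> x" for z
    proof -
      have "\<not> g z < g x" using arg_min_if_finite(2) [OF fC y(2), of g] z(1) unfolding x_def by blast
      moreover have "g z \<noteq> g x" using g(1) x z unfolding C_def inj_on_def by blast
      moreover have "(x, z) \<in> shallow_pairs S Q (\<lambda>x y. \<not> R x y) k"
        using x z y(1) miss [OF y(1)] unfolding C_def shallow_pairs_def by auto
      ultimately show ?thesis using z(1) unfolding N_def C_def by simp
    qed
    then show ?thesis using x unfolding x_def [symmetric] by blast
  qed
  have "f ` Q \<subseteq> insert None (Some ` S)"
    using first unfolding f_def C_def by auto
  moreover have "card (insert None (Some ` S)) * (t - 1) < card Q"
  proof -
    have "card (insert None (Some ` S)) = card S + 1"
      using S by (subst card_insert_disjoint) (auto simp: card_image)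
    moreover have "(card S + 1) * (t - 1) < (card S + 1) * t" using t(1) by (intro mult_strict_left_mono) auto
    ultimately show ?thesis using t(3) by (simp add: mult.commute)
  qed
  ultimately obtain v where v: "t - 1 < card {y \<in> Q. f y = v}"
    using fibre_pigeonhole [of Q "insert None (Some ` S)" f "t - 1"] S Q by auto
  then have "t \<le> card {y \<in> Q. f y = v}" by simp
  then obtain T where T: "T \<subseteq> {y \<in> Q. f y = v}" "card T = t"
    by (meson obtain_subset_with_card_n)
  \<comment> \<open>\<open>U\<close> contains whatever a member of the group misses, so the rest of
    \<open>S\<close> is completely joined to \<open>T\<close>.\<close>
  define U where "U = (case v of None \<Rightarrow> {} | Some x \<Rightarrow> insert x (N x))"
  have U: "C y \<subseteq> U" if "y \<in> T" for y
  proof (cases "C y = {}")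
    case False
    have y: "y \<in> Q" "f y = v" using T(1) that by auto
    then have "v = Some (arg_min_on g (C y))" using False unfolding f_def by simp
    then show ?thesis using first [OF y(1) False] unfolding U_def by simp
  qed simp
  have "card (U \<inter> S) \<le> 4 * K * k + 1"
  proof (cases v)
    case (Some x)
    show ?thesis
    proof (cases "x \<in> S")
      case True
      have "card (U \<inter> S) \<le> card (insert x (N x))"
        unfolding U_def Some using S by (intro card_mono) (auto simp: N_def)
      also have "\<dots> \<le> card (N x) + 1" by (simp add: card_insert_le_m1)
      finally show ?thesis using g(2) [OF True] unfolding N_def by linarith
    next
      case False
      \<comment> \<open>No group carries a label outside \<open>S\<close>, so in this case
        \<open>T\<close> would be empty.\<close>
      have "f y \<noteq> v" if "y \<in> Q" for y
        using first [OF that] False unfolding f_def Some C_def by (auto split: if_splits)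
      then have "T = {}" using T(1) by blast
      then show ?thesis using T(2) t(1) by simp
    qed
  qed (simp add: U_def)
  moreover have "card (S - U) = card S - card (U \<inter> S)"
    using S by (metis card_Diff_subset_Int finite_Int Int_commute)
  ultimately have "t \<le> card (S - U)" using t(2) by linarith
  then obtain S' where S': "S' \<subseteq> S - U" "card S' = t"
    by (meson obtain_subset_with_card_n)
  have "R x y" if "x \<in> S'" "y \<in> T" for x y
    using S'(1) U [OF that(2)] that(1) unfolding C_def by blast
  then show ?thesis
    unfolding biclique_def using S' T by (intro exI [of _ S'] exI [of _ T]) blast
qed

text \<open>A maximal separated subfamily has at most \<open>M\<close> members by the packing bound,
  so a large class of \<open>Q\<close> is close to a single \<open>y0\<close>. Its members miss
  fewer than \<open>\<delta> * s\<close> of the at least \<open>\<epsilon> * s\<close> points of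
  \<open>y0\<close>, so the class is almost complete on these points.\<close>

lemma biclique_if_dense:
  fixes \<epsilon> :: real and K :: nat
  assumes \<epsilon>: "0 < \<epsilon>" "\<epsilon> \<le> 1"
  obtains c :: nat where "1 \<le> c"
    "\<And>(P::'a set) (Q::'b set) R t. finite P \<Longrightarrow> finite Q \<Longrightarrow> linear_delaunay K P Q R \<Longrightarrow>
       linear_delaunay K P Q (\<lambda>x y. \<not> R x y) \<Longrightarrow> 1 \<le> t \<Longrightarrow> c * t \<le> card P \<Longrightarrow> c * t * card P \<le> card Q \<Longrightarrow>
       (\<And>y. y \<in> Q \<Longrightarrow> \<epsilon> * card P \<le> card {x \<in> P. R x y}) \<Longrightarrow> biclique t P Q R"
proof -
  \<comment> \<open>Chosen so that \<open>4 * K * \<delta> * s\<close> is at most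
    \<open>\<epsilon> * s / 2\<close>; the other half leaves room for \<open>t + 1\<close>.\<close>
  define \<delta> where "\<delta> = \<epsilon> / (8 * (K + 1))"
  have \<delta>: "0 < \<delta>" "\<delta> \<le> 1"
    using \<epsilon> unfolding \<delta>_def by (auto simp: divide_simps)
  obtain r where r: "(1 - \<delta>) ^ r * (real ((r + 1) ^ (K + 1) + 1))\<^sup>2 < 1"
    using exponential_beats_polynomial [OF \<delta>] by blast
  define M where "M = (r + 1) ^ (K + 1)"
  \<comment> \<open>The summands serve the pigeonhole over \<open>M\<close> classes, the bound
    \<open>4 * t \<le> \<epsilon> * s\<close>, and \<open>1 \<le> \<delta> * s\<close>, which makes
    \<open>k\<close> positive.\<close>
  define c where "c = 2 * M + nat \<lceil>4 / \<epsilon>\<rceil> + nat \<lceil>1 / \<delta>\<rceil>"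
  have M: "1 \<le> M" unfolding M_def by (rule one_le_power) simp
  have c: "2 * M \<le> c" "4 / \<epsilon> \<le> c" "1 / \<delta> \<le> c"
  proof -
    have "4 / \<epsilon> \<le> real (nat \<lceil>4 / \<epsilon>\<rceil>)" "1 / \<delta> \<le> real (nat \<lceil>1 / \<delta>\<rceil>)" by linarith+
    then show "4 / \<epsilon> \<le> c" "1 / \<delta> \<le> c" unfolding c_def by simp_all
  qed (simp add: c_def)
  show thesis
  proof (rule that [of c])
    show "1 \<le> c" using c(1) M by linarith
  next
    fix P :: "'a set" and Q :: "'b set" and R t
    assume P: "finite P" and Q: "finite Q" and lin: "linear_delaunay K P Q R"
      and lin': "linear_delaunay K P Q (\<lambda>x y. \<not> R x y)" and t: "1 \<le> t"
      and ctP: "c * t \<le> card P" and ctQ: "c * t * card P \<le> card Q"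
      and dense: "\<And>y. y \<in> Q \<Longrightarrow> \<epsilon> * card P \<le> card {x \<in> P. R x y}"
    define s where "s = card P"
    define dist where "dist y y' = card {x \<in> P. R x y \<noteq> R x y'}" for y y'
    have "1 \<le> c" using c(1) M by linarith
    then have s1: "1 \<le> s" using ctP t unfolding s_def by (metis le_trans mult_le_mono nat_mult_1)
    then have P0: "P \<noteq> {}" unfolding s_def by auto
    have s: "4 * real t \<le> \<epsilon> * s" "1 \<le> \<delta> * s"
    proof -
      have cts: "real c * real t \<le> real s" using ctP unfolding s_def by (metis of_nat_le_iff of_nat_mult)
      have "4 / \<epsilon> * real t \<le> real c * real t" using c(2) by (intro mult_right_mono) auto
      then have "4 / \<epsilon> * real t \<le> real s" using cts by linarith
      then show "4 * real t \<le> \<epsilon> * s" using \<epsilon> by (simp add: field_simps)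
      have "1 / \<delta> * 1 \<le> real c * real t" using c(3) t \<delta> by (intro mult_mono) auto
      then have "1 / \<delta> \<le> real s" using cts by linarith
      then show "1 \<le> \<delta> * s" using \<delta> by (simp add: field_simps)
    qed
    define sepd where "sepd Q' \<longleftrightarrow> Q' \<subseteq> Q \<and> (\<forall>y\<in>Q'. \<forall>y'\<in>Q'. y \<noteq> y' \<longrightarrow> \<delta> * s \<le> dist y y')" for Q'
    have "finite {Q'. sepd Q'}" using Q by (rule_tac finite_subset [of _ "Pow Q"]) (auto simp: sepd_def)
    moreover have "sepd {}" unfolding sepd_def by simp
    ultimately obtain Q0 where Q0: "sepd Q0" and maxQ0: "\<And>Q'. sepd Q' \<Longrightarrow> Q0 \<subseteq> Q' \<Longrightarrow> Q0 = Q'"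
      using finite_has_maximal [of "{Q'. sepd Q'}"] by blast
    have Q0Q: "Q0 \<subseteq> Q" using Q0 unfolding sepd_def by blast
    have fQ0: "finite Q0" using Q0Q Q by (rule finite_subset)
    have cQ0: "card Q0 \<le> M"
      unfolding M_def
    proof (rule separated_card_le [OF P P0 fQ0 _ \<delta>(2) _ r])
      show "linear_delaunay K P Q0 R" by (rule linear_delaunay_mono [OF lin P order_refl Q0Q order_refl])
      show "\<delta> * card P \<le> card {x \<in> P. R x y \<noteq> R x y'}" if "y \<in> Q0" "y' \<in> Q0" "y \<noteq> y'" for y y'
        using Q0 that unfolding sepd_def dist_def s_def by blast
    qed
    have dist_sym: "dist y y' = dist y' y" for y y'
      unfolding dist_def by (rule arg_cong [of _ _ card]) auto
    have near: "\<exists>y0\<in>Q0. dist y0 y < \<delta> * s" if y: "y \<in> Q" for y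
    proof (rule ccontr)
      assume far: "\<not> ?thesis"
      have "dist y y = 0" unfolding dist_def by simp
      then have "y \<notin> Q0" using far s(2) by force
      moreover have "sepd (insert y Q0)"
      proof -
        have far': "\<delta> * s \<le> dist y0 y" "\<delta> * s \<le> dist y y0" if "y0 \<in> Q0" for y0
          using far that dist_sym [of y y0] by (auto simp: not_less)
        have old: "\<delta> * s \<le> dist u u'" if "u \<in> Q0" "u' \<in> Q0" "u \<noteq> u'" for u u'
          using Q0 that unfolding sepd_def by blast
        have "\<delta> * s \<le> dist u u'" if "u \<in> insert y Q0" "u' \<in> insert y Q0" "u \<noteq> u'" for u u'
          using that far' old by (elim insertE) auto
        then show ?thesis using y Q0Q unfolding sepd_def by blast
      qed
      ultimately show False using maxQ0 [of "insert y Q0"] by blast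
    qed
    define \<phi> where "\<phi> y = (SOME y0. y0 \<in> Q0 \<and> dist y0 y < \<delta> * s)" for y
    have \<phi>: "\<phi> y \<in> Q0 \<and> dist (\<phi> y) y < \<delta> * s" if "y \<in> Q" for y
    proof -
      have "\<exists>y0. y0 \<in> Q0 \<and> dist y0 y < \<delta> * s" using near [OF that] by blast
      then show ?thesis unfolding \<phi>_def by (rule someI_ex)
    qed
    have tsQ: "2 * M * (t * s) \<le> card Q"
    proof -
      have "2 * M * (t * s) \<le> c * (t * s)" using c(1) by (rule mult_le_mono1)
      also have "\<dots> \<le> card Q" using ctQ unfolding s_def by (simp only: mult.assoc)
      finally show ?thesis .
    qed
    have ts1: "t * (s + 1) \<le> 2 * (t * s)" using s1 by simp
    have ts0: "0 < t * (s + 1)" using t by simp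
    have "card Q0 * (t * (s + 1) - 1) < card Q"
    proof -
      have "card Q0 * (t * (s + 1) - 1) \<le> M * (t * (s + 1) - 1)" using cQ0 by (rule mult_le_mono1)
      also have "\<dots> < M * (t * (s + 1))" using M ts0 by (intro mult_strict_left_mono) auto
      also have "\<dots> \<le> M * (2 * (t * s))" using ts1 by (rule mult_le_mono2)
      finally show ?thesis using tsQ by (simp add: mult_ac)
    qed
    then obtain y0 where "t * (s + 1) - 1 < card {y \<in> Q. \<phi> y = y0}"
      using fibre_pigeonhole [of Q Q0 \<phi> "t * (s + 1) - 1"] Q fQ0 \<phi> by blast
    then have big: "t * (s + 1) \<le> card {y \<in> Q. \<phi> y = y0}" by simp
    define Q1 where "Q1 = {y \<in> Q. \<phi> y = y0}"
    have "0 < card Q1" using big ts0 unfolding Q1_def by linarith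
    then have "Q1 \<noteq> {}" by auto
    then have y0: "y0 \<in> Q" using \<phi> Q0Q unfolding Q1_def by blast
    define S where "S = {x \<in> P. R x y0}"
    have fS: "finite S" "S \<subseteq> P" using P unfolding S_def by auto
    define k where "k = nat \<lfloor>\<delta> * s\<rfloor>"
    have k: "1 \<le> k" "real k \<le> \<delta> * s" using s(2) unfolding k_def by linarith+
    have "biclique t S Q1 R"
    proof (rule biclique_if_almost_complete [OF fS(1) _ _ k(1)])
      show "finite Q1" using Q unfolding Q1_def by simp
      show "linear_delaunay K S Q1 (\<lambda>x y. \<not> R x y)"
        by (rule linear_delaunay_mono [OF lin' P fS(2)]) (auto simp: Q1_def)
      show "card {x \<in> S. \<not> R x y} \<le> k" if y: "y \<in> Q1" for y
      proof -
        have "card {x \<in> S. \<not> R x y} \<le> dist y0 y"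
          unfolding dist_def S_def using P by (intro card_mono) auto
        moreover have "real (dist y0 y) < \<delta> * s" using \<phi> y unfolding Q1_def by blast
        ultimately show ?thesis unfolding k_def by linarith
      qed
      have "4 * real K * real k \<le> 4 * real K * (\<delta> * s)" using k(2) by (intro mult_left_mono) auto
      also have "\<dots> \<le> \<epsilon> * s / 2"
      proof -
        have "8 * real K * \<delta> \<le> \<epsilon>"
          unfolding \<delta>_def using \<epsilon> by (simp add: divide_simps)
        then have "8 * real K * \<delta> * s \<le> \<epsilon> * s" by (intro mult_right_mono) auto
        then show ?thesis by simp
      qed
      finally have "real t + 4 * real K * real k + 1 \<le> \<epsilon> * s"
        using s(1) t by linarith
      also have "\<dots> \<le> card S" using dense [OF y0] unfolding S_def s_def .
      finally have "real (t + 4 * K * k + 1) \<le> real (card S)" by simp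
      then show "t + 4 * K * k + 1 \<le> card S" by (simp only: of_nat_le_iff)
      have "card S \<le> s" unfolding s_def using P fS(2) by (rule card_mono)
      then have "t * (card S + 1) \<le> t * (s + 1)" by simp
      then show "t * (card S + 1) \<le> card Q1" using big unfolding Q1_def by linarith
    qed (rule t)
    then show "biclique t P Q R"
      using fS(2) by (rule biclique_mono) (auto simp: Q1_def)
  qed
qed

text \<open>The average density is at least \<open>1 / (32 * K)\<close>. Sets below half of that
  contribute at most half of the sum, so at least \<open>card Q / (64 * K)\<close> sets are dense.
  The number 32 arises from sets with at least \<open>k / 4\<close> elements among at most
  \<open>8 * K * k\<close> points.\<close>

lemma biclique_if_dense_on_average:
  fixes K :: nat
  assumes K: "1 \<le> K"
  obtains c d :: nat where "1 \<le> c" "1 \<le> d"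
    "\<And>(P::'a set) (Q::'b set) R t. finite P \<Longrightarrow> finite Q \<Longrightarrow> linear_delaunay K P Q R \<Longrightarrow>
       linear_delaunay K P Q (\<lambda>x y. \<not> R x y) \<Longrightarrow> 1 \<le> t \<Longrightarrow> card P = c * t \<Longrightarrow> d * t ^ 2 \<le> card Q \<Longrightarrow>
       card P * card Q \<le> 32 * K * (\<Sum>y\<in>Q. card {x \<in> P. R x y}) \<Longrightarrow> biclique t P Q R"
proof -
  define \<epsilon> :: real where "\<epsilon> = 1 / (64 * K)"
  have \<epsilon>: "0 < \<epsilon>" "\<epsilon> \<le> 1" "32 * real K * \<epsilon> = 1 / 2" using K unfolding \<epsilon>_def by (auto simp: divide_simps)
  obtain c :: nat where c: "1 \<le> c"
    and bic: "\<And>(P::'a set) (Q::'b set) R t. finite P \<Longrightarrow> finite Q \<Longrightarrow> linear_delaunay K P Q R \<Longrightarrow>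
       linear_delaunay K P Q (\<lambda>x y. \<not> R x y) \<Longrightarrow> 1 \<le> t \<Longrightarrow> c * t \<le> card P \<Longrightarrow> c * t * card P \<le> card Q \<Longrightarrow>
       (\<And>y. y \<in> Q \<Longrightarrow> \<epsilon> * card P \<le> card {x \<in> P. R x y}) \<Longrightarrow> biclique t P Q R"
    using biclique_if_dense [OF \<epsilon>(1,2), of K] by blast
  show thesis
  proof (rule that [of c "64 * K * c ^ 2"])
    show "1 \<le> c" by (rule c)
    show "1 \<le> 64 * K * c ^ 2" using K c by simp
  next
    fix P :: "'a set" and Q :: "'b set" and R t
    assume P: "finite P" and Q: "finite Q" and lin: "linear_delaunay K P Q R"
      and lin': "linear_delaunay K P Q (\<lambda>x y. \<not> R x y)" and t: "1 \<le> t" and cP: "card P = c * t"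
      and cQ: "64 * K * c ^ 2 * t ^ 2 \<le> card Q"
      and avg: "card P * card Q \<le> 32 * K * (\<Sum>y\<in>Q. card {x \<in> P. R x y})"
    define s where "s = card P"
    have s: "0 < s" using cP c t unfolding s_def by simp
    define Q' where "Q' = {y \<in> Q. \<epsilon> * s \<le> card {x \<in> P. R x y}}"
    have Q': "Q' \<subseteq> Q" "finite Q'" using Q unfolding Q'_def by auto
    have "real (\<Sum>y\<in>Q. card {x \<in> P. R x y}) = (\<Sum>y\<in>Q. real (card {x \<in> P. R x y}))" by simp
    also have "\<dots> \<le> (\<Sum>y\<in>Q. (if y \<in> Q' then real s else 0) + \<epsilon> * s)"
    proof (rule sum_mono)
      fix y assume y: "y \<in> Q"
      have "card {x \<in> P. R x y} \<le> s" unfolding s_def using P by (intro card_mono) auto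
      moreover have "0 \<le> \<epsilon> * s" using \<epsilon>(1) by simp
      ultimately show "real (card {x \<in> P. R x y}) \<le> (if y \<in> Q' then real s else 0) + \<epsilon> * s"
        using y unfolding Q'_def by auto
    qed
    also have "\<dots> = real (card Q') * s + \<epsilon> * s * card Q"
      using Q Q' by (simp add: sum.distrib sum.If_cases Int_absorb1)
    finally have "32 * real K * real (\<Sum>y\<in>Q. card {x \<in> P. R x y}) \<le> 32 * real K * (real (card Q') * s + \<epsilon> * s * card Q)"
      by (intro mult_left_mono) auto
    also have "\<dots> = 32 * real K * card Q' * s + (32 * real K * \<epsilon>) * (s * card Q)"
      by (simp add: algebra_simps)
    finally have "32 * real K * real (\<Sum>y\<in>Q. card {x \<in> P. R x y}) \<le> 32 * real K * card Q' * s + real s * card Q / 2"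
      unfolding \<epsilon>(3) by simp
    moreover have "real s * card Q \<le> 32 * real K * real (\<Sum>y\<in>Q. card {x \<in> P. R x y})"
    proof -
      have "real (s * card Q) \<le> real (32 * K * (\<Sum>y\<in>Q. card {x \<in> P. R x y}))"
        using avg unfolding s_def of_nat_le_iff .
      then show ?thesis by simp
    qed
    ultimately have "real s * card Q \<le> real s * (64 * real K * card Q')"
      by (simp add: algebra_simps)
    then have "real (card Q) \<le> 64 * real K * card Q'" using s by simp
    then have "real (card Q) \<le> real (64 * K * card Q')" by simp
    then have "card Q \<le> 64 * K * card Q'" unfolding of_nat_le_iff .
    then have "64 * K * c ^ 2 * t ^ 2 \<le> 64 * K * card Q'" using cQ by linarith
    then have "64 * K * (c ^ 2 * t ^ 2) \<le> 64 * K * card Q'" by (simp only: mult.assoc)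
    then have "c ^ 2 * t ^ 2 \<le> card Q'" using K by simp
    then have "c * t * card P \<le> card Q'" unfolding cP by (simp add: power2_eq_square mult_ac)
    moreover have "linear_delaunay K P Q' R" "linear_delaunay K P Q' (\<lambda>x y. \<not> R x y)"
      by (rule linear_delaunay_mono [OF lin P order_refl Q'(1) order_refl],
          rule linear_delaunay_mono [OF lin' P order_refl Q'(1) order_refl])
    ultimately have "biclique t P Q' R"
      using bic [OF P Q'(2)] t cP unfolding Q'_def s_def by simp
    then show "biclique t P Q R" using Q'(1) by (rule biclique_mono [OF _ order_refl])
  qed
qed

text \<open>Removing a lightest element, one at a time, never lowers the average of
  \<open>f\<close>.\<close>

lemma exists_heavy_subset:
  fixes f :: "'a \<Rightarrow> nat"
  assumes "finite X" "s \<le> card X"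
  shows "\<exists>Z\<subseteq>X. card Z = s \<and> s * (\<Sum>x\<in>X. f x) \<le> card X * (\<Sum>x\<in>Z. f x)"
  using assms(2)
proof (induction s rule: inc_induct)
  case base
  show ?case by (intro exI [of _ X]) simp
next
  case (step s)
  obtain Z where Z: "Z \<subseteq> X" "card Z = Suc s" "Suc s * (\<Sum>x\<in>X. f x) \<le> card X * (\<Sum>x\<in>Z. f x)"
    using step.IH by blast
  have fZ: "finite Z" using Z(1) assms(1) by (rule finite_subset)
  obtain z where z: "z \<in> Z" "\<And>x. x \<in> Z \<Longrightarrow> f z \<le> f x"
    using ex_min_if_finite [of "f ` Z"] fZ Z(2)
    by (metis arg_min_if_finite(1) arg_min_least card_0_eq nat.distinct(1))
  have sumZ: "(\<Sum>x\<in>Z. f x) = f z + (\<Sum>x\<in>Z - {z}. f x)" using fZ z(1) by (rule sum.remove)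
  have "s * f z = (\<Sum>x\<in>Z - {z}. f z)" using Z(2) z(1) fZ by simp
  also have "\<dots> \<le> (\<Sum>x\<in>Z - {z}. f x)" using z(2) by (intro sum_mono) auto
  finally have "s * (\<Sum>x\<in>Z. f x) \<le> Suc s * (\<Sum>x\<in>Z - {z}. f x)"
    unfolding sumZ by (simp add: algebra_simps)
  then have "card X * (s * (\<Sum>x\<in>Z. f x)) \<le> card X * (Suc s * (\<Sum>x\<in>Z - {z}. f x))"
    by (rule mult_le_mono2)
  moreover have "s * (Suc s * (\<Sum>x\<in>X. f x)) \<le> s * (card X * (\<Sum>x\<in>Z. f x))"
    using Z(3) by (rule mult_le_mono2)
  ultimately have "Suc s * (s * (\<Sum>x\<in>X. f x)) \<le> Suc s * (card X * (\<Sum>x\<in>Z - {z}. f x))"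
    by (simp only: mult_ac)
  then have "s * (\<Sum>x\<in>X. f x) \<le> card X * (\<Sum>x\<in>Z - {z}. f x)"
    by (simp only: Suc_mult_le_cancel1)
  then show ?case
    using Z(1,2) z(1) fZ by (intro exI [of _ "Z - {z}"]) auto
qed

text \<open>If each level \<open>i\<close> had fewer than \<open>card Y / 2 ^ (i + 1)\<close>
  members, the levels could not cover \<open>Y\<close>. Weighting by \<open>2 ^ i\<close> makes the
  loss a factor 2 instead of a logarithm.\<close>

lemma exists_dyadic_level:
  fixes f :: "'a \<Rightarrow> nat"
  assumes Y: "finite Y" "Y \<noteq> {}" and k: "1 \<le> k" "\<And>y. y \<in> Y \<Longrightarrow> k \<le> f y"
  obtains k' where "k \<le> k'" "k * card Y \<le> 2 * (k' * card {y \<in> Y. k' \<le> f y \<and> f y \<le> 2 * k'})"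
proof -
  define L where "L i = {y \<in> Y. 2 ^ i * k \<le> f y \<and> f y \<le> 2 * (2 ^ i * k)}" for i
  have "\<exists>i. card Y \<le> 2 * (2 ^ i * card (L i))"
  proof (rule ccontr)
    assume "\<not> ?thesis"
    then have lt: "\<And>i. 2 * (2 ^ i * card (L i)) < card Y" by (meson not_le)
    have lt': "real (card (L i)) \<le> card Y * (1 / 2) ^ Suc i" for i
    proof -
      have "real (2 * (2 ^ i * card (L i))) \<le> card Y" using lt [of i] by linarith
      then show ?thesis by (simp add: field_simps)
    qed
    define n where "n = Suc (Max (f ` Y))"
    have "Y \<subseteq> (\<Union>i<n. L i)"
    proof
      fix y assume y: "y \<in> Y"
      have fn: "f y < n" unfolding n_def using Y y by (simp add: le_imp_less_Suc)
      define i where "i = (GREATEST i. 2 ^ i * k \<le> f y)"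
      have ex: "2 ^ 0 * k \<le> f y" using k(2) [OF y] by simp
      have bd: "j \<le> f y" if "2 ^ j * k \<le> f y" for j
      proof -
        have "j \<le> 2 ^ j" using less_exp [of j] by simp
        also have "\<dots> \<le> 2 ^ j * k" using k(1) by simp
        finally show ?thesis using that by simp
      qed
      have i1: "2 ^ i * k \<le> f y" unfolding i_def using GreatestI_nat [of "\<lambda>i. 2 ^ i * k \<le> f y", OF ex] bd by blast
      have "\<not> 2 ^ Suc i * k \<le> f y"
        using Greatest_le_nat [of "\<lambda>i. 2 ^ i * k \<le> f y" "Suc i"] bd unfolding i_def by (meson Suc_n_not_le_n)
      then have "y \<in> L i" using y i1 unfolding L_def by simp
      moreover have "i < n" using bd [OF i1] fn by simp
      ultimately show "y \<in> (\<Union>i<n. L i)" by blast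
    qed
    then have "card Y \<le> card (\<Union>i<n. L i)" using Y by (intro card_mono) (auto simp: L_def)
    also have "\<dots> \<le> (\<Sum>i<n. card (L i))" by (rule card_UN_le) simp
    finally have "real (card Y) \<le> real (\<Sum>i<n. card (L i))" unfolding of_nat_le_iff .
    also have "\<dots> = (\<Sum>i<n. real (card (L i)))" by simp
    also have "\<dots> \<le> (\<Sum>i<n. card Y * (1 / 2) ^ Suc i)" using lt' by (rule sum_mono)
    also have "\<dots> = card Y * (\<Sum>i<n. (1 / 2) ^ Suc i)" by (simp add: sum_distrib_left)
    also have "(\<Sum>i<n. (1 / 2) ^ Suc i) = 1 - (1 / 2 :: real) ^ n"
      by (induction n) (auto simp: field_simps)
    finally have "real (card Y) * (1 / 2) ^ n \<le> 0" by (simp add: algebra_simps)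
    moreover have "0 < real (card Y) * (1 / 2) ^ n" using Y by (simp add: card_gt_0_iff)
    ultimately show False by linarith
  qed
  then obtain i where i: "card Y \<le> 2 * (2 ^ i * card (L i))" by blast
  show thesis
  proof (rule that [of "2 ^ i * k"])
    show "k \<le> 2 ^ i * k" by simp
    have "k * card Y \<le> k * (2 * (2 ^ i * card (L i)))" using i by (rule mult_le_mono2)
    then show "k * card Y \<le> 2 * (2 ^ i * k * card {y \<in> Y. 2 ^ i * k \<le> f y \<and> f y \<le> 2 * (2 ^ i * k)})"
      unfolding L_def by (simp add: mult_ac)
  qed
qed

section \<open>Incidences\<close>

text \<open>In a system without large bicliques, the first half of the argument bounds the number of
  sets by the number of points and the second half does the converse; with both minimum degrees
  large the two bounds contradict each other.\<close>

lemma biclique_if_min_degrees: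
  fixes K :: nat
  assumes K: "1 \<le> K"
  obtains C D :: nat where "1 \<le> C" "1 \<le> D"
    "\<And>(A::'a set) (B::'b set) R t. finite A \<Longrightarrow> finite B \<Longrightarrow> linear_delaunay K A B R \<Longrightarrow>
       linear_delaunay K A B (\<lambda>x y. \<not> R x y) \<Longrightarrow> linear_delaunay K B A (\<lambda>y x. R x y) \<Longrightarrow> 1 \<le> t \<Longrightarrow>
       A \<noteq> {} \<Longrightarrow> B \<noteq> {} \<Longrightarrow>
       (\<And>y. y \<in> B \<Longrightarrow> C * t \<le> card {x \<in> A. R x y}) \<Longrightarrow>
       (\<And>x. x \<in> A \<Longrightarrow> D * t ^ 2 \<le> card {y \<in> B. R x y}) \<Longrightarrow> biclique t A B R"
proof -
  obtain c d :: nat where cd: "1 \<le> c" "1 \<le> d"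
    and bic: "\<And>(P::'a set) (Q::'b set) R t. finite P \<Longrightarrow> finite Q \<Longrightarrow> linear_delaunay K P Q R \<Longrightarrow>
       linear_delaunay K P Q (\<lambda>x y. \<not> R x y) \<Longrightarrow> 1 \<le> t \<Longrightarrow> card P = c * t \<Longrightarrow> d * t ^ 2 \<le> card Q \<Longrightarrow>
       card P * card Q \<le> 32 * K * (\<Sum>y\<in>Q. card {x \<in> P. R x y}) \<Longrightarrow> biclique t P Q R"
    using biclique_if_dense_on_average [OF K] by blast
  \<comment> \<open>The extra 1 compensates the \<open>+ 1\<close> in
    \<open>dense_neighbourhood\<close>, so that half of a set still has \<open>c * t\<close>
    points.\<close>
  define C where "C = 2 * c + 1"
  \<comment> \<open>The two counts will give \<open>C * D \<le> 16 * c * d\<close>, which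
    \<open>D\<close> alone must exceed; \<open>2 * d + 1\<close> does for the second count what
    \<open>C\<close> does for the first.\<close>
  define D where "D = 16 * c * d + 2 * d + 1"
  show thesis
  proof (rule that [of C D])
    show "1 \<le> C" "1 \<le> D" unfolding C_def D_def by simp_all
  next
    fix A :: "'a set" and B :: "'b set" and R t
    assume A: "finite A" "A \<noteq> {}" and B: "finite B" "B \<noteq> {}" and lin: "linear_delaunay K A B R"
      and lin': "linear_delaunay K A B (\<lambda>x y. \<not> R x y)" and dual: "linear_delaunay K B A (\<lambda>y x. R x y)"
      and t: "1 \<le> t" and degB: "\<And>y. y \<in> B \<Longrightarrow> C * t \<le> card {x \<in> A. R x y}"
      and degA: "\<And>x. x \<in> A \<Longrightarrow> D * t ^ 2 \<le> card {y \<in> B. R x y}"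
    show "biclique t A B R"
    proof (rule ccontr)
      assume no: "\<not> biclique t A B R"
      have bic': False
        if P: "P \<subseteq> A" "card P = c * t" and Q: "Q \<subseteq> B" "d * t ^ 2 \<le> card Q"
          and dense: "card P * card Q \<le> 32 * K * (\<Sum>y\<in>Q. card {x \<in> P. R x y})" for P Q
      proof -
        have fP: "finite P" using P(1) A(1) by (rule finite_subset)
        have fQ: "finite Q" using Q(1) B(1) by (rule finite_subset)
        have "biclique t P Q R"
          by (rule bic [OF fP fQ linear_delaunay_mono [OF lin A(1) P(1) Q(1) order_refl]
                linear_delaunay_mono [OF lin' A(1) P(1) Q(1) order_refl] t P(2) Q(2) dense])
        then show False using no biclique_mono P(1) Q(1) by blast
      qed
      have "C * t * card B \<le> 4 * (card A * (d * t ^ 2))"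
      proof -
        have Ct: "1 \<le> C * t" using t unfolding C_def by simp
        obtain k where k: "C * t \<le> k"
          "C * t * card B \<le> 2 * (k * card {y \<in> B. k \<le> card {x \<in> A. R x y} \<and> card {x \<in> A. R x y} \<le> 2 * k})"
          using exists_dyadic_level [where f = "\<lambda>y. card {x \<in> A. R x y}", OF B Ct degB] by blast
        define Y where "Y = {y \<in> B. k \<le> card {x \<in> A. R x y} \<and> card {x \<in> A. R x y} \<le> 2 * k}"
        have Y: "Y \<subseteq> B" "finite Y" using B(1) unfolding Y_def by auto
        have k1: "1 \<le> k" using k(1) Ct by linarith
        have linY: "linear_delaunay K A Y R"
          by (rule linear_delaunay_mono [OF lin A(1) order_refl Y(1) order_refl])
        obtain P Q where PQ: "P \<subseteq> A" "Q \<subseteq> Y" "card P \<le> 8 * K * k"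
            "\<And>y. y \<in> Q \<Longrightarrow> k \<le> 2 * card {x \<in> P. R x y} + 1" "k * card Y \<le> 2 * (card A * card Q)"
          using dense_neighbourhood [OF A(1) Y(2) linY k1] unfolding Y_def by blast
        have fP: "finite P" using PQ(1) A(1) by (rule finite_subset)
        have fQ: "finite Q" using PQ(2) Y(2) by (rule finite_subset)
        have kc: "2 * (c * t) + 1 \<le> k"
          using k(1) t unfolding C_def by (simp add: algebra_simps)
        have "card Q < d * t ^ 2"
        proof (rule ccontr)
          assume big: "\<not> card Q < d * t ^ 2"
          have "0 < d * t ^ 2" using cd t by simp
          then have "0 < card Q" using big by linarith
          then have "Q \<noteq> {}" by auto
          then obtain y where "y \<in> Q" by blast
          then have "c * t \<le> card {x \<in> P. R x y}" using PQ(4) kc by fastforce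
          also have "\<dots> \<le> card P" using fP by (intro card_mono) auto
          \<comment> \<open>The biclique lemma wants exactly \<open>c * t\<close> points, so
            \<open>P\<close> is thinned without loss of average density.\<close>
          finally obtain P' where P': "P' \<subseteq> P" "card P' = c * t"
            "c * t * (\<Sum>x\<in>P. card {y \<in> Q. R x y}) \<le> card P * (\<Sum>x\<in>P'. card {y \<in> Q. R x y})"
            using exists_heavy_subset [OF fP] by blast
          have fP': "finite P'" using P'(1) fP by (rule finite_subset)
          have "1 \<le> c * t" using cd t by simp
          have "card Q * k = (\<Sum>y\<in>Q. k)" by simp
          also have "\<dots> \<le> (\<Sum>y\<in>Q. 4 * card {x \<in> P. R x y})"
          proof (rule sum_mono)
            fix y assume "y \<in> Q"
            then show "k \<le> 4 * card {x \<in> P. R x y}" using PQ(4) [of y] kc \<open>1 \<le> c * t\<close> by linarith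
          qed
          also have "\<dots> = 4 * (\<Sum>x\<in>P. card {y \<in> Q. R x y})"
            unfolding sum_distrib_left [symmetric] sum_card_swap [OF fP fQ, of R] ..
          finally have "c * t * (card Q * k) \<le> c * t * (4 * (\<Sum>x\<in>P. card {y \<in> Q. R x y}))"
            by (rule mult_le_mono2)
          also have "\<dots> \<le> 4 * (card P * (\<Sum>x\<in>P'. card {y \<in> Q. R x y}))" using P'(3) by simp
          also have "\<dots> \<le> 4 * (8 * K * k * (\<Sum>x\<in>P'. card {y \<in> Q. R x y}))"
            using PQ(3) by (intro mult_le_mono) auto
          finally have "k * (card P' * card Q) \<le> k * (32 * K * (\<Sum>y\<in>Q. card {x \<in> P'. R x y}))"
            unfolding sum_card_swap [OF fP' fQ, of R] P'(2) by (simp add: mult_ac)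
          then have "card P' * card Q \<le> 32 * K * (\<Sum>y\<in>Q. card {x \<in> P'. R x y})" using k1 by simp
          moreover have "P' \<subseteq> A" "Q \<subseteq> B" "d * t ^ 2 \<le> card Q" using P'(1) PQ(1,2) Y(1) big by auto
          ultimately show False using bic' P'(2) by blast
        qed
        then have "card A * card Q \<le> card A * (d * t ^ 2)" by (intro mult_le_mono2) simp
        then show ?thesis using k(2) PQ(5) unfolding Y_def by linarith
      qed
      moreover have "D * t ^ 2 * card A \<le> 4 * (card B * (c * t))"
      proof -
        have "0 < D" "0 < t ^ 2" using t unfolding D_def by simp_all
        then have "0 < D * t ^ 2" by (rule mult_pos_pos)
        then have Dt: "1 \<le> D * t ^ 2" by linarith
        obtain k where k: "D * t ^ 2 \<le> k"
          "D * t ^ 2 * card A \<le> 2 * (k * card {x \<in> A. k \<le> card {y \<in> B. R x y} \<and> card {y \<in> B. R x y} \<le> 2 * k})"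
          using exists_dyadic_level [where f = "\<lambda>x. card {y \<in> B. R x y}", OF A Dt degA] by blast
        define X where "X = {x \<in> A. k \<le> card {y \<in> B. R x y} \<and> card {y \<in> B. R x y} \<le> 2 * k}"
        have X: "X \<subseteq> A" "finite X" using A(1) unfolding X_def by auto
        have k1: "1 \<le> k" using k(1) Dt by linarith
        have linX: "linear_delaunay K B X (\<lambda>y x. R x y)"
          by (rule linear_delaunay_mono [OF dual B(1) order_refl X(1) order_refl])
        obtain Q Z where QZ: "Q \<subseteq> B" "Z \<subseteq> X" "card Q \<le> 8 * K * k"
            "\<And>x. x \<in> Z \<Longrightarrow> k \<le> 2 * card {y \<in> Q. R x y} + 1" "k * card X \<le> 2 * (card B * card Z)"
          using dense_neighbourhood [OF B(1) X(2) linX k1] unfolding X_def by blast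
        have fQ: "finite Q" using QZ(1) B(1) by (rule finite_subset)
        have kd: "2 * (d * t ^ 2) + 1 \<le> k"
        proof -
          have "(2 * d + 1) * t ^ 2 \<le> D * t ^ 2" unfolding D_def by (intro mult_le_mono1) simp
          moreover have "1 \<le> t ^ 2" using t by simp
          moreover have "(2 * d + 1) * t ^ 2 = 2 * (d * t ^ 2) + t ^ 2" by (simp add: algebra_simps)
          ultimately show ?thesis using k(1) by linarith
        qed
        have "card Z < c * t"
        proof (rule ccontr)
          assume "\<not> card Z < c * t"
          \<comment> \<open>Every point of \<open>Z\<close> has at least \<open>k / 4\<close>
            neighbours in \<open>Q\<close>, so any \<open>c * t\<close> of them will do.\<close>
          then obtain P where P: "P \<subseteq> Z" "card P = c * t" "finite P"
            by (metis not_less obtain_subset_with_card_n)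
          have ct: "1 \<le> c * t" using cd t by simp
          then have "P \<noteq> {}" using P(2) by auto
          then obtain x where "x \<in> Z" using P(1) by blast
          then have "d * t ^ 2 \<le> card {y \<in> Q. R x y}" using QZ(4) kd by fastforce
          also have "\<dots> \<le> card Q" using fQ by (intro card_mono) auto
          finally have big: "d * t ^ 2 \<le> card Q" .
          have dt: "1 \<le> d * t ^ 2" using cd t by simp
          have "card P * k = (\<Sum>x\<in>P. k)" by simp
          also have "\<dots> \<le> (\<Sum>x\<in>P. 4 * card {y \<in> Q. R x y})"
          proof (rule sum_mono)
            fix x assume "x \<in> P"
            then have "k \<le> 2 * card {y \<in> Q. R x y} + 1" using QZ(4) P(1) by blast
            then show "k \<le> 4 * card {y \<in> Q. R x y}" using kd dt by linarith
          qed
          also have "\<dots> = 4 * (\<Sum>y\<in>Q. card {x \<in> P. R x y})"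
            unfolding sum_distrib_left [symmetric] sum_card_swap [OF P(3) fQ, of R] ..
          finally have "8 * K * (card P * k) \<le> 8 * K * (4 * (\<Sum>y\<in>Q. card {x \<in> P. R x y}))"
            by (rule mult_le_mono2)
          moreover have "card P * card Q \<le> card P * (8 * K * k)" using QZ(3) by (rule mult_le_mono2)
          moreover have "card P * (8 * K * k) = 8 * K * (card P * k)" by (simp only: mult_ac)
          ultimately have "card P * card Q \<le> 8 * K * (4 * (\<Sum>y\<in>Q. card {x \<in> P. R x y}))"
            by linarith
          then have "card P * card Q \<le> 32 * K * (\<Sum>y\<in>Q. card {x \<in> P. R x y})"
            by simp
          moreover have "P \<subseteq> A" using P(1) QZ(2) X(1) by blast
          ultimately show False using bic' P(2) QZ(1) big by blast
        qed
        then have "card B * card Z \<le> card B * (c * t)" by (intro mult_le_mono2) simp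
        then show ?thesis using k(2) QZ(5) unfolding X_def by linarith
      qed
      ultimately have "(C * t * card B) * (D * t ^ 2 * card A) \<le> (4 * (card A * (d * t ^ 2))) * (4 * (card B * (c * t)))"
        by (rule mult_le_mono)
      \<comment> \<open>In the product of the two counts all dependence on \<open>t\<close>,
        \<open>A\<close> and \<open>B\<close> cancels.\<close>
      then have "(t ^ 3 * card A * card B) * (C * D) \<le> (t ^ 3 * card A * card B) * (16 * c * d)"
        by (simp add: power2_eq_square power3_eq_cube mult_ac)
      moreover have "0 < t ^ 3 * card A * card B" using t A B by (simp add: card_gt_0_iff)
      ultimately have "C * D \<le> 16 * c * d" by simp
      moreover have "1 * D \<le> C * D" unfolding C_def by (intro mult_le_mono1) simp
      ultimately have "D \<le> 16 * c * d" by linarith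
      then show False unfolding D_def by simp
    qed
  qed
qed

text \<open>While both sides are nonempty, some vertex is below its threshold. Deleting it loses
  fewer than \<open>k\<close> incidences for an element of \<open>B\<close> and fewer than
  \<open>d\<close> for one of \<open>A\<close>.\<close>

lemma sum_degrees_le_if_no_core:
  assumes "finite A" "finite B"
    and "\<And>A' B'. A' \<subseteq> A \<Longrightarrow> B' \<subseteq> B \<Longrightarrow> A' \<noteq> {} \<Longrightarrow> B' \<noteq> {} \<Longrightarrow>
      (\<And>y. y \<in> B' \<Longrightarrow> k \<le> card {x \<in> A'. R x y}) \<Longrightarrow>
      (\<And>x. x \<in> A' \<Longrightarrow> d \<le> card {y \<in> B'. R x y}) \<Longrightarrow> False"
  shows "(\<Sum>y\<in>B. card {x \<in> A. R x y}) \<le> d * card A + k * card B"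
  using assms
proof (induction "card A + card B" arbitrary: A B rule: less_induct)
  case less
  note A = less.prems(1) and B = less.prems(2) and no = less.prems(3)
  consider "A = {}" | "B = {}" | y where "y \<in> B" "card {x \<in> A. R x y} < k"
    | x where "x \<in> A" "card {y \<in> B. R x y} < d"
    using no [of A B] by (meson not_less order_refl)
  then show ?case
  proof cases
    case 3
    have less_B: "card (B - {y}) < card B" using B 3(1) by (rule card_Diff1_less)
    have "(\<Sum>y\<in>B - {y}. card {x \<in> A. R x y}) \<le> d * card A + k * card (B - {y})"
    proof (rule less.hyps)
      show "card A + card (B - {y}) < card A + card B" using less_B by simp
      fix A' B' assume sub: "A' \<subseteq> A" "B' \<subseteq> B - {y}"
        and core: "A' \<noteq> {}" "B' \<noteq> {}" "\<And>y. y \<in> B' \<Longrightarrow> k \<le> card {x \<in> A'. R x y}"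
          "\<And>x. x \<in> A' \<Longrightarrow> d \<le> card {y \<in> B'. R x y}"
      have "B' \<subseteq> B" using sub by blast
      then show False by (rule no [OF sub(1) _ core])
    qed (use A B in auto)
    moreover have "(\<Sum>y\<in>B. card {x \<in> A. R x y}) = card {x \<in> A. R x y} + (\<Sum>y\<in>B - {y}. card {x \<in> A. R x y})"
      using B 3(1) by (rule sum.remove)
    moreover have "card B = Suc (card (B - {y}))" by (rule card_Suc_Diff1 [OF B 3(1), symmetric])
    ultimately show ?thesis using 3(2) by simp
  next
    case 4
    have less_A: "card (A - {x}) < card A" using A 4(1) by (rule card_Diff1_less)
    have "(\<Sum>y\<in>B. card {x' \<in> A - {x}. R x' y}) \<le> d * card (A - {x}) + k * card B"
    proof (rule less.hyps)
      show "card (A - {x}) + card B < card A + card B" using less_A by simp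
      fix A' B' assume sub: "A' \<subseteq> A - {x}" "B' \<subseteq> B"
        and core: "A' \<noteq> {}" "B' \<noteq> {}" "\<And>y. y \<in> B' \<Longrightarrow> k \<le> card {x \<in> A'. R x y}"
          "\<And>x. x \<in> A' \<Longrightarrow> d \<le> card {y \<in> B'. R x y}"
      have "A' \<subseteq> A" using sub by blast
      then show False by (rule no [OF _ sub(2) core])
    qed (use A B in auto)
    moreover have "(\<Sum>y\<in>B. card {x' \<in> A. R x' y}) = card {y \<in> B. R x y} + (\<Sum>y\<in>B. card {x' \<in> A - {x}. R x' y})"
      unfolding sum_card_swap [OF A B, of R, symmetric] sum_card_swap [OF finite_Diff [OF A] B, of R, symmetric]
      using A 4(1) by (rule sum.remove)
    moreover have "card A = Suc (card (A - {x}))" by (rule card_Suc_Diff1 [OF A 4(1), symmetric])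
    ultimately show ?thesis using 4(2) by simp
  qed auto
qed

lemma biclique_imp_not_K_free:
  assumes "biclique t A B (\<in>)" "2 \<le> t"
  shows "\<not> K_free t A B (incidence_edges A B)"
proof -
  obtain S T where ST: "S \<subseteq> A" "T \<subseteq> B" "card S = t" "card T = t" "\<forall>x\<in>S. \<forall>y\<in>T. x \<in> y"
    using assms(1) unfolding biclique_def by blast
  moreover have "finite S" "finite T" using ST(3,4) assms(2) by (auto intro: card_ge_0_finite)
  moreover have "S \<times> T \<subseteq> incidence_edges A B" using ST unfolding incidence_edges_def by auto
  ultimately show ?thesis unfolding K_free_def by blast
qed

theorem theorem10:
  "\<exists>C::real. C > 0 \<and>
     (\<forall>(t::nat) (n::nat) (m::nat) (A::complex set) (B::complex set set).
        t \<ge> 2 \<longrightarrow> finite A \<longrightarrow> card A = n \<longrightarrow> finite B \<longrightarrow> card B = m \<longrightarrow> pseudo_discs B \<longrightarrow>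
        K_free t A B (incidence_edges A B) \<longrightarrow>
        real (card (incidence_edges A B)) \<le> C * (real t ^ 4 * real n + real t * real m))"
proof -
  \<comment> \<open>The largest of the Delaunay constants 62, 62 and 2046 serves all three
    systems.\<close>
  define K :: nat where "K = 2046"
  have "1 \<le> K" unfolding K_def by simp
  then obtain C D :: nat where CD: "1 \<le> C" "1 \<le> D"
    and core: "\<And>(A::complex set) (B::complex set set) R t. finite A \<Longrightarrow> finite B \<Longrightarrow> linear_delaunay K A B R \<Longrightarrow>
       linear_delaunay K A B (\<lambda>x y. \<not> R x y) \<Longrightarrow> linear_delaunay K B A (\<lambda>y x. R x y) \<Longrightarrow> 1 \<le> t \<Longrightarrow>
       A \<noteq> {} \<Longrightarrow> B \<noteq> {} \<Longrightarrow>
       (\<And>y. y \<in> B \<Longrightarrow> C * t \<le> card {x \<in> A. R x y}) \<Longrightarrow>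
       (\<And>x. x \<in> A \<Longrightarrow> D * t ^ 2 \<le> card {y \<in> B. R x y}) \<Longrightarrow> biclique t A B R"
    using biclique_if_min_degrees [of K] by blast
  have bound: "real (card (incidence_edges A B)) \<le> real (C + D) * (real t ^ 4 * real (card A) + real t * real (card B))"
    if t: "2 \<le> t" and A: "finite A" and B: "finite B" and pd: "pseudo_discs B"
      and free: "K_free t A B (incidence_edges A B)" for t A B
  proof -
    have "card (incidence_edges A B) = (\<Sum>b\<in>B. card {a \<in> A. a \<in> b})"
    proof -
      have "incidence_edges A B = (\<lambda>(b, a). (a, b)) ` (SIGMA b:B. {a \<in> A. a \<in> b})"
        unfolding incidence_edges_def by auto
      moreover have "inj_on (\<lambda>(b, a). (a, b)) (SIGMA b:B. {a \<in> A. a \<in> b})"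
        by (auto simp: inj_on_def)
      ultimately have "card (incidence_edges A B) = card (SIGMA b:B. {a \<in> A. a \<in> b})"
        by (simp add: card_image)
      then show ?thesis using A B by simp
    qed
    also have "\<dots> \<le> D * t ^ 2 * card A + C * t * card B"
    proof (rule sum_degrees_le_if_no_core [OF A B])
      fix A' B'
      assume A': "A' \<subseteq> A" "A' \<noteq> {}" and B': "B' \<subseteq> B" "B' \<noteq> {}"
        and deg: "\<And>b. b \<in> B' \<Longrightarrow> C * t \<le> card {a \<in> A'. a \<in> b}"
          "\<And>a. a \<in> A' \<Longrightarrow> D * t ^ 2 \<le> card {b \<in> B'. a \<in> b}"
      have K: "62 \<le> K" "2046 \<le> K" unfolding K_def by simp_all
      have fA': "finite A'" using A'(1) A by (rule finite_subset)
      have fB': "finite B'" using B'(1) B by (rule finite_subset)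
      have "biclique t A' B' (\<in>)"
      proof (rule core [OF fA' fB' _ _ _ _ A'(2) B'(2) deg])
        show "linear_delaunay K A' B' (\<in>)"
          by (rule linear_delaunay_mono [OF pseudo_discs_linear_delaunay [OF A pd] A A'(1) B'(1) K(1)])
        show "linear_delaunay K A' B' (\<lambda>x y. x \<notin> y)"
          by (rule linear_delaunay_mono [OF pseudo_discs_linear_delaunay_complement [OF A pd] A A'(1) B'(1) K(1)])
        show "linear_delaunay K B' A' (\<lambda>y x. x \<in> y)"
          by (rule linear_delaunay_mono [OF pseudo_discs_linear_delaunay_dual [OF B pd] B B'(1) A'(1) K(2)])
        show "1 \<le> t" using t by simp
      qed
      then have "biclique t A B (\<in>)" using A'(1) B'(1) by (rule biclique_mono)
      then show False using biclique_imp_not_K_free t free by blast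
    qed
    finally have "real (card (incidence_edges A B)) \<le> real (D * t ^ 2 * card A + C * t * card B)"
      unfolding of_nat_le_iff .
    also have "\<dots> = real D * (real t ^ 2 * card A) + real C * (real t * card B)" by simp
    also have "\<dots> \<le> real (C + D) * (real t ^ 4 * card A) + real (C + D) * (real t * card B)"
    proof (intro add_mono mult_mono)
      show "real t ^ 2 \<le> real t ^ 4" using t by (intro power_increasing) auto
    qed auto
    finally show ?thesis by (simp only: distrib_left)
  qed
  show ?thesis
  proof (intro exI [of _ "real (C + D)"] conjI allI impI)
    show "0 < real (C + D)" using CD by simp
  qed (use bound in blast)
qed

end
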